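(* Let $A$ be an associative (unital) $\Bbbk$-algebra with a $\Bbbk$-linear trace map $\mathrm{tr}\colon A\to\Bbbk$ and (finite) dual bases $B$ and $\{b^\vee:b\in B\}$ of $A$ satisfying $\mathrm{tr}(ab)=\mathrm{tr}(ba)$ for all $a,b\in A$ and $\mathrm{tr}(a^\vee b)=\delta_{a,b}$ for all $a,b\in B$. Let $\mathcal{AW}(A)$ be the affine wreath product category with generating object $\uparrow$ and generating morphisms $s$, $\beta_a$ $(a\in A)$, $x$, and let $d\in\mathbb{N}$. Then $\mathrm{End}_{\mathcal{AW}(A)}(\uparrow^{\otimes d})$ is an affine wreath product algebra; namely, as a $\Bbbk$-algebra it is presented by the generators $$t_i\ (1\le i\le d),\qquad u_i(a)\ (1\le i\le d,\ a\in A),\qquad s_i\ (1\le i\le d-1),$$ given by the endomorphisms $$t_i=1_{\uparrow}^{\otimes(d-i)}\otimes x\otimes1_\uparrow^{\otimes(i-1)},\quad u_i(a)=1_{\uparrow}^{\otimes(d-i)}\otimes\beta_a\otimes1_\uparrow^{\otimes(i-1)},\quad s_i=1_{\uparrow}^{\otimes(d-1-i)}\otimes s\otimes1_\uparrow^{\otimes(i-1)},$$ subject to the relations: (1) $s_is_j=s_js_i$ for $|i-j|>1$; $s_i^2=1$ for $1\le i\le d-1$; $s_{i+1}s_is_{i+1}=s_is_{i+1}s_i$ for $1\le i\le d-2$; (2) $t_it_j=t_jt_i$ for $1\le i,j\le d$; $t_is_j=s_jt_i$ for $1\le i\le d$, $1\le j\le d-1$ with $i\ne j,j+1$; (3) $u_j(\lambda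 a+\mu b)=\lambda u_j(a)+\mu u_j(b)$, $u_j(a)u_j(b)=u_j(ab)$ and $u_j(1_A)=1$ for $1\le j\le d$, $\lambda,\mu\in\Bbbk$, $a,b\in A$; $u_i(a)u_j(b)=u_j(b)u_i(a)$ for $i\neq j$ and $a,b\in A$; (4) $s_iu_j(a)=u_{s_i(j)}(a)s_i$ for $1\le i\le d-1$, $1\le j\le d$, $a\in A$, where $s_i(j)$ denotes the image of $j$ under the transposition $(i,i+1)$; (5) $t_iu_j(a)=u_j(a)t_i$ for $1\le i,j\le d$ and all $a\in A$; (6) $t_{i+1}s_i-s_it_i=m_i$ for $1\le i\le d-1$, where $m_i=\sum_{b\in B}u_{i+1}(b)u_i(b^\vee)$.
   Context: $\Bbbk$ is a fixed commutative ground ring; linear categories are $\Bbbk$-linear and monoidal categories are strict. A strict linear monoidal category is a category whose hom-sets are $\Bbbk$-modules with bilinear composition, with a bilinear, strictly associative tensor bifunctor $\otimes$ and a strict unit object. The endomorphism sets are $\Bbbk$-algebras under composition. A strict linear monoidal category presented by generating objects, generating morphisms and relations is the quotient of the free strict linear monoidal category on these generators (objects: the free monoid under $\otimes$ on the generating objects; morphisms freely generated, under composition, $\otimes$ and $\Bbbk$-linear combinations, by the generating morphisms, subject only to the axioms of a strict linear monoidal category) by the tensor ideal generated by the relations, i.e. the smallest family of submodules of the hom-modules which contains the relations and is closed under composing and tensoring on either side with arbitrary morphisms. The affine wreath product category $\mathcal{AW}(A)$ is the strict linear monoidal category with one generating object $\uparrow$, generating morphisms $$s\colon\uparrow\otimes\uparrow\to\uparrow\otimes\uparrow,\qquad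 \beta_a\colon\uparrow\to\uparrow\ (a\in A),\qquad x\colon\uparrow\to\uparrow,$$ and relations, with $1=1_\uparrow$: (i) $s\circ s=1_{\uparrow\otimes\uparrow}$; (ii) $(s\otimes1)\circ(1\otimes s)\circ(s\otimes1)=(1\otimes s)\circ(s\otimes1)\circ(1\otimes s)$; (iii) $a\mapsto\beta_a$ is a homomorphism of unital $\Bbbk$-algebras $A\to\mathrm{End}(\uparrow)$: $\beta_{\lambda a+\mu b}=\lambda\beta_a+\mu\beta_b$, $\beta_a\circ\beta_b=\beta_{ab}$, $\beta_{1_A}=1_\uparrow$, for all $\lambda,\mu\in\Bbbk$, $a,b\in A$; (iv) $s\circ(\beta_a\otimes1)=(1\otimes\beta_a)\circ s$ for all $a\in A$; (v) $(x\otimes1)\circ s-s\circ(1\otimes x)=\sum_{b\in B}\beta_b\otimes\beta_{b^\vee}$; (vi) $\beta_a\circ x=x\circ\beta_a$ for all $a\in A$. The element $\sum_{b\in B}b\otimes b^\vee\in A\otimes A$ does not depend on the choice of the basis $B$. *)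

theory Defs
  imports "HOL-Algebra.Module" "HOL-Algebra.QuotRing" "HOL-Combinatorics.Transposition"
begin

section \<open>Algebras, bases, presentations of algebras\<close>

text \<open>
  The locale \<open>algebra\<close> of HOL-Algebra is restricted to commutative algebras, whence the following
  one. Neither the ground ring nor the algebra is required to be nontrivial.
\<close>

locale assoc_algebra = module R M + ring M for R (structure) and M (structure) +
  assumes smult_mult_left:
      "\<lbrakk>c \<in> carrier R; x \<in> carrier M; y \<in> carrier M\<rbrakk> \<Longrightarrow>
        (c \<odot>\<^bsub>M\<^esub> x) \<otimes>\<^bsub>M\<^esub> y = c \<odot>\<^bsub>M\<^esub> (x \<otimes>\<^bsub>M\<^esub> y)"
    and smult_mult_right:
      "\<lbrakk>c \<in> carrier R; x \<in> carrier M; y \<in> carrier M\<rbrakk> \<Longrightarrow>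
        x \<otimes>\<^bsub>M\<^esub> (c \<odot>\<^bsub>M\<^esub> y) = c \<odot>\<^bsub>M\<^esub> (x \<otimes>\<^bsub>M\<^esub> y)"

definition finite_basis ::
    "('k, 'e) ring_scheme \<Rightarrow> ('k, 'a, 'f) module_scheme \<Rightarrow> 'i set \<Rightarrow> ('i \<Rightarrow> 'a) \<Rightarrow> bool" where
  "finite_basis K M I v \<longleftrightarrow>
     finite I \<and> v \<in> I \<rightarrow> carrier M \<and>
     (\<forall>m \<in> carrier M. \<exists>!c. c \<in> I \<rightarrow>\<^sub>E carrier K \<and> m = (\<Oplus>\<^bsub>M\<^esub>i\<in>I. c i \<odot>\<^bsub>M\<^esub> v i))"

text \<open>
  The free associative algebra on a set \<open>X\<close>: finitely supported functions on the words in \<open>X\<close>,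
  multiplied by convolution with respect to concatenation.
\<close>

definition free_algebra ::
    "('k, 'e) ring_scheme \<Rightarrow> 'x set \<Rightarrow> ('k, 'x list \<Rightarrow> 'k) module" where
  "free_algebra K X =
    \<lparr>carrier = {f. (\<forall>w. f w \<in> carrier K) \<and> finite {w. f w \<noteq> \<zero>\<^bsub>K\<^esub>} \<and> {w. f w \<noteq> \<zero>\<^bsub>K\<^esub>} \<subseteq> lists X},
     mult = (\<lambda>f g w. \<Oplus>\<^bsub>K\<^esub>i\<in>{..length w}. f (take i w) \<otimes>\<^bsub>K\<^esub> g (drop i w)),
     one = (\<lambda>w. if w = [] then \<one>\<^bsub>K\<^esub> else \<zero>\<^bsub>K\<^esub>),
     zero = (\<lambda>w. \<zero>\<^bsub>K\<^esub>),
     add = (\<lambda>f g w. f w \<oplus>\<^bsub>K\<^esub> g w),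
     smult = (\<lambda>c f w. c \<otimes>\<^bsub>K\<^esub> f w)\<rparr>"

definition free_var :: "('k, 'e) ring_scheme \<Rightarrow> 'x \<Rightarrow> 'x list \<Rightarrow> 'k" where
  "free_var K y = (\<lambda>w. if w = [y] then \<one>\<^bsub>K\<^esub> else \<zero>\<^bsub>K\<^esub>)"

text \<open>
  The algebra \<open>E\<close> is presented by the generators \<open>X\<close>, interpreted in \<open>E\<close> by \<open>ev\<close>, and the relations
  \<open>r = 0\<close> for \<open>r \<in> R\<close>. The two-sided ring ideal \<open>Idl R\<close> is automatically closed under
  scalars; linearity of \<open>\<psi>\<close> is stated on representatives, as \<open>Quot\<close> only yields a ring.
\<close>

definition presented_by ::
    "('k, 'e) ring_scheme \<Rightarrow> ('k, 'm, 'f) module_scheme \<Rightarrow> 'x set \<Rightarrow> ('x list \<Rightarrow> 'k) set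
      \<Rightarrow> ('x \<Rightarrow> 'm) \<Rightarrow> bool" where
  "presented_by K E X R ev \<longleftrightarrow>
    (let P = free_algebra K X; I = Idl\<^bsub>P\<^esub> R in
      assoc_algebra K E \<and>
      (\<exists>\<psi> \<in> ring_iso (P Quot I) E.
        (\<forall>c \<in> carrier K. \<forall>f \<in> carrier P. \<psi> (I +>\<^bsub>P\<^esub> (c \<odot>\<^bsub>P\<^esub> f)) = c \<odot>\<^bsub>E\<^esub> \<psi> (I +>\<^bsub>P\<^esub> f)) \<and>
        (\<forall>y \<in> X. \<psi> (I +>\<^bsub>P\<^esub> free_var K y) = ev y)))"


section \<open>Strict linear monoidal categories\<close>

text \<open>
  Data of a strict linear monoidal category whose objects are all elements of the type \<open>'o\<close>.
  Composition, tensor product and the linear structure only matter on morphisms in \<open>Mor\<close>,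
  composition \<open>g \<cdot> f\<close> (\<open>g\<close> after \<open>f\<close>) only if \<open>Dom g = Cod f\<close>, and addition only for
  parallel morphisms.
\<close>

record ('o, 'm, 'k) lin_mon_cat =
  Mor :: "'m set"
  Dom :: "'m \<Rightarrow> 'o"
  Cod :: "'m \<Rightarrow> 'o"
  Ident :: "'o \<Rightarrow> 'm"
  Comp :: "'m \<Rightarrow> 'm \<Rightarrow> 'm"  (infixl \<open>\<cdot>\<index>\<close> 70)
  UnitO :: 'o
  TensO :: "'o \<Rightarrow> 'o \<Rightarrow> 'o"
  TensM :: "'m \<Rightarrow> 'm \<Rightarrow> 'm"  (infixl \<open>\<boxtimes>\<index>\<close> 75)
  ZeroM :: "'o \<Rightarrow> 'o \<Rightarrow> 'm"
  AddM :: "'m \<Rightarrow> 'm \<Rightarrow> 'm"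
  ScaleM :: "'k \<Rightarrow> 'm \<Rightarrow> 'm"

definition Hom :: "('o, 'm, 'k, 'z) lin_mon_cat_scheme \<Rightarrow> 'o \<Rightarrow> 'o \<Rightarrow> 'm set" where
  "Hom C X Y = {f \<in> Mor C. Dom C f = X \<and> Cod C f = Y}"

definition DiffM ::
    "('k, 'e) ring_scheme \<Rightarrow> ('o, 'm, 'k, 'z) lin_mon_cat_scheme \<Rightarrow> 'm \<Rightarrow> 'm \<Rightarrow> 'm" where
  "DiffM K C f g = AddM C f (ScaleM C (\<ominus>\<^bsub>K\<^esub> \<one>\<^bsub>K\<^esub>) g)"

definition End_algebra :: "('o, 'm, 'k, 'z) lin_mon_cat_scheme \<Rightarrow> 'o \<Rightarrow> ('k, 'm) module" where
  "End_algebra C X =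
    \<lparr>carrier = Hom C X X, mult = Comp C, one = Ident C X, zero = ZeroM C X X, add = AddM C,
     smult = ScaleM C\<rparr>"

definition tens_pow_obj :: "('o, 'm, 'k, 'z) lin_mon_cat_scheme \<Rightarrow> 'o \<Rightarrow> nat \<Rightarrow> 'o" where
  "tens_pow_obj C X n = (TensO C X ^^ n) (UnitO C)"

definition tens_pow_mor :: "('o, 'm, 'k, 'z) lin_mon_cat_scheme \<Rightarrow> 'm \<Rightarrow> nat \<Rightarrow> 'm" where
  "tens_pow_mor C f n = (TensM C f ^^ n) (Ident C (UnitO C))"


subsection \<open>Free strict linear monoidal categories\<close>

record ('o, 'g) signature =
  Gens :: "'g set"
  Src :: "'g \<Rightarrow> 'o list"
  Tgt :: "'g \<Rightarrow> 'o list"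

text \<open>
  The objects of the free category are the lists over \<open>'o\<close>, i.e. the free monoid on the generating
  objects; the morphisms are well-formed terms modulo the axioms of a strict linear monoidal
  category.
\<close>

datatype ('o, 'g, 'k) mterm =
    TId "'o list"
  | TGen 'g
  | TComp "('o, 'g, 'k) mterm" "('o, 'g, 'k) mterm"
  | TTens "('o, 'g, 'k) mterm" "('o, 'g, 'k) mterm"
  | TZero "'o list" "'o list"
  | TAdd "('o, 'g, 'k) mterm" "('o, 'g, 'k) mterm"
  | TScale 'k "('o, 'g, 'k) mterm"

primrec tdom :: "('o, 'g) signature \<Rightarrow> ('o, 'g, 'k) mterm \<Rightarrow> 'o list" where
  "tdom S (TId X) = X"
| "tdom S (TGen y) = Src S y"
| "tdom S (TComp g f) = tdom S f"
| "tdom S (TTens f g) = tdom S f @ tdom S g"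
| "tdom S (TZero X Y) = X"
| "tdom S (TAdd f g) = tdom S f"
| "tdom S (TScale c f) = tdom S f"

primrec tcod :: "('o, 'g) signature \<Rightarrow> ('o, 'g, 'k) mterm \<Rightarrow> 'o list" where
  "tcod S (TId X) = X"
| "tcod S (TGen y) = Tgt S y"
| "tcod S (TComp g f) = tcod S g"
| "tcod S (TTens f g) = tcod S f @ tcod S g"
| "tcod S (TZero X Y) = Y"
| "tcod S (TAdd f g) = tcod S f"
| "tcod S (TScale c f) = tcod S f"

primrec twf :: "('k, 'e) ring_scheme \<Rightarrow> ('o, 'g) signature \<Rightarrow> ('o, 'g, 'k) mterm \<Rightarrow> bool" where
  "twf K S (TId X) \<longleftrightarrow> True"
| "twf K S (TGen y) \<longleftrightarrow> y \<in> Gens S"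
| "twf K S (TComp g f) \<longleftrightarrow> twf K S g \<and> twf K S f \<and> tdom S g = tcod S f"
| "twf K S (TTens f g) \<longleftrightarrow> twf K S f \<and> twf K S g"
| "twf K S (TZero X Y) \<longleftrightarrow> True"
| "twf K S (TAdd f g) \<longleftrightarrow> twf K S f \<and> twf K S g \<and> tdom S f = tdom S g \<and> tcod S f = tcod S g"
| "twf K S (TScale c f) \<longleftrightarrow> c \<in> carrier K \<and> twf K S f"

inductive teq :: "('k, 'e) ring_scheme \<Rightarrow> ('o, 'g) signature
    \<Rightarrow> ('o, 'g, 'k) mterm \<Rightarrow> ('o, 'g, 'k) mterm \<Rightarrow> bool"
  for K (structure) and S where
  \<comment> \<open>congruence\<close>
  refl: "twf K S f \<Longrightarrow> teq K S f f"
| sym: "teq K S f g \<Longrightarrow> teq K S g f"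
| trans: "teq K S f g \<Longrightarrow> teq K S g h \<Longrightarrow> teq K S f h"
| cong_comp: "teq K S g g' \<Longrightarrow> teq K S f f' \<Longrightarrow> tdom S g = tcod S f \<Longrightarrow>
    teq K S (TComp g f) (TComp g' f')"
| cong_tens: "teq K S f f' \<Longrightarrow> teq K S g g' \<Longrightarrow> teq K S (TTens f g) (TTens f' g')"
| cong_add: "teq K S f f' \<Longrightarrow> teq K S g g' \<Longrightarrow> tdom S f = tdom S g \<Longrightarrow> tcod S f = tcod S g \<Longrightarrow>
    teq K S (TAdd f g) (TAdd f' g')"
| cong_scale: "c \<in> carrier K \<Longrightarrow> teq K S f f' \<Longrightarrow> teq K S (TScale c f) (TScale c f')"
  \<comment> \<open>category\<close>
| comp_assoc: "twf K S (TComp h (TComp g f)) \<Longrightarrow>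
    teq K S (TComp (TComp h g) f) (TComp h (TComp g f))"
| comp_id_left: "twf K S f \<Longrightarrow> teq K S (TComp (TId (tcod S f)) f) f"
| comp_id_right: "twf K S f \<Longrightarrow> teq K S (TComp f (TId (tdom S f))) f"
  \<comment> \<open>the morphisms between two given objects form a module\<close>
| add_assoc: "twf K S (TAdd f (TAdd g h)) \<Longrightarrow> teq K S (TAdd (TAdd f g) h) (TAdd f (TAdd g h))"
| add_comm: "twf K S (TAdd f g) \<Longrightarrow> teq K S (TAdd f g) (TAdd g f)"
| add_zero: "twf K S f \<Longrightarrow> teq K S (TAdd f (TZero (tdom S f) (tcod S f))) f"
| add_inverse: "twf K S f \<Longrightarrow>
    teq K S (TAdd f (TScale (\<ominus> \<one>) f)) (TZero (tdom S f) (tcod S f))"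
| scale_add: "c \<in> carrier K \<Longrightarrow> twf K S (TAdd f g) \<Longrightarrow>
    teq K S (TScale c (TAdd f g)) (TAdd (TScale c f) (TScale c g))"
| add_scale: "c \<in> carrier K \<Longrightarrow> c' \<in> carrier K \<Longrightarrow> twf K S f \<Longrightarrow>
    teq K S (TScale (c \<oplus> c') f) (TAdd (TScale c f) (TScale c' f))"
| scale_scale: "c \<in> carrier K \<Longrightarrow> c' \<in> carrier K \<Longrightarrow> twf K S f \<Longrightarrow>
    teq K S (TScale (c \<otimes> c') f) (TScale c (TScale c' f))"
| scale_one: "twf K S f \<Longrightarrow> teq K S (TScale \<one> f) f"
  \<comment> \<open>composition is bilinear\<close>
| comp_add_left: "twf K S (TComp (TAdd g g') f) \<Longrightarrow>
    teq K S (TComp (TAdd g g') f) (TAdd (TComp g f) (TComp g' f))"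
| comp_add_right: "twf K S (TComp g (TAdd f f')) \<Longrightarrow>
    teq K S (TComp g (TAdd f f')) (TAdd (TComp g f) (TComp g f'))"
| comp_scale_left: "c \<in> carrier K \<Longrightarrow> twf K S (TComp g f) \<Longrightarrow>
    teq K S (TComp (TScale c g) f) (TScale c (TComp g f))"
| comp_scale_right: "c \<in> carrier K \<Longrightarrow> twf K S (TComp g f) \<Longrightarrow>
    teq K S (TComp g (TScale c f)) (TScale c (TComp g f))"
  \<comment> \<open>the tensor product is a bilinear bifunctor\<close>
| tens_id: "teq K S (TTens (TId X) (TId Y)) (TId (X @ Y))"
| interchange: "twf K S (TComp g f) \<Longrightarrow> twf K S (TComp g' f') \<Longrightarrow>
    teq K S (TComp (TTens g g') (TTens f f')) (TTens (TComp g f) (TComp g' f'))"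
| tens_add_left: "twf K S (TAdd f f') \<Longrightarrow> twf K S g \<Longrightarrow>
    teq K S (TTens (TAdd f f') g) (TAdd (TTens f g) (TTens f' g))"
| tens_add_right: "twf K S f \<Longrightarrow> twf K S (TAdd g g') \<Longrightarrow>
    teq K S (TTens f (TAdd g g')) (TAdd (TTens f g) (TTens f g'))"
| tens_scale_left: "c \<in> carrier K \<Longrightarrow> twf K S f \<Longrightarrow> twf K S g \<Longrightarrow>
    teq K S (TTens (TScale c f) g) (TScale c (TTens f g))"
| tens_scale_right: "c \<in> carrier K \<Longrightarrow> twf K S f \<Longrightarrow> twf K S g \<Longrightarrow>
    teq K S (TTens f (TScale c g)) (TScale c (TTens f g))"
  \<comment> \<open>the tensor product is strictly associative and unital\<close>
| tens_assoc: "twf K S f \<Longrightarrow> twf K S g \<Longrightarrow> twf K S h \<Longrightarrow>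
    teq K S (TTens (TTens f g) h) (TTens f (TTens g h))"
| tens_unit_left: "twf K S f \<Longrightarrow> teq K S (TTens (TId []) f) f"
| tens_unit_right: "twf K S f \<Longrightarrow> teq K S (TTens f (TId [])) f"

definition tclass :: "('k, 'e) ring_scheme \<Rightarrow> ('o, 'g) signature
    \<Rightarrow> ('o, 'g, 'k) mterm \<Rightarrow> ('o, 'g, 'k) mterm set" where
  "tclass K S f = {g. teq K S f g}"

definition rep :: "'m set \<Rightarrow> 'm" where
  "rep F = (SOME f. f \<in> F)"

definition free_cat :: "('k, 'e) ring_scheme \<Rightarrow> ('o, 'g) signature
    \<Rightarrow> ('o list, ('o, 'g, 'k) mterm set, 'k) lin_mon_cat" where
  "free_cat K S =
    \<lparr>Mor = tclass K S ` {f. twf K S f},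
     Dom = (\<lambda>F. tdom S (rep F)),
     Cod = (\<lambda>F. tcod S (rep F)),
     Ident = (\<lambda>X. tclass K S (TId X)),
     Comp = (\<lambda>G F. tclass K S (TComp (rep G) (rep F))),
     UnitO = [],
     TensO = (@),
     TensM = (\<lambda>F G. tclass K S (TTens (rep F) (rep G))),
     ZeroM = (\<lambda>X Y. tclass K S (TZero X Y)),
     AddM = (\<lambda>F G. tclass K S (TAdd (rep F) (rep G))),
     ScaleM = (\<lambda>c F. tclass K S (TScale c (rep F)))\<rparr>"

definition free_cat_gen :: "('k, 'e) ring_scheme \<Rightarrow> ('o, 'g) signature
    \<Rightarrow> 'g \<Rightarrow> ('o, 'g, 'k) mterm set" where
  "free_cat_gen K S y = tclass K S (TGen y)"


subsection \<open>Quotients by tensor ideals\<close>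

inductive_set gen_tensor_ideal :: "('k, 'e) ring_scheme \<Rightarrow> ('o, 'm, 'k, 'z) lin_mon_cat_scheme
    \<Rightarrow> 'm set \<Rightarrow> 'm set"
  for K and C (structure) and R where
  rel: "f \<in> R \<Longrightarrow> f \<in> gen_tensor_ideal K C R"
| zero: "ZeroM C X Y \<in> gen_tensor_ideal K C R"
| add: "f \<in> gen_tensor_ideal K C R \<Longrightarrow> g \<in> gen_tensor_ideal K C R \<Longrightarrow>
    Dom C f = Dom C g \<Longrightarrow> Cod C f = Cod C g \<Longrightarrow> AddM C f g \<in> gen_tensor_ideal K C R"
| scale: "c \<in> carrier K \<Longrightarrow> f \<in> gen_tensor_ideal K C R \<Longrightarrow>
    ScaleM C c f \<in> gen_tensor_ideal K C R"
| comp_left: "f \<in> gen_tensor_ideal K C R \<Longrightarrow> g \<in> Mor C \<Longrightarrow> Dom C g = Cod C f \<Longrightarrow>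
    g \<cdot> f \<in> gen_tensor_ideal K C R"
| comp_right: "f \<in> gen_tensor_ideal K C R \<Longrightarrow> g \<in> Mor C \<Longrightarrow> Dom C f = Cod C g \<Longrightarrow>
    f \<cdot> g \<in> gen_tensor_ideal K C R"
| tens_left: "f \<in> gen_tensor_ideal K C R \<Longrightarrow> g \<in> Mor C \<Longrightarrow> g \<boxtimes> f \<in> gen_tensor_ideal K C R"
| tens_right: "f \<in> gen_tensor_ideal K C R \<Longrightarrow> g \<in> Mor C \<Longrightarrow> f \<boxtimes> g \<in> gen_tensor_ideal K C R"

definition quot_class :: "('k, 'e) ring_scheme \<Rightarrow> ('o, 'm, 'k, 'z) lin_mon_cat_scheme
    \<Rightarrow> 'm set \<Rightarrow> 'm \<Rightarrow> 'm set" where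
  "quot_class K C I f = {g \<in> Hom C (Dom C f) (Cod C f). DiffM K C g f \<in> I}"

definition quot_cat :: "('k, 'e) ring_scheme \<Rightarrow> ('o, 'm, 'k, 'z) lin_mon_cat_scheme
    \<Rightarrow> 'm set \<Rightarrow> ('o, 'm set, 'k) lin_mon_cat" where
  "quot_cat K C I =
    \<lparr>Mor = quot_class K C I ` Mor C,
     Dom = (\<lambda>F. Dom C (rep F)),
     Cod = (\<lambda>F. Cod C (rep F)),
     Ident = (\<lambda>X. quot_class K C I (Ident C X)),
     Comp = (\<lambda>G F. quot_class K C I (Comp C (rep G) (rep F))),
     UnitO = UnitO C,
     TensO = TensO C,
     TensM = (\<lambda>F G. quot_class K C I (TensM C (rep F) (rep G))),
     ZeroM = (\<lambda>X Y. quot_class K C I (ZeroM C X Y)),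
     AddM = (\<lambda>F G. quot_class K C I (AddM C (rep F) (rep G))),
     ScaleM = (\<lambda>c F. quot_class K C I (ScaleM C c (rep F)))\<rparr>"


section \<open>The affine wreath product category\<close>

datatype 'a aw_gen = Gen_s | Gen_beta 'a | Gen_x

text \<open>The unique element of type \<open>unit\<close> is the generating object, so \<open>[()]\<close> is the object \<open>\<up>\<close>.\<close>

abbreviation up :: "unit list" where
  "up \<equiv> [()]"

definition aw_sig :: "('k, 'a, 'f) module_scheme \<Rightarrow> (unit, 'a aw_gen) signature" where
  "aw_sig A =
    \<lparr>Gens = {Gen_s, Gen_x} \<union> Gen_beta ` carrier A,
     Src = (\<lambda>y. if y = Gen_s then up @ up else up),
     Tgt = (\<lambda>y. if y = Gen_s then up @ up else up)\<rparr>"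

definition aw_relations :: "('k, 'e) ring_scheme \<Rightarrow> ('k, 'a, 'f) module_scheme \<Rightarrow> 'a set \<Rightarrow> ('a \<Rightarrow> 'a)
    \<Rightarrow> (unit, 'a aw_gen, 'k) mterm set set" where
  "aw_relations K A B dual =
    (let F = free_cat K (aw_sig A);
         s = free_cat_gen K (aw_sig A) Gen_s;
         \<beta> = (\<lambda>a. free_cat_gen K (aw_sig A) (Gen_beta a));
         x = free_cat_gen K (aw_sig A) Gen_x;
         i = Ident F up
     in
      {DiffM K F (s \<cdot>\<^bsub>F\<^esub> s) (Ident F (up @ up))}
      \<union> {DiffM K F ((s \<boxtimes>\<^bsub>F\<^esub> i) \<cdot>\<^bsub>F\<^esub> (i \<boxtimes>\<^bsub>F\<^esub> s) \<cdot>\<^bsub>F\<^esub> (s \<boxtimes>\<^bsub>F\<^esub> i))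
                 ((i \<boxtimes>\<^bsub>F\<^esub> s) \<cdot>\<^bsub>F\<^esub> (s \<boxtimes>\<^bsub>F\<^esub> i) \<cdot>\<^bsub>F\<^esub> (i \<boxtimes>\<^bsub>F\<^esub> s))}
      \<union> {DiffM K F (\<beta> (c \<odot>\<^bsub>A\<^esub> a \<oplus>\<^bsub>A\<^esub> c' \<odot>\<^bsub>A\<^esub> b))
                   (AddM F (ScaleM F c (\<beta> a)) (ScaleM F c' (\<beta> b))) | c c' a b.
           c \<in> carrier K \<and> c' \<in> carrier K \<and> a \<in> carrier A \<and> b \<in> carrier A}
      \<union> {DiffM K F (\<beta> a \<cdot>\<^bsub>F\<^esub> \<beta> b) (\<beta> (a \<otimes>\<^bsub>A\<^esub> b)) | a b. a \<in> carrier A \<and> b \<in> carrier A}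
      \<union> {DiffM K F (\<beta> \<one>\<^bsub>A\<^esub>) i}
      \<union> {DiffM K F (s \<cdot>\<^bsub>F\<^esub> (\<beta> a \<boxtimes>\<^bsub>F\<^esub> i)) ((i \<boxtimes>\<^bsub>F\<^esub> \<beta> a) \<cdot>\<^bsub>F\<^esub> s) | a. a \<in> carrier A}
      \<union> {DiffM K F (DiffM K F ((x \<boxtimes>\<^bsub>F\<^esub> i) \<cdot>\<^bsub>F\<^esub> s) (s \<cdot>\<^bsub>F\<^esub> (i \<boxtimes>\<^bsub>F\<^esub> x)))
                   (\<Oplus>\<^bsub>End_algebra F (up @ up)\<^esub>b\<in>B. \<beta> b \<boxtimes>\<^bsub>F\<^esub> \<beta> (dual b))}
      \<union> {DiffM K F (\<beta> a \<cdot>\<^bsub>F\<^esub> x) (x \<cdot>\<^bsub>F\<^esub> \<beta> a) | a. a \<in> carrier A})"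

definition aw_ideal :: "('k, 'e) ring_scheme \<Rightarrow> ('k, 'a, 'f) module_scheme \<Rightarrow> 'a set \<Rightarrow> ('a \<Rightarrow> 'a)
    \<Rightarrow> (unit, 'a aw_gen, 'k) mterm set set" where
  "aw_ideal K A B dual =
    gen_tensor_ideal K (free_cat K (aw_sig A)) (aw_relations K A B dual)"

definition AW :: "('k, 'e) ring_scheme \<Rightarrow> ('k, 'a, 'f) module_scheme \<Rightarrow> 'a set \<Rightarrow> ('a \<Rightarrow> 'a)
    \<Rightarrow> (unit list, (unit, 'a aw_gen, 'k) mterm set set, 'k) lin_mon_cat" where
  "AW K A B dual = quot_cat K (free_cat K (aw_sig A)) (aw_ideal K A B dual)"

definition AW_gen :: "('k, 'e) ring_scheme \<Rightarrow> ('k, 'a, 'f) module_scheme \<Rightarrow> 'a set \<Rightarrow> ('a \<Rightarrow> 'a)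
    \<Rightarrow> 'a aw_gen \<Rightarrow> (unit, 'a aw_gen, 'k) mterm set set" where
  "AW_gen K A B dual y =
    quot_class K (free_cat K (aw_sig A)) (aw_ideal K A B dual) (free_cat_gen K (aw_sig A) y)"


section \<open>The affine wreath product algebra\<close>

datatype 'a awp_gen = Var_t nat | Var_u nat 'a | Var_s nat

definition awp_gens :: "('k, 'a, 'f) module_scheme \<Rightarrow> nat \<Rightarrow> 'a awp_gen set" where
  "awp_gens A d =
    {Var_t i | i. i \<in> {1..d}} \<union> {Var_u i a | i a. i \<in> {1..d} \<and> a \<in> carrier A}
      \<union> {Var_s i | i. i \<in> {1..<d}}"

definition awp_relations :: "('k, 'e) ring_scheme \<Rightarrow> ('k, 'a, 'f) module_scheme \<Rightarrow> 'a set \<Rightarrow> ('a \<Rightarrow> 'a)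
    \<Rightarrow> nat \<Rightarrow> ('a awp_gen list \<Rightarrow> 'k) set" where
  "awp_relations K A B dual d =
    (let P = free_algebra K (awp_gens A d);
         t = (\<lambda>i. free_var K (Var_t i));
         u = (\<lambda>i a. free_var K (Var_u i a));
         s = (\<lambda>i. free_var K (Var_s i));
         m = (\<lambda>i. \<Oplus>\<^bsub>P\<^esub>b\<in>B. u (i + 1) b \<otimes>\<^bsub>P\<^esub> u i (dual b))
     in
      {s i \<otimes>\<^bsub>P\<^esub> s j \<ominus>\<^bsub>P\<^esub> s j \<otimes>\<^bsub>P\<^esub> s i | i j.
         i \<in> {1..<d} \<and> j \<in> {1..<d} \<and> \<bar>int i - int j\<bar> > 1}
      \<union> {s i \<otimes>\<^bsub>P\<^esub> s i \<ominus>\<^bsub>P\<^esub> \<one>\<^bsub>P\<^esub> | i. i \<in> {1..<d}}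
      \<union> {s (i + 1) \<otimes>\<^bsub>P\<^esub> s i \<otimes>\<^bsub>P\<^esub> s (i + 1) \<ominus>\<^bsub>P\<^esub> s i \<otimes>\<^bsub>P\<^esub> s (i + 1) \<otimes>\<^bsub>P\<^esub> s i | i.
         1 \<le> i \<and> i + 2 \<le> d}
      \<union> {t i \<otimes>\<^bsub>P\<^esub> t j \<ominus>\<^bsub>P\<^esub> t j \<otimes>\<^bsub>P\<^esub> t i | i j. i \<in> {1..d} \<and> j \<in> {1..d}}
      \<union> {t i \<otimes>\<^bsub>P\<^esub> s j \<ominus>\<^bsub>P\<^esub> s j \<otimes>\<^bsub>P\<^esub> t i | i j.
         i \<in> {1..d} \<and> j \<in> {1..<d} \<and> i \<noteq> j \<and> i \<noteq> j + 1}
      \<union> {u j (c \<odot>\<^bsub>A\<^esub> a \<oplus>\<^bsub>A\<^esub> c' \<odot>\<^bsub>A\<^esub> b) \<ominus>\<^bsub>P\<^esub> (c \<odot>\<^bsub>P\<^esub> u j a \<oplus>\<^bsub>P\<^esub> c' \<odot>\<^bsub>P\<^esub> u j b) | j c c' a b.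
         j \<in> {1..d} \<and> c \<in> carrier K \<and> c' \<in> carrier K \<and> a \<in> carrier A \<and> b \<in> carrier A}
      \<union> {u j a \<otimes>\<^bsub>P\<^esub> u j b \<ominus>\<^bsub>P\<^esub> u j (a \<otimes>\<^bsub>A\<^esub> b) | j a b.
         j \<in> {1..d} \<and> a \<in> carrier A \<and> b \<in> carrier A}
      \<union> {u j \<one>\<^bsub>A\<^esub> \<ominus>\<^bsub>P\<^esub> \<one>\<^bsub>P\<^esub> | j. j \<in> {1..d}}
      \<union> {u i a \<otimes>\<^bsub>P\<^esub> u j b \<ominus>\<^bsub>P\<^esub> u j b \<otimes>\<^bsub>P\<^esub> u i a | i j a b.
         i \<in> {1..d} \<and> j \<in> {1..d} \<and> i \<noteq> j \<and> a \<in> carrier A \<and> b \<in> carrier A}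
      \<union> {s i \<otimes>\<^bsub>P\<^esub> u j a \<ominus>\<^bsub>P\<^esub> u (transpose i (i + 1) j) a \<otimes>\<^bsub>P\<^esub> s i | i j a.
         i \<in> {1..<d} \<and> j \<in> {1..d} \<and> a \<in> carrier A}
      \<union> {t i \<otimes>\<^bsub>P\<^esub> u j a \<ominus>\<^bsub>P\<^esub> u j a \<otimes>\<^bsub>P\<^esub> t i | i j a.
         i \<in> {1..d} \<and> j \<in> {1..d} \<and> a \<in> carrier A}
      \<union> {(t (i + 1) \<otimes>\<^bsub>P\<^esub> s i \<ominus>\<^bsub>P\<^esub> s i \<otimes>\<^bsub>P\<^esub> t i) \<ominus>\<^bsub>P\<^esub> m i | i. i \<in> {1..<d}})"

definition awp_endo :: "('k, 'e) ring_scheme \<Rightarrow> ('k, 'a, 'f) module_scheme \<Rightarrow> 'a set \<Rightarrow> ('a \<Rightarrow> 'a)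
    \<Rightarrow> nat \<Rightarrow> 'a awp_gen \<Rightarrow> (unit, 'a aw_gen, 'k) mterm set set" where
  "awp_endo K A B dual d y =
    (let C = AW K A B dual;
         s = AW_gen K A B dual Gen_s;
         \<beta> = (\<lambda>a. AW_gen K A B dual (Gen_beta a));
         x = AW_gen K A B dual Gen_x;
         i = tens_pow_mor C (Ident C up)
     in case y of
        Var_t k \<Rightarrow> i (d - k) \<boxtimes>\<^bsub>C\<^esub> x \<boxtimes>\<^bsub>C\<^esub> i (k - 1)
      | Var_u k a \<Rightarrow> i (d - k) \<boxtimes>\<^bsub>C\<^esub> \<beta> a \<boxtimes>\<^bsub>C\<^esub> i (k - 1)
      | Var_s k \<Rightarrow> i (d - 1 - k) \<boxtimes>\<^bsub>C\<^esub> s \<boxtimes>\<^bsub>C\<^esub> i (k - 1))"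

end

theory Submission
  imports Defs
begin

text \<open>
  Write \<open>P d\<close> for the free algebra on the generators of the affine wreath product algebra on \<open>d\<close> strands
  and \<open>I d\<close> for the ideal generated by its relations. The relations hold among the given endomorphisms
  of \<open>\<up>\<^sup>d\<close>: each is a defining relation of the category with identity strands added on both sides, or
  an instance of the interchange law, or follows from such by conjugating with a crossing
  (\<open>endo_sat\<close>). Hence evaluation is a homomorphism \<open>psi\<close> from \<open>P d\<close> to the endomorphism algebra that
  kills \<open>I d\<close>, and it remains to see that \<open>psi\<close> is onto and that its kernel is not larger.
  
  Both come from a map in the other direction. The algebras \<open>P d / I d\<close> are the endomorphism algebras
  of a strict linear monoidal category with objects the natural numbers and with no nonzero morphisms
  between different objects; the tensor product of \<open>f\<close> on \<open>m\<close> strands and \<open>g\<close> on \<open>n\<close> strands is \<open>f'\<cdot>g\<close>,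
  where \<open>f'\<close> is \<open>f\<close> with all strand numbers raised by \<open>n\<close> (\<open>shift\<close>). This is well defined because
  raising strand numbers turns relations into relations (\<open>shift_ideal\<close>), and it satisfies the
  interchange law because the raised copy of \<open>P m\<close> commutes with \<open>P n\<close> modulo the relations
  (\<open>shift_commute\<close>). The generators of the affine wreath product category have evident images on one
  and two strands. On the level of terms this functor is \<open>phi\<close>: it respects the axioms of strict
  linear monoidal categories modulo \<open>I d\<close> (\<open>phi_teq\<close>) and takes every term whose class lies in the tensor
  ideal into \<open>I d\<close> (\<open>ideal_vanishes\<close>).
  
  Induction on terms shows that the morphism denoted by a term \<open>f\<close> from \<open>\<up>\<^sup>d\<close> to \<open>\<up>\<^sup>d\<close> is \<open>psi d (phi f)\<close>
  (\<open>denote_psi\<close>), so \<open>psi\<close> is onto. Conversely every \<open>p\<close> in \<open>P d\<close> is \<open>phi f\<close> for some term \<open>f\<close> (\<open>phi_surj\<close>); if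
  \<open>psi d p = 0\<close>, then \<open>f\<close> denotes zero, its class lies in the tensor ideal, and \<open>p = phi f\<close> lies in \<open>I d\<close>.
\<close>

section \<open>Free algebras\<close>

(* Finite supports are compared as subsets of lists X; unfolding membership letter by letter
   would hide these inclusions from the simplifier. *)
declare in_lists_conv_set [simp del] in_listsD [rule del] in_listsI [rule del]

context
  fixes K :: "('k, 'e) ring_scheme" (structure)
begin

text \<open>
  The multiplication of \<open>free_algebra K X\<close>, which is the same function for every \<open>X\<close>.
\<close>

definition conv :: "('x list \<Rightarrow> 'k) \<Rightarrow> ('x list \<Rightarrow> 'k) \<Rightarrow> 'x list \<Rightarrow> 'k" where
  "conv f g = (\<lambda>w. \<Oplus>i\<in>{..length w}. f (take i w) \<otimes> g (drop i w))"

lemma free_algebra_simps: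
  "f \<in> carrier (free_algebra K X) \<longleftrightarrow> 
    (\<forall>w. f w \<in> carrier K) \<and> finite {w. f w \<noteq> \<zero>} \<and> (\<forall>w. f w \<noteq> \<zero> \<longrightarrow> w \<in> lists X)"
  "f \<otimes>\<^bsub>free_algebra K X\<^esub> g = conv f g"
  "\<one>\<^bsub>free_algebra K X\<^esub> = (\<lambda>w. if w = [] then \<one> else \<zero>)"
  "\<zero>\<^bsub>free_algebra K X\<^esub> = (\<lambda>w. \<zero>)"
  "f \<oplus>\<^bsub>free_algebra K X\<^esub> g = (\<lambda>w. f w \<oplus> g w)"
  "c \<odot>\<^bsub>free_algebra K X\<^esub> f = (\<lambda>w. c \<otimes> f w)"
  by (auto simp: free_algebra_def conv_def)

end

context cring
begin

lemma conv_Nil: "f [] \<in> carrier R \<Longrightarrow> g [] \<in> carrier R \<Longrightarrow> conv R f g [] = f [] \<otimes> g []"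
  by (simp add: conv_def)

text \<open>
  Only the empty prefix of \<open>x # w\<close> lacks the letter \<open>x\<close>. This recursion, in which \<open>f\<close> is replaced by its
  left derivative along \<open>x\<close>, yields the algebra laws by induction on the word with \<open>f\<close> arbitrary.
\<close>

lemma conv_Cons:
  assumes "\<And>w. f w \<in> carrier R" "\<And>w. g w \<in> carrier R"
  shows "conv R f g (x # w) = f [] \<otimes> g (x # w) \<oplus> conv R (\<lambda>v. f (x # v)) g w"
proof -
  have "conv R f g (x # w) =
      (\<Oplus>i\<in>{..length w}. f (take (Suc i) (x # w)) \<otimes> g (drop (Suc i) (x # w))) \<oplus> f [] \<otimes> g (x # w)"
    unfolding conv_def length_Cons using assms by (subst finsum_Suc2) auto
  also have "\<dots> = f [] \<otimes> g (x # w) \<oplus> conv R (\<lambda>v. f (x # v)) g w"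
    using assms by (simp add: a_comm conv_def)
  finally show ?thesis .
qed

lemma conv_closed:
  assumes "\<And>w. f w \<in> carrier R" "\<And>w. g w \<in> carrier R"
  shows "conv R f g w \<in> carrier R"
  unfolding conv_def using assms by (auto intro!: finsum_closed)

lemma conv_add_left:
  assumes "\<And>w. f w \<in> carrier R" "\<And>w. f' w \<in> carrier R" "\<And>w. g w \<in> carrier R"
  shows "conv R (\<lambda>w. f w \<oplus> f' w) g w = conv R f g w \<oplus> conv R f' g w"
  using assms
proof (induction w arbitrary: f f')
  case (Cons x w)
  then show ?case
    by (simp add: conv_Cons conv_closed l_distr a_ac)
qed (simp add: conv_Nil l_distr)

lemma conv_add_right:
  assumes "\<And>w. f w \<in> carrier R" "\<And>w. g' w \<in> carrier R" "\<And>w. g w \<in> carrier R"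
  shows "conv R f (\<lambda>w. g w \<oplus> g' w) w = conv R f g w \<oplus> conv R f g' w"
  using assms
proof (induction w arbitrary: f)
  case (Cons x w)
  then show ?case
    by (simp add: conv_Cons conv_closed r_distr a_ac)
qed (simp add: conv_Nil r_distr)

lemma conv_scale_left:
  assumes "\<And>w. f w \<in> carrier R" "\<And>w. g w \<in> carrier R" "c \<in> carrier R"
  shows "conv R (\<lambda>w. c \<otimes> f w) g w = c \<otimes> conv R f g w"
  using assms
proof (induction w arbitrary: f)
  case (Cons x w)
  then show ?case
    by (simp add: conv_Cons conv_closed r_distr m_ac)
qed (simp add: conv_Nil m_assoc)

lemma conv_scale_right:
  assumes "\<And>w. f w \<in> carrier R" "\<And>w. g w \<in> carrier R" "c \<in> carrier R"
  shows "conv R f (\<lambda>w. c \<otimes> g w) w = c \<otimes> conv R f g w"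
  using assms
proof (induction w arbitrary: f)
  case (Cons x w)
  then show ?case
    by (simp add: conv_Cons conv_closed r_distr m_ac)
qed (simp add: conv_Nil m_ac)

text \<open>
  The left derivative obeys the rule \<open>\<partial>(f * g) = f [] \<cdot> \<partial>g + \<partial>f * g\<close>, so the induction hypothesis for
  \<open>\<partial>f\<close> and linearity in the left factor suffice.
\<close>

lemma conv_assoc:
  assumes "\<And>w. f w \<in> carrier R" "\<And>w. g w \<in> carrier R" "\<And>w. h w \<in> carrier R"
  shows "conv R (conv R f g) h w = conv R f (conv R g h) w"
  using assms
proof (induction w arbitrary: f g)
  case Nil
  then show ?case by (simp add: conv_Nil conv_closed m_assoc)
next
  case (Cons x w)
  have *: "(\<lambda>v. conv R f g (x # v)) =
      (\<lambda>v. f [] \<otimes> g (x # v) \<oplus> conv R (\<lambda>v. f (x # v)) g v)"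
    using Cons.prems by (simp add: conv_Cons)
  have "conv R (conv R f g) h (x # w) = f [] \<otimes> g [] \<otimes> h (x # w) \<oplus>
      (f [] \<otimes> conv R (\<lambda>v. g (x # v)) h w \<oplus> conv R (conv R (\<lambda>v. f (x # v)) g) h w)"
    using Cons.prems
    by (simp add: conv_Cons conv_closed conv_Nil * conv_add_left conv_scale_left)
  also have "\<dots> = conv R f (conv R g h) (x # w)"
    using Cons.prems Cons.IH[of "\<lambda>v. f (x # v)" g]
    by (simp add: conv_Cons conv_closed conv_Nil r_distr a_ac m_ac)
  finally show ?case .
qed

lemma conv_zero_left:
  assumes "\<And>w. g w \<in> carrier R"
  shows "conv R (\<lambda>w. \<zero>) g w = \<zero>"
  using assms by (induction w) (simp_all add: conv_Nil conv_Cons)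

lemma conv_one_left:
  assumes "\<And>w. g w \<in> carrier R"
  shows "conv R (\<lambda>w. if w = [] then \<one> else \<zero>) g w = g w"
  using assms by (cases w) (simp_all add: conv_Nil conv_Cons conv_zero_left)

lemma conv_one_right:
  assumes "\<And>w. f w \<in> carrier R"
  shows "conv R f (\<lambda>w. if w = [] then \<one> else \<zero>) w = f w"
  using assms by (induction w arbitrary: f) (simp_all add: conv_Nil conv_Cons)

lemma conv_var:
  assumes "\<And>w. g w \<in> carrier R"
  shows "conv R (free_var R x) g w = (case w of [] \<Rightarrow> \<zero> | y # v \<Rightarrow> if y = x then g v else \<zero>)"
proof (cases w)
  case (Cons y v)
  have "(\<lambda>v. free_var R x (y # v)) = (if y = x then (\<lambda>w. if w = [] then \<one> else \<zero>) else (\<lambda>w. \<zero>))"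
    by (auto simp: free_var_def)
  then show ?thesis
    using assms Cons by (simp add: conv_Cons free_var_def conv_one_left conv_zero_left)
qed (use assms in \<open>simp add: conv_Nil free_var_def\<close>)

lemma conv_in_free_algebra:
  assumes "f \<in> carrier (free_algebra R X)" "g \<in> carrier (free_algebra R X)"
  shows "conv R f g \<in> carrier (free_algebra R X)"
proof -
  let ?F = "{w. f w \<noteq> \<zero>}" and ?G = "{w. g w \<noteq> \<zero>}"
  have f: "\<And>w. f w \<in> carrier R" and g: "\<And>w. g w \<in> carrier R"
    and fin: "finite ?F" "finite ?G" and l: "?F \<subseteq> lists X" "?G \<subseteq> lists X"
    using assms by (auto simp: free_algebra_simps)
  have sub: "{w. conv R f g w \<noteq> \<zero>} \<subseteq> (\<lambda>(u, v). u @ v) ` (?F \<times> ?G)"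
  proof
    fix w assume "w \<in> {w. conv R f g w \<noteq> \<zero>}"
    then have "conv R f g w \<noteq> \<zero>" by simp
    then have "\<exists>i. f (take i w) \<otimes> g (drop i w) \<noteq> \<zero>"
      unfolding conv_def by (auto intro: ccontr finsum_zero)
    then obtain i where i: "f (take i w) \<otimes> g (drop i w) \<noteq> \<zero>" ..
    then have "take i w \<in> ?F" "drop i w \<in> ?G"
      using f g by auto
    then show "w \<in> (\<lambda>(u, v). u @ v) ` (?F \<times> ?G)"
      by (intro image_eqI[of _ _ "(take i w, drop i w)"]) auto
  qed
  have "(\<lambda>(u, v). u @ v) ` (?F \<times> ?G) \<subseteq> lists X" using l by auto
  then show ?thesis
    using sub fin f g finite_subset[OF sub]
    unfolding free_algebra_simps by (auto intro: conv_closed)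
qed

lemma free_algebra_abelian_group: "abelian_group (free_algebra R X)"
proof (rule abelian_groupI, unfold free_algebra_simps(4,5))
  fix f g assume "f \<in> carrier (free_algebra R X)" "g \<in> carrier (free_algebra R X)"
  moreover have "{w. f w \<oplus> g w \<noteq> \<zero>} \<subseteq> {w. f w \<noteq> \<zero>} \<union> {w. g w \<noteq> \<zero>}" by auto
  ultimately show "(\<lambda>w. f w \<oplus> g w) \<in> carrier (free_algebra R X)"
    unfolding free_algebra_simps(1) by (auto dest: finite_subset intro: finite_UnI)
next
  fix f assume f: "f \<in> carrier (free_algebra R X)"
  have "{w. \<ominus> f w \<noteq> \<zero>} = {w. f w \<noteq> \<zero>}"
    using f by (auto simp: free_algebra_simps)
  then show "\<exists>y\<in>carrier (free_algebra R X). (\<lambda>w. y w \<oplus> f w) = (\<lambda>w. \<zero>)"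
    using f by (intro bexI[of _ "\<lambda>w. \<ominus> f w"]) (auto simp: free_algebra_simps l_neg)
qed (simp_all add: fun_eq_iff free_algebra_simps a_ac)

lemma free_algebra_assoc_algebra: "assoc_algebra R (free_algebra R X)"
proof (intro assoc_algebra.intro assoc_algebra_axioms.intro)
  have scale: "(\<lambda>w. c \<otimes> f w) \<in> carrier (free_algebra R X)"
    if "c \<in> carrier R" "f \<in> carrier (free_algebra R X)" for c f
  proof -
    have "{w. c \<otimes> f w \<noteq> \<zero>} \<subseteq> {w. f w \<noteq> \<zero>}" using that by auto
    then show ?thesis
      using that unfolding free_algebra_simps(1) by (auto dest: finite_subset)
  qed
  note val = free_algebra_simps(1)[THEN iffD1, THEN conjunct1, rule_format]
  note ops = free_algebra_simps(2-6)
  show "module R (free_algebra R X)"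
  proof (rule moduleI[OF is_cring free_algebra_abelian_group])
    show "c \<odot>\<^bsub>free_algebra R X\<^esub> f \<in> carrier (free_algebra R X)"
      if "c \<in> carrier R" "f \<in> carrier (free_algebra R X)" for c f
      using scale[OF that] by (simp add: ops)
  qed (simp_all add: ops val l_distr r_distr m_assoc)
  have "monoid (free_algebra R X)"
  proof (rule monoidI)
    show "f \<otimes>\<^bsub>free_algebra R X\<^esub> g \<in> carrier (free_algebra R X)"
      if "f \<in> carrier (free_algebra R X)" "g \<in> carrier (free_algebra R X)" for f g
      using conv_in_free_algebra[OF that] by (simp add: ops)
    show "\<one>\<^bsub>free_algebra R X\<^esub> \<in> carrier (free_algebra R X)"
      by (simp add: free_algebra_simps)
  qed (simp_all add: fun_eq_iff ops val conv_assoc conv_one_left conv_one_right)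
  then show "ring (free_algebra R X)"
    by (rule ringI[OF free_algebra_abelian_group]) (simp_all add: fun_eq_iff ops val conv_add_left conv_add_right)
qed (simp_all add: fun_eq_iff free_algebra_simps conv_scale_left conv_scale_right)

lemma free_var_closed: "x \<in> X \<Longrightarrow> free_var R x \<in> carrier (free_algebra R X)"
  by (auto simp: free_algebra_simps free_var_def)

lemma free_algebra_mono: "X \<subseteq> Y \<Longrightarrow> carrier (free_algebra R X) \<subseteq> carrier (free_algebra R Y)"
  using lists_mono[of X Y] unfolding free_algebra_simps(1) subset_iff by blast

text \<open>
  A monomial arises from the unit by multiplying with letters from the left, and an element of the
  free algebra is a finite linear combination of monomials.
\<close>

lemma free_algebra_induct [consumes 1, case_names zero one var add scale]:
  assumes f: "f \<in> carrier (free_algebra R X)"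
    and zero: "Q \<zero>\<^bsub>free_algebra R X\<^esub>"
    and one: "Q \<one>\<^bsub>free_algebra R X\<^esub>"
    and var: "\<And>x f. x \<in> X \<Longrightarrow> f \<in> carrier (free_algebra R X) \<Longrightarrow> Q f \<Longrightarrow>
      Q (free_var R x \<otimes>\<^bsub>free_algebra R X\<^esub> f)"
    and add: "\<And>f g. f \<in> carrier (free_algebra R X) \<Longrightarrow> g \<in> carrier (free_algebra R X) \<Longrightarrow>
      Q f \<Longrightarrow> Q g \<Longrightarrow> Q (f \<oplus>\<^bsub>free_algebra R X\<^esub> g)"
    and scale: "\<And>c f. c \<in> carrier R \<Longrightarrow> f \<in> carrier (free_algebra R X) \<Longrightarrow> Q f \<Longrightarrow>
      Q (c \<odot>\<^bsub>free_algebra R X\<^esub> f)"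
  shows "Q f"
proof -
  let ?P = "free_algebra R X"
  interpret P: assoc_algebra R ?P by (rule free_algebra_assoc_algebra)
  have word: "(\<lambda>v. if v = w then \<one> else \<zero>) \<in> carrier ?P \<and> Q (\<lambda>v. if v = w then \<one> else \<zero>)"
    if "w \<in> lists X" for w
    using that
  proof (induction w)
    case Nil
    then show ?case using one P.one_closed by (simp add: free_algebra_simps(3))
  next
    case (Cons x w)
    have "(\<lambda>v. if v = x # w then \<one> else \<zero>) = free_var R x \<otimes>\<^bsub>?P\<^esub> (\<lambda>v. if v = w then \<one> else \<zero>)"
      by (auto simp: free_algebra_simps conv_var split: list.splits)
    then show ?case using Cons var P.m_closed[OF free_var_closed] by auto
  qed
  have "finite S \<Longrightarrow> f \<in> carrier ?P \<Longrightarrow> {w. f w \<noteq> \<zero>} \<subseteq> S \<Longrightarrow> Q f" for S f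
  proof (induction S arbitrary: f rule: finite_induct)
    case empty
    then have "f = \<zero>\<^bsub>?P\<^esub>" by (auto simp: free_algebra_simps)
    then show ?case using zero by simp
  next
    case (insert w S)
    show ?case
    proof (cases "f w = \<zero>")
      case True
      then show ?thesis using insert by auto
    next
      case False
      let ?g = "\<lambda>v. if v = w then \<zero> else f v" and ?e = "\<lambda>v. if v = w then \<one> else \<zero>"
      have fw: "f w \<in> carrier R" and w: "w \<in> lists X"
        using insert.prems False by (auto simp: free_algebra_simps)
      have g: "?g \<in> carrier ?P"
        using insert.prems by (auto simp: free_algebra_simps elim: rev_finite_subset)
      have eq: "f = f w \<odot>\<^bsub>?P\<^esub> ?e \<oplus>\<^bsub>?P\<^esub> ?g"
        using insert.prems by (auto simp: free_algebra_simps)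
      have "Q ?g" using insert.prems by (intro insert.IH g) auto
      then have "Q (f w \<odot>\<^bsub>?P\<^esub> ?e \<oplus>\<^bsub>?P\<^esub> ?g)"
        using word[OF w] by (intro add scale P.smult_closed fw g) auto
      then show ?thesis by (subst eq)
    qed
  qed
  from this[OF _ f subset_refl] f show ?thesis by (simp add: free_algebra_simps(1))
qed

end

section \<open>Evaluation homomorphisms and presentations\<close>

definition algebra_hom ::
    "('k, 'e) ring_scheme \<Rightarrow> ('k, 'm, 'f) module_scheme \<Rightarrow> ('k, 'n, 'g) module_scheme
      \<Rightarrow> ('m \<Rightarrow> 'n) \<Rightarrow> bool" where
  "algebra_hom K M N h \<longleftrightarrow> h \<in> ring_hom M N \<and>
    (\<forall>c \<in> carrier K. \<forall>x \<in> carrier M. h (c \<odot>\<^bsub>M\<^esub> x) = c \<odot>\<^bsub>N\<^esub> h x)"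

definition free_eval :: "('k, 'e) ring_scheme \<Rightarrow> ('k, 'm, 'f) module_scheme \<Rightarrow> ('x \<Rightarrow> 'm)
    \<Rightarrow> ('x list \<Rightarrow> 'k) \<Rightarrow> 'm" where
  "free_eval K E ev f = (\<Oplus>\<^bsub>E\<^esub>w\<in>{w. f w \<noteq> \<zero>\<^bsub>K\<^esub>}. f w \<odot>\<^bsub>E\<^esub> foldr (\<lambda>x m. ev x \<otimes>\<^bsub>E\<^esub> m) w \<one>\<^bsub>E\<^esub>)"

lemma ring_semiring:
  assumes "ring S"
  shows "semiring S"
proof -
  interpret ring S by (rule assms)
  show ?thesis by (rule semiring_axioms)
qed

context assoc_algebra
begin

lemma word_closed:
  "ev \<in> X \<rightarrow> carrier M \<Longrightarrow> w \<in> lists X \<Longrightarrow> foldr (\<lambda>x m. ev x \<otimes>\<^bsub>M\<^esub> m) w \<one>\<^bsub>M\<^esub> \<in> carrier M"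
  by (induction w) auto

text \<open>
  Evaluations of different elements are compared over a common finite set of words.
\<close>

lemma free_eval_superset:
  assumes ev: "ev \<in> X \<rightarrow> carrier M" and f: "f \<in> carrier (free_algebra R X)"
    and S: "finite S" "{w. f w \<noteq> \<zero>} \<subseteq> S" "S \<subseteq> lists X"
  shows "free_eval R M ev f = (\<Oplus>\<^bsub>M\<^esub>w\<in>S. f w \<odot>\<^bsub>M\<^esub> foldr (\<lambda>x m. ev x \<otimes>\<^bsub>M\<^esub> m) w \<one>\<^bsub>M\<^esub>)"
  unfolding free_eval_def
  using assms word_closed[OF ev]
  by (intro M.add.finprod_mono_neutral_cong_left) (auto simp: free_algebra_simps)

text \<open>
  Multiplying by a letter prefixes it to every word of the support, so evaluation is compatible with
  products whose left factor is a letter; induction on the left factor gives multiplicativity.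
\<close>

lemma free_eval_algebra_hom:
  assumes ev: "ev \<in> X \<rightarrow> carrier M"
  shows "algebra_hom R (free_algebra R X) M (free_eval R M ev)"
    and "x \<in> X \<Longrightarrow> free_eval R M ev (free_var R x) = ev x"
proof -
  let ?P = "free_algebra R X" and ?h = "free_eval R M ev"
  let ?W = "\<lambda>w. foldr (\<lambda>x m. ev x \<otimes>\<^bsub>M\<^esub> m) w \<one>\<^bsub>M\<^esub>"
  interpret P: assoc_algebra R ?P by (rule R.free_algebra_assoc_algebra)
  have rM: "ring M" and rP: "ring ?P"
    by (rule assoc_algebra.axioms(2)[OF assoc_algebra_axioms])
      (rule assoc_algebra.axioms(2)[OF R.free_algebra_assoc_algebra])
  have sM: "semiring M" by (rule ring_semiring[OF rM])
  note W = word_closed[OF ev]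
  have closed: "?h f \<in> carrier M" if "f \<in> carrier ?P" for f
    unfolding free_eval_def using that W
    by (intro M.finsum_closed) (auto simp: free_algebra_simps)
  have h_add: "?h (f \<oplus>\<^bsub>?P\<^esub> g) = ?h f \<oplus>\<^bsub>M\<^esub> ?h g" if f: "f \<in> carrier ?P" and g: "g \<in> carrier ?P" for f g
  proof -
    let ?S = "{w. f w \<noteq> \<zero>} \<union> {w. g w \<noteq> \<zero>}"
    have S: "finite ?S" "?S \<subseteq> lists X" and fc: "f \<in> UNIV \<rightarrow> carrier R" "g \<in> UNIV \<rightarrow> carrier R"
      using f g by (auto simp: free_algebra_simps)
    have "?h (f \<oplus>\<^bsub>?P\<^esub> g) = (\<Oplus>\<^bsub>M\<^esub>w\<in>?S. (f \<oplus>\<^bsub>?P\<^esub> g) w \<odot>\<^bsub>M\<^esub> ?W w)"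
      using f g by (intro free_eval_superset[OF ev P.a_closed S(1) _ S(2)]) (auto simp: free_algebra_simps)
    also have "\<dots> = (\<Oplus>\<^bsub>M\<^esub>w\<in>?S. f w \<odot>\<^bsub>M\<^esub> ?W w \<oplus>\<^bsub>M\<^esub> g w \<odot>\<^bsub>M\<^esub> ?W w)"
      using S fc W by (intro M.finsum_cong') (auto simp: free_algebra_simps smult_l_distr Pi_iff)
    also have "\<dots> = (\<Oplus>\<^bsub>M\<^esub>w\<in>?S. f w \<odot>\<^bsub>M\<^esub> ?W w) \<oplus>\<^bsub>M\<^esub> (\<Oplus>\<^bsub>M\<^esub>w\<in>?S. g w \<odot>\<^bsub>M\<^esub> ?W w)"
      using S fc W by (intro M.finsum_addf) (auto simp: Pi_iff)
    also have "\<dots> = ?h f \<oplus>\<^bsub>M\<^esub> ?h g"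
      using free_eval_superset[OF ev f S(1) _ S(2)] free_eval_superset[OF ev g S(1) _ S(2)] by simp
    finally show ?thesis .
  qed
  have h_scale: "?h (c \<odot>\<^bsub>?P\<^esub> f) = c \<odot>\<^bsub>M\<^esub> ?h f" if c: "c \<in> carrier R" and f: "f \<in> carrier ?P" for c f
  proof -
    let ?S = "{w. f w \<noteq> \<zero>}"
    have S: "finite ?S" "?S \<subseteq> lists X" and fc: "f \<in> UNIV \<rightarrow> carrier R"
      using f by (auto simp: free_algebra_simps)
    have "?h (c \<odot>\<^bsub>?P\<^esub> f) = (\<Oplus>\<^bsub>M\<^esub>w\<in>?S. (c \<odot>\<^bsub>?P\<^esub> f) w \<odot>\<^bsub>M\<^esub> ?W w)"
      using f c by (intro free_eval_superset[OF ev P.smult_closed S(1) _ S(2)]) (auto simp: free_algebra_simps)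
    also have "\<dots> = (\<Oplus>\<^bsub>M\<^esub>w\<in>?S. c \<odot>\<^bsub>M\<^esub> (f w \<odot>\<^bsub>M\<^esub> ?W w))"
      using S fc W c by (intro M.finsum_cong') (auto simp: free_algebra_simps smult_assoc1 Pi_iff)
    also have "\<dots> = c \<odot>\<^bsub>M\<^esub> ?h f"
      unfolding free_eval_def using S fc W c by (intro finsum_smult_ldistr[symmetric]) (auto simp: Pi_iff)
    finally show ?thesis .
  qed
  have h_one: "?h \<one>\<^bsub>?P\<^esub> = \<one>\<^bsub>M\<^esub>"
  proof -
    have "?h \<one>\<^bsub>?P\<^esub> = (\<Oplus>\<^bsub>M\<^esub>w\<in>{[]}. \<one>\<^bsub>?P\<^esub> w \<odot>\<^bsub>M\<^esub> ?W w)"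
      by (intro free_eval_superset[OF ev P.one_closed]) (auto simp: free_algebra_simps)
    then show ?thesis by (simp add: free_algebra_simps)
  qed
  have h_zero: "?h \<zero>\<^bsub>?P\<^esub> = \<zero>\<^bsub>M\<^esub>" by (simp add: free_eval_def free_algebra_simps)
  have eval_var: "?h (free_var R x \<otimes>\<^bsub>?P\<^esub> g) = ev x \<otimes>\<^bsub>M\<^esub> ?h g" if x: "x \<in> X" and g: "g \<in> carrier ?P" for x g
  proof -
    let ?S = "{w. g w \<noteq> \<zero>}"
    have S: "finite ?S" "?S \<subseteq> lists X" and gc: "g \<in> UNIV \<rightarrow> carrier R"
      using g by (auto simp: free_algebra_simps)
    have val: "(free_var R x \<otimes>\<^bsub>?P\<^esub> g) w = (case w of [] \<Rightarrow> \<zero> | y # v \<Rightarrow> if y = x then g v else \<zero>)" for w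
      using gc by (simp add: free_algebra_simps Pi_iff conv_var)
    have supp: "{w. (free_var R x \<otimes>\<^bsub>?P\<^esub> g) w \<noteq> \<zero>} \<subseteq> (#) x ` ?S"
    proof
      fix w assume "w \<in> {w. (free_var R x \<otimes>\<^bsub>?P\<^esub> g) w \<noteq> \<zero>}"
      then show "w \<in> (#) x ` ?S" by (cases w) (auto simp: val split: if_splits)
    qed
    have "?h (free_var R x \<otimes>\<^bsub>?P\<^esub> g) = (\<Oplus>\<^bsub>M\<^esub>w\<in>(#) x ` ?S. (free_var R x \<otimes>\<^bsub>?P\<^esub> g) w \<odot>\<^bsub>M\<^esub> ?W w)"
      using S x supp by (intro free_eval_superset[OF ev P.m_closed[OF R.free_var_closed[OF x] g]]) auto
    also have "\<dots> = (\<Oplus>\<^bsub>M\<^esub>w\<in>?S. (free_var R x \<otimes>\<^bsub>?P\<^esub> g) (x # w) \<odot>\<^bsub>M\<^esub> ?W (x # w))"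
      using S x gc W ev by (intro M.finsum_reindex) (auto simp: val Pi_iff inj_on_def simp del: foldr.simps)
    also have "\<dots> = (\<Oplus>\<^bsub>M\<^esub>w\<in>?S. ev x \<otimes>\<^bsub>M\<^esub> (g w \<odot>\<^bsub>M\<^esub> ?W w))"
      using S x gc W ev by (intro M.finsum_cong') (auto simp: val Pi_iff smult_mult_right)
    also have "\<dots> = ev x \<otimes>\<^bsub>M\<^esub> ?h g"
      unfolding free_eval_def using S x gc W ev by (intro semiring.finsum_rdistr[OF sM, symmetric]) (auto simp: Pi_iff)
    finally show ?thesis .
  qed
  have mult: "?h (f \<otimes>\<^bsub>?P\<^esub> g) = ?h f \<otimes>\<^bsub>M\<^esub> ?h g" if f: "f \<in> carrier ?P" and g: "g \<in> carrier ?P" for f g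
    using f
  proof (induction f rule: R.free_algebra_induct)
    case zero
    show ?case
      using closed[OF g] g ring.ring_simprules(24)[OF rM] ring.ring_simprules(24)[OF rP] h_zero by simp
  next
    case one
    show ?case
      using closed[OF g] g ring.ring_simprules(12)[OF rM] ring.ring_simprules(12)[OF rP] h_one by simp
  next
    case (var x f)
    have "?h (free_var R x \<otimes>\<^bsub>?P\<^esub> f \<otimes>\<^bsub>?P\<^esub> g) = ?h (free_var R x \<otimes>\<^bsub>?P\<^esub> (f \<otimes>\<^bsub>?P\<^esub> g))"
      by (simp only: ring.ring_simprules(11)[OF rP R.free_var_closed[OF var(1)] var(2) g])
    also have "\<dots> = ev x \<otimes>\<^bsub>M\<^esub> (?h f \<otimes>\<^bsub>M\<^esub> ?h g)"
      using eval_var[OF var(1) P.m_closed[OF var(2) g]] var(3) by simp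
    also have "\<dots> = ?h (free_var R x \<otimes>\<^bsub>?P\<^esub> f) \<otimes>\<^bsub>M\<^esub> ?h g"
      using ring.ring_simprules(11)[OF rM Pi_mem[OF ev var(1)] closed[OF var(2)] closed[OF g]]
        eval_var[OF var(1,2)] by simp
    finally show ?case .
  next
    case (add f f')
    then show ?case
      using ring.ring_simprules(13)[OF rP, of f f' g] ring.ring_simprules(13)[OF rM, of "?h f" "?h f'" "?h g"]
        h_add closed g P.m_closed by simp
  next
    case (scale c f)
    then show ?case
      using P.smult_mult_left[of c f g] smult_mult_left[of c "?h f" "?h g"]
        h_scale closed g P.m_closed by simp
  qed
  show "algebra_hom R ?P M ?h"
    unfolding algebra_hom_def using closed h_add mult h_one h_scale by (auto intro!: ring_hom_memI)
  show "?h (free_var R x) = ev x" if "x \<in> X"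
  proof -
    have "?h (free_var R x) = ?h (free_var R x \<otimes>\<^bsub>?P\<^esub> \<one>\<^bsub>?P\<^esub>)"
      using monoid.r_one[OF ring.is_monoid[OF rP] R.free_var_closed[OF that]] by simp
    also have "\<dots> = ev x"
      unfolding eval_var[OF that P.one_closed] h_one
      by (rule monoid.r_one[OF ring.is_monoid[OF rM] Pi_mem[OF ev that]])
    finally show ?thesis .
  qed
qed

end

text \<open>
  The isomorphism theorem: the ideal generated by the relations lies in the kernel, which is an ideal,
  and the last assumption is the reverse inclusion.
\<close>

lemma presented_byI:
  assumes K: "cring K" and E: "assoc_algebra K E"
    and h: "algebra_hom K (free_algebra K X) E h"
    and R: "R \<subseteq> carrier (free_algebra K X)" "\<And>r. r \<in> R \<Longrightarrow> h r = \<zero>\<^bsub>E\<^esub>"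
    and ev: "\<And>y. y \<in> X \<Longrightarrow> h (free_var K y) = ev y"
    and surj: "\<And>m. m \<in> carrier E \<Longrightarrow> \<exists>p \<in> carrier (free_algebra K X). h p = m"
    and inj: "\<And>p. p \<in> carrier (free_algebra K X) \<Longrightarrow> h p = \<zero>\<^bsub>E\<^esub> \<Longrightarrow> p \<in> Idl\<^bsub>free_algebra K X\<^esub> R"
  shows "presented_by K E X R ev"
proof -
  let ?P = "free_algebra K X" and ?I = "Idl\<^bsub>free_algebra K X\<^esub> R"
  interpret K: cring K by (rule K)
  have rE: "ring E" and rP: "ring ?P"
    by (rule assoc_algebra.axioms(2)[OF E])
      (rule assoc_algebra.axioms(2)[OF K.free_algebra_assoc_algebra])
  interpret h: ring_hom_ring ?P E h
    using h by (intro ring_hom_ringI2 rE rP) (simp add: algebra_hom_def)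
  have ker: "x \<in> a_kernel ?P E h \<longleftrightarrow> x \<in> carrier ?P \<and> h x = \<zero>\<^bsub>E\<^esub>" for x
    unfolding a_kernel_def' by simp
  have "?I \<subseteq> a_kernel ?P E h"
    using R ker by (intro ring.genideal_minimal[OF rP] h.kernel_is_ideal) blast
  moreover have "a_kernel ?P E h \<subseteq> ?I"
    using inj ker by blast
  ultimately have I: "?I = a_kernel ?P E h" by (rule subset_antisym)
  let ?\<psi> = "\<lambda>X. the_elem (h ` X)"
  have "h ` carrier ?P = carrier E"
    using surj h.hom_closed by blast
  then have iso: "?\<psi> \<in> ring_iso (?P Quot ?I) E"
    unfolding I by (rule h.FactRing_iso_set)
  have val: "?\<psi> (?I +>\<^bsub>?P\<^esub> f) = h f" if "f \<in> carrier ?P" for f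
    unfolding I using that by (rule h.the_elem_simp)
  have lin: "?\<psi> (?I +>\<^bsub>?P\<^esub> (c \<odot>\<^bsub>?P\<^esub> f)) = c \<odot>\<^bsub>E\<^esub> ?\<psi> (?I +>\<^bsub>?P\<^esub> f)"
    if "c \<in> carrier K" "f \<in> carrier ?P" for c f
    using that h assoc_algebra.axioms(1)[OF K.free_algebra_assoc_algebra, of X]
    by (simp add: val algebra_hom_def module.smult_closed)
  have gen: "?\<psi> (?I +>\<^bsub>?P\<^esub> free_var K y) = ev y" if "y \<in> X" for y
    using that by (simp add: val K.free_var_closed ev)
  show ?thesis
    unfolding presented_by_def Let_def
    by (intro conjI bexI[OF _ iso] ballI E) (rule lin gen, assumption+)+
qed

section \<open>Strict linear monoidal categories and their quotients\<close>

text \<open>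
  The axioms are stated for elements of hom-sets because the operations of a \<open>lin_mon_cat\<close> are
  unspecified on other arguments.
\<close>

locale lin_mon_category =
  fixes K :: "('k, 'e) ring_scheme" and C :: "('o, 'm, 'k, 'z) lin_mon_cat_scheme" (structure)
  assumes ground_cring: "cring K"
    and tensO_assoc: "TensO C (TensO C X Y) Z = TensO C X (TensO C Y Z)"
    and unitO_left: "TensO C (UnitO C) X = X"
    and unitO_right: "TensO C X (UnitO C) = X"
    and Ident_Hom: "Ident C X \<in> Hom C X X"
    and comp_Hom: "g \<in> Hom C Y Z \<Longrightarrow> f \<in> Hom C X Y \<Longrightarrow> g \<cdot> f \<in> Hom C X Z"
    and tens_Hom: "f \<in> Hom C X Y \<Longrightarrow> g \<in> Hom C X' Y' \<Longrightarrow> f \<boxtimes> g \<in> Hom C (TensO C X X') (TensO C Y Y')"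
    and zero_Hom: "ZeroM C X Y \<in> Hom C X Y"
    and add_Hom: "f \<in> Hom C X Y \<Longrightarrow> g \<in> Hom C X Y \<Longrightarrow> AddM C f g \<in> Hom C X Y"
    and scale_Hom: "c \<in> carrier K \<Longrightarrow> f \<in> Hom C X Y \<Longrightarrow> ScaleM C c f \<in> Hom C X Y"
    and comp_assoc: "h \<in> Hom C Z W \<Longrightarrow> g \<in> Hom C Y Z \<Longrightarrow> f \<in> Hom C X Y \<Longrightarrow> h \<cdot> g \<cdot> f = h \<cdot> (g \<cdot> f)"
    and id_left: "f \<in> Hom C X Y \<Longrightarrow> Ident C Y \<cdot> f = f"
    and id_right: "f \<in> Hom C X Y \<Longrightarrow> f \<cdot> Ident C X = f"
    and add_assoc: "f \<in> Hom C X Y \<Longrightarrow> g \<in> Hom C X Y \<Longrightarrow> h \<in> Hom C X Y \<Longrightarrow>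
      AddM C (AddM C f g) h = AddM C f (AddM C g h)"
    and add_comm: "f \<in> Hom C X Y \<Longrightarrow> g \<in> Hom C X Y \<Longrightarrow> AddM C f g = AddM C g f"
    and add_zero: "f \<in> Hom C X Y \<Longrightarrow> AddM C f (ZeroM C X Y) = f"
    and add_inverse: "f \<in> Hom C X Y \<Longrightarrow> AddM C f (ScaleM C (\<ominus>\<^bsub>K\<^esub> \<one>\<^bsub>K\<^esub>) f) = ZeroM C X Y"
    and scale_add: "c \<in> carrier K \<Longrightarrow> f \<in> Hom C X Y \<Longrightarrow> g \<in> Hom C X Y \<Longrightarrow>
      ScaleM C c (AddM C f g) = AddM C (ScaleM C c f) (ScaleM C c g)"
    and add_scale: "c \<in> carrier K \<Longrightarrow> c' \<in> carrier K \<Longrightarrow> f \<in> Hom C X Y \<Longrightarrow>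
      ScaleM C (c \<oplus>\<^bsub>K\<^esub> c') f = AddM C (ScaleM C c f) (ScaleM C c' f)"
    and scale_scale: "c \<in> carrier K \<Longrightarrow> c' \<in> carrier K \<Longrightarrow> f \<in> Hom C X Y \<Longrightarrow>
      ScaleM C (c \<otimes>\<^bsub>K\<^esub> c') f = ScaleM C c (ScaleM C c' f)"
    and scale_one: "f \<in> Hom C X Y \<Longrightarrow> ScaleM C \<one>\<^bsub>K\<^esub> f = f"
    and comp_add_left: "g \<in> Hom C Y Z \<Longrightarrow> g' \<in> Hom C Y Z \<Longrightarrow> f \<in> Hom C X Y \<Longrightarrow>
      AddM C g g' \<cdot> f = AddM C (g \<cdot> f) (g' \<cdot> f)"
    and comp_add_right: "g \<in> Hom C Y Z \<Longrightarrow> f \<in> Hom C X Y \<Longrightarrow> f' \<in> Hom C X Y \<Longrightarrow>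
      g \<cdot> AddM C f f' = AddM C (g \<cdot> f) (g \<cdot> f')"
    and comp_scale_left: "c \<in> carrier K \<Longrightarrow> g \<in> Hom C Y Z \<Longrightarrow> f \<in> Hom C X Y \<Longrightarrow>
      ScaleM C c g \<cdot> f = ScaleM C c (g \<cdot> f)"
    and comp_scale_right: "c \<in> carrier K \<Longrightarrow> g \<in> Hom C Y Z \<Longrightarrow> f \<in> Hom C X Y \<Longrightarrow>
      g \<cdot> ScaleM C c f = ScaleM C c (g \<cdot> f)"
    and tens_id: "Ident C X \<boxtimes> Ident C Y = Ident C (TensO C X Y)"
    and interchange: "g \<in> Hom C Y Z \<Longrightarrow> f \<in> Hom C X Y \<Longrightarrow> g' \<in> Hom C Y' Z' \<Longrightarrow> f' \<in> Hom C X' Y' \<Longrightarrow>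
      (g \<boxtimes> g') \<cdot> (f \<boxtimes> f') = (g \<cdot> f) \<boxtimes> (g' \<cdot> f')"
    and tens_add_left: "f \<in> Hom C X Y \<Longrightarrow> f' \<in> Hom C X Y \<Longrightarrow> g \<in> Hom C X' Y' \<Longrightarrow>
      AddM C f f' \<boxtimes> g = AddM C (f \<boxtimes> g) (f' \<boxtimes> g)"
    and tens_add_right: "f \<in> Hom C X Y \<Longrightarrow> g \<in> Hom C X' Y' \<Longrightarrow> g' \<in> Hom C X' Y' \<Longrightarrow>
      f \<boxtimes> AddM C g g' = AddM C (f \<boxtimes> g) (f \<boxtimes> g')"
    and tens_scale_left: "c \<in> carrier K \<Longrightarrow> f \<in> Hom C X Y \<Longrightarrow> g \<in> Hom C X' Y' \<Longrightarrow>
      ScaleM C c f \<boxtimes> g = ScaleM C c (f \<boxtimes> g)"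
    and tens_scale_right: "c \<in> carrier K \<Longrightarrow> f \<in> Hom C X Y \<Longrightarrow> g \<in> Hom C X' Y' \<Longrightarrow>
      f \<boxtimes> ScaleM C c g = ScaleM C c (f \<boxtimes> g)"
    and tens_assoc: "f \<in> Hom C X Y \<Longrightarrow> g \<in> Hom C X' Y' \<Longrightarrow> h \<in> Hom C X'' Y'' \<Longrightarrow>
      f \<boxtimes> g \<boxtimes> h = f \<boxtimes> (g \<boxtimes> h)"
    and tens_unit_left: "f \<in> Hom C X Y \<Longrightarrow> Ident C (UnitO C) \<boxtimes> f = f"
    and tens_unit_right: "f \<in> Hom C X Y \<Longrightarrow> f \<boxtimes> Ident C (UnitO C) = f"

text \<open>
  Multiplication and unit are meaningful only for \<open>X = Y\<close>. Including them makes this one record serve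
  both as hom-module and as endomorphism algebra.
\<close>

definition Hom_module :: "('o, 'm, 'k, 'z) lin_mon_cat_scheme \<Rightarrow> 'o \<Rightarrow> 'o \<Rightarrow> ('k, 'm) module" where
  "Hom_module C X Y =
    \<lparr>carrier = Hom C X Y, mult = Comp C, one = Ident C X, zero = ZeroM C X Y, add = AddM C,
     smult = ScaleM C\<rparr>"

lemma End_algebra_eq: "End_algebra C X = Hom_module C X X"
  by (simp add: End_algebra_def Hom_module_def)

lemma Hom_module_simps:
  "carrier (Hom_module C X Y) = Hom C X Y"
  "f \<otimes>\<^bsub>Hom_module C X Y\<^esub> g = Comp C f g"
  "\<one>\<^bsub>Hom_module C X Y\<^esub> = Ident C X"
  "\<zero>\<^bsub>Hom_module C X Y\<^esub> = ZeroM C X Y"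
  "f \<oplus>\<^bsub>Hom_module C X Y\<^esub> g = AddM C f g"
  "c \<odot>\<^bsub>Hom_module C X Y\<^esub> f = ScaleM C c f"
  by (simp_all add: Hom_module_def)

lemma Hom_Mor: "f \<in> Hom C X Y \<Longrightarrow> f \<in> Mor C"
  by (simp add: Hom_def)

lemma HomI: "f \<in> Mor C \<Longrightarrow> f \<in> Hom C (Dom C f) (Cod C f)"
  by (simp add: Hom_def)

lemma Hom_Dom: "f \<in> Hom C X Y \<Longrightarrow> Dom C f = X"
  and Hom_Cod: "f \<in> Hom C X Y \<Longrightarrow> Cod C f = Y"
  by (simp_all add: Hom_def)

context lin_mon_category
begin

lemma minus_one_closed: "\<ominus>\<^bsub>K\<^esub> \<one>\<^bsub>K\<^esub> \<in> carrier K"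
proof -
  interpret cring K by (rule ground_cring)
  show ?thesis by simp
qed

lemma Hom_module: "module K (Hom_module C X Y)"
proof (rule moduleI[OF ground_cring])
  show "abelian_group (Hom_module C X Y)"
  proof (rule abelian_groupI, unfold Hom_module_simps)
    show "AddM C (ZeroM C X Y) f = f" if "f \<in> Hom C X Y" for f
      using that add_zero add_comm zero_Hom by metis
    show "\<exists>g\<in>Hom C X Y. AddM C g f = ZeroM C X Y" if f: "f \<in> Hom C X Y" for f
      using f add_inverse[OF f] add_comm[OF scale_Hom[OF minus_one_closed f] f]
        scale_Hom[OF minus_one_closed f] by auto
  qed (rule add_Hom zero_Hom add_assoc add_comm, (assumption+)?)+
qed (unfold Hom_module_simps, (rule scale_Hom add_scale scale_add scale_scale scale_one, (assumption+)?)+)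

lemma End_assoc_algebra: "assoc_algebra K (End_algebra C X)"
  unfolding End_algebra_eq
proof (intro assoc_algebra.intro assoc_algebra_axioms.intro Hom_module ringI)
  show "abelian_group (Hom_module C X X)" by (rule module.axioms(2)[OF Hom_module])
  show "monoid (Hom_module C X X)"
    by (rule monoidI, unfold Hom_module_simps)
       (rule comp_Hom Ident_Hom comp_assoc id_left id_right, (assumption+)?)+
qed (unfold Hom_module_simps,
   (rule comp_scale_left comp_scale_right comp_add_left comp_add_right, (assumption+)?)+)

lemma DiffM_eq:
  assumes "f \<in> Hom C X Y" "g \<in> Hom C X Y"
  shows "DiffM K C f g = f \<ominus>\<^bsub>Hom_module C X Y\<^esub> g"
proof -
  interpret M: module K "Hom_module C X Y" by (rule Hom_module)
  show ?thesis
    using M.smult_l_minus[of "\<one>\<^bsub>K\<^esub>" g] M.smult_one[of g] M.R.one_closed assms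
    by (simp add: DiffM_def a_minus_def Hom_module_simps)
qed

lemma DiffM_eq':
  "f \<in> carrier (Hom_module C X Y) \<Longrightarrow> g \<in> carrier (Hom_module C X Y) \<Longrightarrow>
    DiffM K C f g = f \<ominus>\<^bsub>Hom_module C X Y\<^esub> g"
  by (rule DiffM_eq) (simp_all only: Hom_module_simps)

lemma Diff_Hom: "f \<in> Hom C X Y \<Longrightarrow> g \<in> Hom C X Y \<Longrightarrow> DiffM K C f g \<in> Hom C X Y"
  unfolding DiffM_def by (intro add_Hom scale_Hom minus_one_closed)

lemma scale_zero: "f \<in> Hom C X Y \<Longrightarrow> ScaleM C \<zero>\<^bsub>K\<^esub> f = ZeroM C X Y"
  using module.smult_l_null[OF Hom_module, of f X Y] by (simp add: Hom_module_simps)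

lemma zero_closed: "\<zero>\<^bsub>K\<^esub> \<in> carrier K"
proof -
  interpret cring K by (rule ground_cring)
  show ?thesis by simp
qed

lemma comp_zero_left: "f \<in> Hom C X Y \<Longrightarrow> ZeroM C Y Z \<cdot> f = ZeroM C X Z"
  using comp_scale_left[OF zero_closed zero_Hom, of f X Y Z]
  by (simp add: scale_zero[OF zero_Hom] scale_zero[OF comp_Hom[OF zero_Hom]])

lemma comp_zero_right: "g \<in> Hom C Y Z \<Longrightarrow> g \<cdot> ZeroM C X Y = ZeroM C X Z"
  using comp_scale_right[OF zero_closed _ zero_Hom, of g Y Z X]
  by (simp add: scale_zero[OF zero_Hom] scale_zero[OF comp_Hom[OF _ zero_Hom]])

lemma tens_zero_left: "g \<in> Hom C X' Y' \<Longrightarrow> ZeroM C X Y \<boxtimes> g = ZeroM C (TensO C X X') (TensO C Y Y')"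
  using tens_scale_left[OF zero_closed zero_Hom, of g X' Y' X Y]
  by (simp add: scale_zero[OF zero_Hom] scale_zero[OF tens_Hom[OF zero_Hom]])

lemma tens_zero_right: "f \<in> Hom C X Y \<Longrightarrow> f \<boxtimes> ZeroM C X' Y' = ZeroM C (TensO C X X') (TensO C Y Y')"
  using tens_scale_right[OF zero_closed _ zero_Hom, of f X Y X' Y']
  by (simp add: scale_zero[OF zero_Hom] scale_zero[OF tens_Hom[OF _ zero_Hom]])

end

locale tensor_quotient = lin_mon_category K C
  for K :: "('k, 'e) ring_scheme" and C :: "('o, 'm, 'k, 'z) lin_mon_cat_scheme" (structure) +
  fixes Rel :: "'m set"
  assumes Rel_Mor: "Rel \<subseteq> Mor C"
begin

abbreviation I where "I \<equiv> gen_tensor_ideal K C Rel"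
abbreviation Q where "Q \<equiv> quot_cat K C I"
abbreviation qc where "qc \<equiv> quot_class K C I"

text \<open>
  Congruence modulo the tensor ideal, restricted to parallel morphisms. The difference on the right
  alone would not force \<open>f\<close> and \<open>g\<close> to be parallel.
\<close>

definition cong :: "'m \<Rightarrow> 'm \<Rightarrow> bool" where
  "cong f g \<longleftrightarrow> g \<in> Mor C \<and> f \<in> Hom C (Dom C g) (Cod C g) \<and> DiffM K C f g \<in> I"

lemma cong_iff: "g \<in> Hom C X Y \<Longrightarrow> cong f g \<longleftrightarrow> f \<in> Hom C X Y \<and> DiffM K C f g \<in> I"
  by (auto simp: cong_def Hom_def)

lemma ideal_add: "f \<in> I \<Longrightarrow> g \<in> I \<Longrightarrow> f \<in> Hom C X Y \<Longrightarrow> g \<in> Hom C X Y \<Longrightarrow> AddM C f g \<in> I"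
  by (intro gen_tensor_ideal.add) (simp_all add: Hom_def)

lemma cong_refl: "f \<in> Hom C X Y \<Longrightarrow> cong f f"
  by (simp add: cong_iff DiffM_def add_inverse gen_tensor_ideal.zero)

lemma cong_sym: "cong f g \<Longrightarrow> cong g f"
proof -
  assume fg: "cong f g"
  let ?X = "Dom C g" and ?Y = "Cod C g"
  interpret M: module K "Hom_module C ?X ?Y" by (rule Hom_module)
  have f: "f \<in> Hom C ?X ?Y" and g: "g \<in> Hom C ?X ?Y" and I: "DiffM K C f g \<in> I"
    using fg by (auto simp: cong_def Hom_def)
  have "DiffM K C g f = ScaleM C (\<ominus>\<^bsub>K\<^esub> \<one>\<^bsub>K\<^esub>) (DiffM K C f g)"
    using M.smult_l_minus[of "\<one>\<^bsub>K\<^esub>" "DiffM K C f g"] M.smult_one[of "DiffM K C f g"] Diff_Hom[OF f g] f g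
    by (simp add: DiffM_eq'[where X="?X" and Y="?Y"] Hom_module_simps(1,6)[where C=C and X="?X" and Y="?Y", symmetric]
        M.minus_eq M.minus_add M.a_comm)
  then show ?thesis
    using I f g by (simp add: cong_iff[OF f] gen_tensor_ideal.scale minus_one_closed)
qed

lemma cong_trans: "cong f g \<Longrightarrow> cong g h \<Longrightarrow> cong f h"
proof -
  assume fg: "cong f g" and gh: "cong g h"
  let ?X = "Dom C h" and ?Y = "Cod C h"
  interpret M: module K "Hom_module C ?X ?Y" by (rule Hom_module)
  have g: "g \<in> Hom C ?X ?Y" and h: "h \<in> Hom C ?X ?Y"
    and I: "DiffM K C g h \<in> I"
    using gh by (auto simp: cong_def Hom_def)
  have f: "f \<in> Hom C ?X ?Y" and I': "DiffM K C f g \<in> I"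
    using fg g by (auto simp: cong_iff[OF g])
  have "DiffM K C f h = AddM C (DiffM K C f g) (DiffM K C g h)"
    using f g h M.r_neg2[of g "\<ominus>\<^bsub>Hom_module C ?X ?Y\<^esub> h"] M.r_neg1[of g "\<ominus>\<^bsub>Hom_module C ?X ?Y\<^esub> h"]
    by (simp add: DiffM_eq'[where X="?X" and Y="?Y"] Hom_module_simps(1,5)[where C=C and X="?X" and Y="?Y", symmetric]
        M.minus_eq M.a_assoc)
  then show ?thesis
    using ideal_add[OF I' I Diff_Hom[OF f g] Diff_Hom[OF g h]] f by (simp add: cong_iff[OF h])
qed

lemma cong_Hom: "cong f g \<Longrightarrow> g \<in> Hom C X Y \<Longrightarrow> f \<in> Hom C X Y"
  by (simp add: cong_iff)

lemma cong_add:
  assumes g: "g \<in> Hom C X Y" and g': "g' \<in> Hom C X Y" and fg: "cong f g" and fg': "cong f' g'"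
  shows "cong (AddM C f f') (AddM C g g')"
proof -
  interpret M: module K "Hom_module C X Y" by (rule Hom_module)
  have f: "f \<in> Hom C X Y" "DiffM K C f g \<in> I" and f': "f' \<in> Hom C X Y" "DiffM K C f' g' \<in> I"
    using fg fg' by (auto simp: cong_iff[OF g] cong_iff[OF g'])
  have "DiffM K C (AddM C f f') (AddM C g g') = AddM C (DiffM K C f g) (DiffM K C f' g')"
    using f(1) g f'(1) g' add_Hom[OF f(1) f'(1)] add_Hom[OF g g']
    by (simp add: DiffM_eq'[where X=X and Y=Y] Hom_module_simps(1,5)[where C=C and X=X and Y=Y, symmetric]
        M.minus_eq M.minus_add M.a_ac)
  then show ?thesis
    using ideal_add[OF f(2) f'(2) Diff_Hom[OF f(1) g] Diff_Hom[OF f'(1) g']] add_Hom[OF f(1) f'(1)]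
    by (simp add: cong_iff[OF add_Hom[OF g g']])
qed

lemma cong_scale:
  assumes g: "g \<in> Hom C X Y" and c: "c \<in> carrier K" and fg: "cong f g"
  shows "cong (ScaleM C c f) (ScaleM C c g)"
proof -
  interpret K: cring K by (rule ground_cring)
  have f: "f \<in> Hom C X Y" "DiffM K C f g \<in> I"
    using fg by (auto simp: cong_iff[OF g])
  have "DiffM K C (ScaleM C c f) (ScaleM C c g) = ScaleM C c (DiffM K C f g)"
    unfolding DiffM_def
    using f(1) g c minus_one_closed scale_Hom K.m_comm[OF c minus_one_closed]
    by (simp add: scale_add[of _ _ X Y] scale_scale[of _ _ _ X Y, symmetric])
  then show ?thesis
    using f c g by (simp add: cong_iff[OF scale_Hom[OF c g]] scale_Hom gen_tensor_ideal.scale)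
qed

lemma cong_comp_left:
  assumes g: "g \<in> Hom C Y Z" and f: "f \<in> Hom C X Y" and gg: "cong g' g"
  shows "cong (g' \<cdot> f) (g \<cdot> f)"
proof -
  have g': "g' \<in> Hom C Y Z" "DiffM K C g' g \<in> I"
    using gg by (auto simp: cong_iff[OF g])
  have "DiffM K C (g' \<cdot> f) (g \<cdot> f) = DiffM K C g' g \<cdot> f"
    unfolding DiffM_def
    by (simp add: comp_add_left[OF g'(1) scale_Hom[OF minus_one_closed g] f]
        comp_scale_left[OF minus_one_closed g f])
  then show ?thesis
    using gen_tensor_ideal.comp_right[OF g'(2) Hom_Mor[OF f]] Diff_Hom[OF g'(1) g] f comp_Hom[OF g'(1) f]
    by (simp add: cong_iff[OF comp_Hom[OF g f]] Hom_Dom Hom_Cod)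
qed

lemma cong_comp_right:
  assumes g: "g \<in> Hom C Y Z" and f: "f \<in> Hom C X Y" and ff: "cong f' f"
  shows "cong (g \<cdot> f') (g \<cdot> f)"
proof -
  have f': "f' \<in> Hom C X Y" "DiffM K C f' f \<in> I"
    using ff by (auto simp: cong_iff[OF f])
  have "DiffM K C (g \<cdot> f') (g \<cdot> f) = g \<cdot> DiffM K C f' f"
    unfolding DiffM_def
    by (simp add: comp_add_right[OF g f'(1) scale_Hom[OF minus_one_closed f]]
        comp_scale_right[OF minus_one_closed g f])
  then show ?thesis
    using gen_tensor_ideal.comp_left[OF f'(2) Hom_Mor[OF g]] Diff_Hom[OF f'(1) f] g comp_Hom[OF g f'(1)]
    by (simp add: cong_iff[OF comp_Hom[OF g f]] Hom_Dom Hom_Cod)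
qed

lemma cong_comp:
  assumes g: "g \<in> Hom C Y Z" and f: "f \<in> Hom C X Y" and "cong g' g" "cong f' f"
  shows "cong (g' \<cdot> f') (g \<cdot> f)"
  using cong_trans[OF cong_comp_right[of g' Y Z f X] cong_comp_left[OF g f]] assms
  by (simp add: cong_Hom)

lemma cong_tens_left:
  assumes g: "g \<in> Hom C X Y" and f: "f \<in> Hom C X' Y'" and gg: "cong g' g"
  shows "cong (g' \<boxtimes> f) (g \<boxtimes> f)"
proof -
  have g': "g' \<in> Hom C X Y" "DiffM K C g' g \<in> I"
    using gg by (auto simp: cong_iff[OF g])
  have "DiffM K C (g' \<boxtimes> f) (g \<boxtimes> f) = DiffM K C g' g \<boxtimes> f"
    unfolding DiffM_def
    by (simp add: tens_add_left[OF g'(1) scale_Hom[OF minus_one_closed g] f]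
        tens_scale_left[OF minus_one_closed g f])
  then show ?thesis
    using gen_tensor_ideal.tens_right[OF g'(2) Hom_Mor[OF f]] tens_Hom[OF g'(1) f]
    by (simp add: cong_iff[OF tens_Hom[OF g f]])
qed

lemma cong_tens_right:
  assumes g: "g \<in> Hom C X Y" and f: "f \<in> Hom C X' Y'" and ff: "cong f' f"
  shows "cong (g \<boxtimes> f') (g \<boxtimes> f)"
proof -
  have f': "f' \<in> Hom C X' Y'" "DiffM K C f' f \<in> I"
    using ff by (auto simp: cong_iff[OF f])
  have "DiffM K C (g \<boxtimes> f') (g \<boxtimes> f) = g \<boxtimes> DiffM K C f' f"
    unfolding DiffM_def
    by (simp add: tens_add_right[OF g f'(1) scale_Hom[OF minus_one_closed f]]
        tens_scale_right[OF minus_one_closed g f])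
  then show ?thesis
    using gen_tensor_ideal.tens_left[OF f'(2) Hom_Mor[OF g]] tens_Hom[OF g f'(1)]
    by (simp add: cong_iff[OF tens_Hom[OF g f]])
qed

lemma cong_tens:
  assumes g: "g \<in> Hom C X Y" and f: "f \<in> Hom C X' Y'" and "cong g' g" "cong f' f"
  shows "cong (g' \<boxtimes> f') (g \<boxtimes> f)"
  using cong_trans[OF cong_tens_right[of g' X Y f X' Y'] cong_tens_left[OF g f]] assms
  by (simp add: cong_Hom)

lemma qc_eq: "f \<in> Mor C \<Longrightarrow> qc f = {g. cong g f}"
  by (auto simp: quot_class_def cong_def)

lemma qc_eqI: "cong f g \<Longrightarrow> qc f = qc g"
proof -
  assume fg: "cong f g"
  then have "f \<in> Mor C" "g \<in> Mor C" by (auto simp: cong_def Hom_def)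
  then show ?thesis
    using cong_trans[OF _ fg] cong_trans[OF _ cong_sym[OF fg]] by (auto simp: qc_eq)
qed

lemma qc_eqD: "qc f = qc g \<Longrightarrow> f \<in> Mor C \<Longrightarrow> g \<in> Mor C \<Longrightarrow> cong f g"
  using cong_refl[OF HomI, of f] by (auto simp: qc_eq)

lemma rep_cong: "f \<in> Mor C \<Longrightarrow> cong (rep (qc f)) f"
  using someI_ex[of "\<lambda>g. g \<in> qc f"] cong_refl[OF HomI, of f] by (auto simp: qc_eq rep_def)

lemma rep_cong_Hom: "f \<in> Hom C X Y \<Longrightarrow> cong (rep (qc f)) f"
  by (rule rep_cong[OF Hom_Mor])

lemma rep_Hom: "f \<in> Hom C X Y \<Longrightarrow> rep (qc f) \<in> Hom C X Y"
  using rep_cong_Hom cong_Hom by blast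

lemma quot_Hom: "Hom Q X Y = qc ` Hom C X Y"
proof
  show "qc ` Hom C X Y \<subseteq> Hom Q X Y"
    using rep_Hom by (auto simp: Hom_def quot_cat_def)
  show "Hom Q X Y \<subseteq> qc ` Hom C X Y"
  proof
    fix F assume "F \<in> Hom Q X Y"
    then obtain f where f: "F = qc f" "f \<in> Mor C" "Dom C (rep F) = X" "Cod C (rep F) = Y"
      by (auto simp: Hom_def quot_cat_def)
    then have "f \<in> Hom C X Y"
      using rep_Hom[OF HomI[OF f(2)]] by (simp add: Hom_def)
    then show "F \<in> qc ` Hom C X Y" using f by simp
  qed
qed

lemma quot_simps:
  "UnitO Q = UnitO C" "TensO Q = TensO C" "Ident Q X = qc (Ident C X)" "ZeroM Q X Y = qc (ZeroM C X Y)"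
  by (simp_all add: quot_cat_def)

lemma quot_comp: "g \<in> Hom C Y Z \<Longrightarrow> f \<in> Hom C X Y \<Longrightarrow> qc g \<cdot>\<^bsub>Q\<^esub> qc f = qc (g \<cdot> f)"
  unfolding quot_cat_def by (simp add: qc_eqI cong_comp rep_cong_Hom)

lemma quot_tens: "g \<in> Hom C X Y \<Longrightarrow> f \<in> Hom C X' Y' \<Longrightarrow> qc g \<boxtimes>\<^bsub>Q\<^esub> qc f = qc (g \<boxtimes> f)"
  unfolding quot_cat_def by (simp add: qc_eqI cong_tens rep_cong_Hom)

lemma quot_add: "g \<in> Hom C X Y \<Longrightarrow> f \<in> Hom C X Y \<Longrightarrow> AddM Q (qc g) (qc f) = qc (AddM C g f)"
  unfolding quot_cat_def by (simp add: qc_eqI cong_add rep_cong_Hom)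

lemma quot_scale: "c \<in> carrier K \<Longrightarrow> f \<in> Hom C X Y \<Longrightarrow> ScaleM Q c (qc f) = qc (ScaleM C c f)"
  unfolding quot_cat_def by (simp add: qc_eqI cong_scale rep_cong_Hom)

lemma quot_rel_zero:
  assumes "f \<in> Hom C X Y" "g \<in> Hom C X Y" "DiffM K C f g \<in> Rel"
  shows "qc f = qc g"
  using assms by (intro qc_eqI) (simp add: cong_iff gen_tensor_ideal.rel)

text \<open>
  The rules below build, along the structure of an expression in \<open>Q\<close>, an expression in \<open>C\<close> that
  represents it. An axiom for \<open>Q\<close> thus reduces to the same axiom for \<open>C\<close> by \<open>represents_eqI\<close>.
\<close>

definition represents :: "'m set \<Rightarrow> 'm \<Rightarrow> 'o \<Rightarrow> 'o \<Rightarrow> bool" where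
  "represents F f X Y \<longleftrightarrow> f \<in> Hom C X Y \<and> F = qc f"

lemma represents_Hom: "represents F f X Y \<Longrightarrow> f \<in> Hom C X Y"
  by (simp add: represents_def)

lemma represents_memI: "represents F f X Y \<Longrightarrow> F \<in> Hom Q X Y"
  by (auto simp: represents_def quot_Hom)

lemma represents_memE: "F \<in> Hom Q X Y \<Longrightarrow> (\<And>f. represents F f X Y \<Longrightarrow> thesis) \<Longrightarrow> thesis"
  by (auto simp: represents_def quot_Hom)

lemma represents_eqI: "represents F f X Y \<Longrightarrow> represents G g X' Y' \<Longrightarrow> f = g \<Longrightarrow> F = G"
  by (simp add: represents_def)

lemma represents_Ident: "represents (Ident Q X) (Ident C X) X X"
  and represents_zero: "represents (ZeroM Q X Y) (ZeroM C X Y) X Y"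
  by (simp_all add: represents_def quot_simps Ident_Hom zero_Hom)

lemma represents_comp: "represents G g Y Z \<Longrightarrow> represents F f X Y \<Longrightarrow> represents (G \<cdot>\<^bsub>Q\<^esub> F) (g \<cdot> f) X Z"
  unfolding represents_def by (elim conjE, hypsubst) (intro conjI comp_Hom quot_comp)

lemma represents_tens: "represents G g X Y \<Longrightarrow> represents F f X' Y' \<Longrightarrow>
    represents (G \<boxtimes>\<^bsub>Q\<^esub> F) (g \<boxtimes> f) (TensO C X X') (TensO C Y Y')"
  unfolding represents_def by (elim conjE, hypsubst) (intro conjI tens_Hom quot_tens)

lemma represents_add: "represents G g X Y \<Longrightarrow> represents F f X Y \<Longrightarrow> represents (AddM Q G F) (AddM C g f) X Y"
  unfolding represents_def by (elim conjE, hypsubst) (intro conjI add_Hom quot_add)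

lemma represents_scale: "c \<in> carrier K \<Longrightarrow> represents F f X Y \<Longrightarrow> represents (ScaleM Q c F) (ScaleM C c f) X Y"
  unfolding represents_def by (elim conjE, hypsubst) (intro conjI scale_Hom quot_scale)

theorem quot_lin_mon_category: "lin_mon_category K Q"
proof -
  interpret K: cring K by (rule ground_cring)
  note reps = represents_Ident represents_zero represents_comp represents_tens represents_add
    represents_scale minus_one_closed K.a_closed K.m_closed K.one_closed
  show ?thesis
    apply (rule lin_mon_category.intro[OF ground_cring]; (unfold quot_simps(1,2))?)
    apply (rule tensO_assoc unitO_left unitO_right)+
    apply (((elim represents_memE)?, rule represents_memI, (rule reps | assumption)+)[1])+
    apply (((elim represents_memE)?, rule represents_eqI, (rule reps | assumption)+,
        rule comp_assoc id_left id_right add_assoc add_comm add_zero add_inverse scale_add add_scale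
          scale_scale scale_one comp_add_left comp_add_right comp_scale_left comp_scale_right tens_id
          interchange tens_add_left tens_add_right tens_scale_left tens_scale_right tens_assoc
          tens_unit_left tens_unit_right,
        ((erule represents_Hom | assumption)+)?)[1])+
    done
qed

end

section \<open>Free strict linear monoidal categories\<close>

locale free_lin_mon_category =
  fixes K :: "('k, 'e) ring_scheme" and S :: "('o, 'g) signature"
  assumes ground_cring: "cring K"
begin

abbreviation F where "F \<equiv> free_cat K S"
abbreviation tc where "tc \<equiv> tclass K S"

lemma minus_one_closed: "\<ominus>\<^bsub>K\<^esub> \<one>\<^bsub>K\<^esub> \<in> carrier K"
proof -
  interpret cring K by (rule ground_cring)
  show ?thesis by simp
qed

lemma teq_wf:
  "teq K S f g \<Longrightarrow> twf K S f \<and> twf K S g \<and> tdom S f = tdom S g \<and> tcod S f = tcod S g"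
proof (induction rule: teq.induct)
  case (cong_comp g g' f f')
  then show ?case by (simp (no_asm_use)) (elim conjE, simp)
next
  case (cong_add f f' g g')
  then show ?case by (simp (no_asm_use)) (elim conjE, simp)
next
  case (add_scale c c' f)
  interpret cring K by (rule ground_cring)
  show ?case using add_scale by simp
next
  case (scale_scale c c' f)
  interpret cring K by (rule ground_cring)
  show ?case using scale_scale by simp
next
  case (scale_one f)
  interpret cring K by (rule ground_cring)
  show ?case using scale_one by simp
qed (auto simp: minus_one_closed)

lemma tclass_eqI: "teq K S f g \<Longrightarrow> tc f = tc g"
  unfolding tclass_def using teq.trans teq.sym by blast

lemma tclass_eqD: "tc f = tc g \<Longrightarrow> twf K S g \<Longrightarrow> teq K S f g"
  unfolding tclass_def using teq.refl by blast

lemma rep_teq: "twf K S f \<Longrightarrow> teq K S (rep (tc f)) f"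
  unfolding rep_def tclass_def mem_Collect_eq by (rule teq.sym) (rule someI, rule teq.refl)

text \<open>
  As for quotients: rules following the structure of an expression produce a representing term, after
  which each axiom of strict linear monoidal categories is an introduction rule of \<open>teq\<close>.
\<close>

definition represents :: "('o, 'g, 'k) mterm set \<Rightarrow> ('o, 'g, 'k) mterm \<Rightarrow> bool" where
  "represents M f \<longleftrightarrow> twf K S f \<and> M = tc f"

lemma represents_rep: "represents M f \<Longrightarrow> teq K S (rep M) f"
  by (simp add: represents_def rep_teq)

lemma represents_memI: "represents M f \<Longrightarrow> tdom S f = X \<Longrightarrow> tcod S f = Y \<Longrightarrow> M \<in> Hom F X Y"
  using represents_rep[of M f] teq_wf[of "rep M" f]
  by (auto simp: represents_def Hom_def free_cat_def)

lemma represents_memE: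
  assumes "M \<in> Hom F X Y"
  obtains f where "twf K S f" "represents M f" "X = tdom S f" "Y = tcod S f"
proof -
  obtain f where f: "twf K S f" "M = tc f" "tdom S (rep M) = X" "tcod S (rep M) = Y"
    using assms by (auto simp: Hom_def free_cat_def)
  then show ?thesis using that[of f] teq_wf[OF rep_teq[OF f(1)]] by (simp add: represents_def)
qed

lemma represents_eqI: "represents M f \<Longrightarrow> represents N g \<Longrightarrow> teq K S f g \<Longrightarrow> M = N"
  by (simp add: represents_def tclass_eqI)

lemma represents_tclass: "twf K S f \<Longrightarrow> represents (tc f) f"
  by (simp add: represents_def)

lemma represents_Ident: "represents (Ident F X) (TId X)"
  and represents_zero: "represents (ZeroM F X Y) (TZero X Y)"
  by (simp_all add: represents_def free_cat_def)

lemma represents_comp: "represents N g \<Longrightarrow> represents M f \<Longrightarrow> tdom S g = tcod S f \<Longrightarrow>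
    represents (N \<cdot>\<^bsub>F\<^esub> M) (TComp g f)"
  using represents_rep[of N g] represents_rep[of M f] teq_wf[of "rep N" g] teq_wf[of "rep M" f]
  by (simp add: represents_def free_cat_def tclass_eqI teq.cong_comp)

lemma represents_tens: "represents N g \<Longrightarrow> represents M f \<Longrightarrow> represents (N \<boxtimes>\<^bsub>F\<^esub> M) (TTens g f)"
  using represents_rep[of N g] represents_rep[of M f] teq_wf[of "rep N" g] teq_wf[of "rep M" f]
  by (simp add: represents_def free_cat_def tclass_eqI teq.cong_tens)

lemma represents_add: "represents N g \<Longrightarrow> represents M f \<Longrightarrow> tdom S g = tdom S f \<Longrightarrow>
    tcod S g = tcod S f \<Longrightarrow> represents (AddM F N M) (TAdd g f)"
  using represents_rep[of N g] represents_rep[of M f] teq_wf[of "rep N" g] teq_wf[of "rep M" f]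
  by (simp add: represents_def free_cat_def tclass_eqI teq.cong_add)

lemma represents_scale: "c \<in> carrier K \<Longrightarrow> represents M f \<Longrightarrow> represents (ScaleM F c M) (TScale c f)"
  using represents_rep[of M f] teq_wf[of "rep M" f]
  by (simp add: represents_def free_cat_def tclass_eqI teq.cong_scale)

lemma free_simps: "UnitO F = []" "TensO F X Y = X @ Y"
  by (simp_all add: free_cat_def)

theorem free_lin_mon_category: "lin_mon_category K F"
proof -
  interpret K: cring K by (rule ground_cring)
  note reps = represents_Ident represents_zero represents_comp represents_tens represents_add
    represents_scale minus_one_closed K.a_closed K.m_closed K.one_closed
  show ?thesis
    apply (rule lin_mon_category.intro[OF ground_cring]; (unfold free_simps)?)
    apply ((rule append_assoc append.left_neutral append.right_neutral)[1])+
    apply (((elim represents_memE)?, rule represents_memI, (rule reps | assumption | (simp; fail))+)[1])+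
    apply (((elim represents_memE)?, rule represents_eqI, (rule reps | assumption | (simp; fail))+,
        hypsubst?, rule teq.comp_assoc teq.comp_id_left teq.comp_id_right teq.add_assoc teq.add_comm
          teq.add_zero teq.add_inverse teq.scale_add teq.add_scale teq.scale_scale teq.scale_one
          teq.comp_add_left teq.comp_add_right teq.comp_scale_left teq.comp_scale_right teq.tens_id
          teq.interchange teq.tens_add_left teq.tens_add_right teq.tens_scale_left
          teq.tens_scale_right teq.tens_assoc teq.tens_unit_left teq.tens_unit_right,
        ((simp; fail)+)?)[1])+
    done
qed

end

section \<open>Presentations of affine wreath product algebras\<close>

lemma assoc_algebra_module: "assoc_algebra K M \<Longrightarrow> module K M"
  and assoc_algebra_ring: "assoc_algebra K M \<Longrightarrow> ring M"
  by (rule assoc_algebra.axioms(1), assumption) (rule assoc_algebra.axioms(2))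

lemma algebra_hom_props:
  assumes M: "assoc_algebra K M" and N: "assoc_algebra K N" and h: "algebra_hom K M N h"
  shows "x \<in> carrier M \<Longrightarrow> h x \<in> carrier N"
    and "x \<in> carrier M \<Longrightarrow> y \<in> carrier M \<Longrightarrow> h (x \<otimes>\<^bsub>M\<^esub> y) = h x \<otimes>\<^bsub>N\<^esub> h y"
    and "x \<in> carrier M \<Longrightarrow> y \<in> carrier M \<Longrightarrow> h (x \<oplus>\<^bsub>M\<^esub> y) = h x \<oplus>\<^bsub>N\<^esub> h y"
    and "x \<in> carrier M \<Longrightarrow> y \<in> carrier M \<Longrightarrow> h (x \<ominus>\<^bsub>M\<^esub> y) = h x \<ominus>\<^bsub>N\<^esub> h y"
    and "h \<one>\<^bsub>M\<^esub> = \<one>\<^bsub>N\<^esub>"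
    and "h \<zero>\<^bsub>M\<^esub> = \<zero>\<^bsub>N\<^esub>"
    and "c \<in> carrier K \<Longrightarrow> x \<in> carrier M \<Longrightarrow> h (c \<odot>\<^bsub>M\<^esub> x) = c \<odot>\<^bsub>N\<^esub> h x"
    and "finite S \<Longrightarrow> f \<in> S \<rightarrow> carrier M \<Longrightarrow> h (\<Oplus>\<^bsub>M\<^esub>i\<in>S. f i) = (\<Oplus>\<^bsub>N\<^esub>i\<in>S. h (f i))"
proof -
  interpret h: ring_hom_ring M N h
    using h by (intro ring_hom_ringI2 assoc_algebra_ring[OF M] assoc_algebra_ring[OF N])
      (simp add: algebra_hom_def)
  show "x \<in> carrier M \<Longrightarrow> h x \<in> carrier N"
    "x \<in> carrier M \<Longrightarrow> y \<in> carrier M \<Longrightarrow> h (x \<otimes>\<^bsub>M\<^esub> y) = h x \<otimes>\<^bsub>N\<^esub> h y"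
    "x \<in> carrier M \<Longrightarrow> y \<in> carrier M \<Longrightarrow> h (x \<oplus>\<^bsub>M\<^esub> y) = h x \<oplus>\<^bsub>N\<^esub> h y"
    "x \<in> carrier M \<Longrightarrow> y \<in> carrier M \<Longrightarrow> h (x \<ominus>\<^bsub>M\<^esub> y) = h x \<ominus>\<^bsub>N\<^esub> h y"
    "h \<one>\<^bsub>M\<^esub> = \<one>\<^bsub>N\<^esub>" "h \<zero>\<^bsub>M\<^esub> = \<zero>\<^bsub>N\<^esub>"
    by (simp_all add: a_minus_def)
  show "c \<in> carrier K \<Longrightarrow> x \<in> carrier M \<Longrightarrow> h (c \<odot>\<^bsub>M\<^esub> x) = c \<odot>\<^bsub>N\<^esub> h x"
    using h by (simp add: algebra_hom_def)
  show "h (\<Oplus>\<^bsub>M\<^esub>i\<in>S. f i) = (\<Oplus>\<^bsub>N\<^esub>i\<in>S. h (f i))" if "finite S" "f \<in> S \<rightarrow> carrier M"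
    using that by (induction rule: finite_induct) (auto simp: Pi_iff)
qed

text \<open>
  The relations of the affine wreath product algebra, for elements \<open>t\<close>, \<open>u\<close>, \<open>s\<close> of any algebra \<open>E\<close> and
  with \<open>r\<close> in place of equality. The relation \<open>r\<close> is equality when \<open>E\<close> is an endomorphism algebra, and
  ``the difference is a defining relation'' when \<open>E\<close> is the free algebra.
\<close>

definition awp_sat :: "('k, 'e) ring_scheme \<Rightarrow> ('k, 'a, 'f) module_scheme \<Rightarrow> 'a set \<Rightarrow> ('a \<Rightarrow> 'a)
    \<Rightarrow> ('k, 'm, 'g) module_scheme \<Rightarrow> ('m \<Rightarrow> 'm \<Rightarrow> bool) \<Rightarrow> nat
    \<Rightarrow> (nat \<Rightarrow> 'm) \<Rightarrow> (nat \<Rightarrow> 'a \<Rightarrow> 'm) \<Rightarrow> (nat \<Rightarrow> 'm) \<Rightarrow> bool" where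
  "awp_sat K A B dual E r d t u s \<longleftrightarrow>
     (\<forall>i\<in>{1..<d}. \<forall>j\<in>{1..<d}. \<bar>int i - int j\<bar> > 1 \<longrightarrow> r (s i \<otimes>\<^bsub>E\<^esub> s j) (s j \<otimes>\<^bsub>E\<^esub> s i)) \<and>
     (\<forall>i\<in>{1..<d}. r (s i \<otimes>\<^bsub>E\<^esub> s i) \<one>\<^bsub>E\<^esub>) \<and>
     (\<forall>i. 1 \<le> i \<longrightarrow> i + 2 \<le> d \<longrightarrow>
       r (s (i + 1) \<otimes>\<^bsub>E\<^esub> s i \<otimes>\<^bsub>E\<^esub> s (i + 1)) (s i \<otimes>\<^bsub>E\<^esub> s (i + 1) \<otimes>\<^bsub>E\<^esub> s i)) \<and>
     (\<forall>i\<in>{1..d}. \<forall>j\<in>{1..d}. r (t i \<otimes>\<^bsub>E\<^esub> t j) (t j \<otimes>\<^bsub>E\<^esub> t i)) \<and>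
     (\<forall>i\<in>{1..d}. \<forall>j\<in>{1..<d}. i \<noteq> j \<longrightarrow> i \<noteq> j + 1 \<longrightarrow> r (t i \<otimes>\<^bsub>E\<^esub> s j) (s j \<otimes>\<^bsub>E\<^esub> t i)) \<and>
     (\<forall>j\<in>{1..d}. \<forall>c\<in>carrier K. \<forall>c'\<in>carrier K. \<forall>a\<in>carrier A. \<forall>b\<in>carrier A.
       r (u j (c \<odot>\<^bsub>A\<^esub> a \<oplus>\<^bsub>A\<^esub> c' \<odot>\<^bsub>A\<^esub> b)) (c \<odot>\<^bsub>E\<^esub> u j a \<oplus>\<^bsub>E\<^esub> c' \<odot>\<^bsub>E\<^esub> u j b)) \<and>
     (\<forall>j\<in>{1..d}. \<forall>a\<in>carrier A. \<forall>b\<in>carrier A. r (u j a \<otimes>\<^bsub>E\<^esub> u j b) (u j (a \<otimes>\<^bsub>A\<^esub> b))) \<and>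
     (\<forall>j\<in>{1..d}. r (u j \<one>\<^bsub>A\<^esub>) \<one>\<^bsub>E\<^esub>) \<and>
     (\<forall>i\<in>{1..d}. \<forall>j\<in>{1..d}. i \<noteq> j \<longrightarrow> (\<forall>a\<in>carrier A. \<forall>b\<in>carrier A.
       r (u i a \<otimes>\<^bsub>E\<^esub> u j b) (u j b \<otimes>\<^bsub>E\<^esub> u i a))) \<and>
     (\<forall>i\<in>{1..<d}. \<forall>j\<in>{1..d}. \<forall>a\<in>carrier A.
       r (s i \<otimes>\<^bsub>E\<^esub> u j a) (u (transpose i (i + 1) j) a \<otimes>\<^bsub>E\<^esub> s i)) \<and>
     (\<forall>i\<in>{1..d}. \<forall>j\<in>{1..d}. \<forall>a\<in>carrier A. r (t i \<otimes>\<^bsub>E\<^esub> u j a) (u j a \<otimes>\<^bsub>E\<^esub> t i)) \<and>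
     (\<forall>i\<in>{1..<d}. r (t (i + 1) \<otimes>\<^bsub>E\<^esub> s i \<ominus>\<^bsub>E\<^esub> s i \<otimes>\<^bsub>E\<^esub> t i)
       (\<Oplus>\<^bsub>E\<^esub>b\<in>B. u (i + 1) b \<otimes>\<^bsub>E\<^esub> u i (dual b)))"

lemmas awp_satD =
  awp_sat_def[THEN iffD1, THEN conjunct1, rule_format]
  awp_sat_def[THEN iffD1, THEN conjunct2, THEN conjunct1, rule_format]
  awp_sat_def[THEN iffD1, THEN conjunct2, THEN conjunct2, THEN conjunct1, rule_format]
  awp_sat_def[THEN iffD1, THEN conjunct2, THEN conjunct2, THEN conjunct2, THEN conjunct1, rule_format]
  awp_sat_def[THEN iffD1, THEN conjunct2, THEN conjunct2, THEN conjunct2, THEN conjunct2, THEN conjunct1, rule_format]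
  awp_sat_def[THEN iffD1, THEN conjunct2, THEN conjunct2, THEN conjunct2, THEN conjunct2, THEN conjunct2, THEN conjunct1, rule_format]
  awp_sat_def[THEN iffD1, THEN conjunct2, THEN conjunct2, THEN conjunct2, THEN conjunct2, THEN conjunct2, THEN conjunct2, THEN conjunct1, rule_format]
  awp_sat_def[THEN iffD1, THEN conjunct2, THEN conjunct2, THEN conjunct2, THEN conjunct2, THEN conjunct2, THEN conjunct2, THEN conjunct2, THEN conjunct1, rule_format]
  awp_sat_def[THEN iffD1, THEN conjunct2, THEN conjunct2, THEN conjunct2, THEN conjunct2, THEN conjunct2, THEN conjunct2, THEN conjunct2, THEN conjunct2, THEN conjunct1, rule_format]
  awp_sat_def[THEN iffD1, THEN conjunct2, THEN conjunct2, THEN conjunct2, THEN conjunct2, THEN conjunct2, THEN conjunct2, THEN conjunct2, THEN conjunct2, THEN conjunct2, THEN conjunct1, rule_format]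
  awp_sat_def[THEN iffD1, THEN conjunct2, THEN conjunct2, THEN conjunct2, THEN conjunct2, THEN conjunct2, THEN conjunct2, THEN conjunct2, THEN conjunct2, THEN conjunct2, THEN conjunct2, THEN conjunct1, rule_format]
  awp_sat_def[THEN iffD1, THEN conjunct2, THEN conjunct2, THEN conjunct2, THEN conjunct2, THEN conjunct2, THEN conjunct2, THEN conjunct2, THEN conjunct2, THEN conjunct2, THEN conjunct2, THEN conjunct2, rule_format]

lemma transpose_in_range: "i \<in> {1..<d} \<Longrightarrow> j \<in> {1..d} \<Longrightarrow> transpose i (i + 1) j \<in> {1..(d::nat)}"
  by (auto simp: transpose_def)

text \<open>
  Every relation involves strand numbers only through their differences and their range.
\<close>

lemma awp_sat_shift:
  assumes "awp_sat K A B dual E r d t u s" "m + n \<le> d"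
  shows "awp_sat K A B dual E r m (\<lambda>i. t (i + n)) (\<lambda>i. u (i + n)) (\<lambda>i. s (i + n))"
proof -
  have r1: "i + n \<in> {1..<d}" if "i \<in> {1..<m}" for i using that assms(2) by auto
  have r2: "i + n \<in> {1..d}" if "i \<in> {1..m}" for i using that assms(2) by auto
  have tr: "transpose i (i + 1) j + n = transpose (i + n) (i + n + 1) (j + n)" for i j
    by (auto simp: transpose_def)
  have ac: "i + 1 + n = i + n + 1" for i by simp
  note satD = awp_satD[OF assms(1)]
  have far: "\<bar>int (i + n) - int (j + n)\<bar> > 1" if "\<bar>int i - int j\<bar> > 1" for i j
    using that by simp
  have ne: "i + n \<noteq> j + n" if "i \<noteq> j" for i j using that by simp
  have ne': "i + n \<noteq> j + n + 1" if "i \<noteq> j + 1" for i j using that by simp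
  have r3: "1 \<le> i + n" "i + n + 2 \<le> d" if "1 \<le> i" "i + 2 \<le> m" for i
    using that assms(2) by auto
  show ?thesis
    unfolding awp_sat_def tr ac
    by (intro conjI ballI allI impI)
      (rule satD, (assumption | rule far ne ne' r1 r2 r3)+)+
qed

locale dual_bases_algebra =
  fixes K :: "('k, 'e) ring_scheme" and A :: "('k, 'a, 'f) module_scheme"
    and B :: "'a set" and dual :: "'a \<Rightarrow> 'a"
  assumes K: "cring K" and A: "assoc_algebra K A"
    and B: "finite B" "B \<subseteq> carrier A" "dual \<in> B \<rightarrow> carrier A"
begin

abbreviation P where "P d \<equiv> free_algebra K (awp_gens A d)"
abbreviation R where "R d \<equiv> awp_relations K A B dual d"
abbreviation t where "t i \<equiv> free_var K (Var_t i)"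
abbreviation u where "u i a \<equiv> free_var K (Var_u i a)"
abbreviation s where "s i \<equiv> free_var K (Var_s i)"

lemma P_algebra: "assoc_algebra K (P d)"
  by (rule cring.free_algebra_assoc_algebra[OF K])

lemma P_ring: "ring (P d)"
  by (rule assoc_algebra_ring[OF P_algebra])

lemma P_closed:
  "p \<in> carrier (P d) \<Longrightarrow> q \<in> carrier (P d) \<Longrightarrow> p \<otimes>\<^bsub>P d\<^esub> q \<in> carrier (P d)"
  "p \<in> carrier (P d) \<Longrightarrow> q \<in> carrier (P d) \<Longrightarrow> p \<oplus>\<^bsub>P d\<^esub> q \<in> carrier (P d)"
  "p \<in> carrier (P d) \<Longrightarrow> q \<in> carrier (P d) \<Longrightarrow> p \<ominus>\<^bsub>P d\<^esub> q \<in> carrier (P d)"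
  "\<one>\<^bsub>P d\<^esub> \<in> carrier (P d)" "\<zero>\<^bsub>P d\<^esub> \<in> carrier (P d)"
  "c \<in> carrier K \<Longrightarrow> p \<in> carrier (P d) \<Longrightarrow> c \<odot>\<^bsub>P d\<^esub> p \<in> carrier (P d)"
proof -
  show "p \<in> carrier (P d) \<Longrightarrow> q \<in> carrier (P d) \<Longrightarrow> p \<otimes>\<^bsub>P d\<^esub> q \<in> carrier (P d)"
    by (rule ring.ring_simprules(5)[OF P_ring])
  show "p \<in> carrier (P d) \<Longrightarrow> q \<in> carrier (P d) \<Longrightarrow> p \<oplus>\<^bsub>P d\<^esub> q \<in> carrier (P d)"
    by (rule ring.ring_simprules(1)[OF P_ring])
  show "p \<in> carrier (P d) \<Longrightarrow> q \<in> carrier (P d) \<Longrightarrow> p \<ominus>\<^bsub>P d\<^esub> q \<in> carrier (P d)"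
    by (rule ring.ring_simprules(4)[OF P_ring])
  show "\<one>\<^bsub>P d\<^esub> \<in> carrier (P d)" "\<zero>\<^bsub>P d\<^esub> \<in> carrier (P d)"
    by (rule ring.ring_simprules(6)[OF P_ring] ring.ring_simprules(2)[OF P_ring])+
  show "c \<in> carrier K \<Longrightarrow> p \<in> carrier (P d) \<Longrightarrow> c \<odot>\<^bsub>P d\<^esub> p \<in> carrier (P d)"
    by (rule module.smult_closed[OF assoc_algebra_module[OF P_algebra]])
qed

lemma gen_closed:
  "i \<in> {1..d} \<Longrightarrow> t i \<in> carrier (P d)"
  "i \<in> {1..d} \<Longrightarrow> a \<in> carrier A \<Longrightarrow> u i a \<in> carrier (P d)"
  "i \<in> {1..<d} \<Longrightarrow> s i \<in> carrier (P d)"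
  by (rule cring.free_var_closed[OF K], simp add: awp_gens_def)+

lemma A_closed:
  "c \<in> carrier K \<Longrightarrow> c' \<in> carrier K \<Longrightarrow> a \<in> carrier A \<Longrightarrow> b \<in> carrier A \<Longrightarrow>
    c \<odot>\<^bsub>A\<^esub> a \<oplus>\<^bsub>A\<^esub> c' \<odot>\<^bsub>A\<^esub> b \<in> carrier A"
  "a \<in> carrier A \<Longrightarrow> b \<in> carrier A \<Longrightarrow> a \<otimes>\<^bsub>A\<^esub> b \<in> carrier A" "\<one>\<^bsub>A\<^esub> \<in> carrier A"
proof -
  show "c \<in> carrier K \<Longrightarrow> c' \<in> carrier K \<Longrightarrow> a \<in> carrier A \<Longrightarrow> b \<in> carrier A \<Longrightarrow>
    c \<odot>\<^bsub>A\<^esub> a \<oplus>\<^bsub>A\<^esub> c' \<odot>\<^bsub>A\<^esub> b \<in> carrier A"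
    by (intro ring.ring_simprules(1)[OF assoc_algebra_ring[OF A]]
        module.smult_closed[OF assoc_algebra_module[OF A]])
  show "a \<in> carrier A \<Longrightarrow> b \<in> carrier A \<Longrightarrow> a \<otimes>\<^bsub>A\<^esub> b \<in> carrier A" "\<one>\<^bsub>A\<^esub> \<in> carrier A"
    by (rule ring.ring_simprules[OF assoc_algebra_ring[OF A]], assumption+)
      (rule ring.ring_simprules[OF assoc_algebra_ring[OF A]])
qed

lemma relations_sat: "awp_sat K A B dual (P d) (\<lambda>p q. p \<ominus>\<^bsub>P d\<^esub> q \<in> R d) d t u s"
  unfolding awp_sat_def awp_relations_def Let_def
  by (intro conjI ballI allI impI)
    ((rule UnI2, intro CollectI exI conjI, rule HOL.refl, assumption+)[1] | rule UnI1 |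
      (intro CollectI exI conjI, rule HOL.refl, assumption+)[1])+

text \<open>
  A homomorphism takes defining relations into \<open>J\<close> as soon as the images of the generators satisfy them
  up to \<open>J\<close>. This serves for evaluation in an endomorphism algebra, where \<open>J\<close> is zero, and for the
  homomorphisms \<open>P m \<rightarrow> P d\<close> that renumber or add strands, where \<open>J\<close> is an ideal of relations.
\<close>

lemma relations_map:
  assumes E: "assoc_algebra K E" and h: "algebra_hom K (P d) E h"
    and T: "\<And>i. i \<in> {1..d} \<Longrightarrow> h (t i) = T i"
    and U: "\<And>i a. i \<in> {1..d} \<Longrightarrow> a \<in> carrier A \<Longrightarrow> h (u i a) = U i a"
    and S: "\<And>i. i \<in> {1..<d} \<Longrightarrow> h (s i) = S i"
    and sat: "awp_sat K A B dual E r d T U S"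
    and J: "\<And>x y. x \<in> carrier E \<Longrightarrow> y \<in> carrier E \<Longrightarrow> r x y \<Longrightarrow> x \<ominus>\<^bsub>E\<^esub> y \<in> J"
    and p: "p \<in> R d"
  shows "p \<in> carrier (P d) \<and> h p \<in> J"
proof -
  note hp = algebra_hom_props[OF P_algebra E h]
  define maps where "maps p e \<longleftrightarrow> p \<in> carrier (P d) \<and> h p = e" for p e
  have gens: "i \<in> {1..d} \<Longrightarrow> maps (t i) (T i)" "i \<in> {1..d} \<Longrightarrow> a \<in> carrier A \<Longrightarrow> maps (u i a) (U i a)"
    "i \<in> {1..<d} \<Longrightarrow> maps (s i) (S i)" for i a
    unfolding maps_def by (intro conjI gen_closed T U S; assumption)+
  have ops: "maps p e \<Longrightarrow> maps q f \<Longrightarrow> maps (p \<otimes>\<^bsub>P d\<^esub> q) (e \<otimes>\<^bsub>E\<^esub> f)"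
    "maps p e \<Longrightarrow> maps q f \<Longrightarrow> maps (p \<oplus>\<^bsub>P d\<^esub> q) (e \<oplus>\<^bsub>E\<^esub> f)"
    "maps p e \<Longrightarrow> maps q f \<Longrightarrow> maps (p \<ominus>\<^bsub>P d\<^esub> q) (e \<ominus>\<^bsub>E\<^esub> f)"
    "c \<in> carrier K \<Longrightarrow> maps p e \<Longrightarrow> maps (c \<odot>\<^bsub>P d\<^esub> p) (c \<odot>\<^bsub>E\<^esub> e)"
    "maps \<one>\<^bsub>P d\<^esub> \<one>\<^bsub>E\<^esub>" for p q e f c
    unfolding maps_def using hp P_closed by auto
  interpret PE: ring E by (rule assoc_algebra_ring[OF E])
  interpret PP: ring "P d" by (rule P_ring)
  have sum: "maps (\<Oplus>\<^bsub>P d\<^esub>b\<in>B. f b) (\<Oplus>\<^bsub>E\<^esub>b\<in>B. e b)"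
    if "\<And>b. b \<in> B \<Longrightarrow> maps (f b) (e b)" for f e
  proof -
    have f: "f \<in> B \<rightarrow> carrier (P d)" and e: "\<And>b. b \<in> B \<Longrightarrow> h (f b) = e b"
      using that by (auto simp: maps_def)
    have "(\<Oplus>\<^bsub>E\<^esub>b\<in>B. h (f b)) = (\<Oplus>\<^bsub>E\<^esub>b\<in>B. e b)"
      using f e hp(1) by (intro PE.finsum_cong' HOL.refl) (auto simp: Pi_iff e[symmetric])
    then show ?thesis
      using hp(8)[OF B(1) f] PP.finsum_closed[OF f] by (simp add: maps_def)
  qed
  have mapI: "p \<ominus>\<^bsub>P d\<^esub> q \<in> carrier (P d) \<and> h (p \<ominus>\<^bsub>P d\<^esub> q) \<in> J"
    if "maps p e" "maps q f" "r e f" for p q e f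
    using that P_closed(3) hp(4) J[of e f] hp(1) by (auto simp: maps_def)
  note Bc = subsetD[OF B(2)] funcset_mem[OF B(3)]
  note rls = gens ops sum A_closed Bc transpose_in_range
  show ?thesis
    using p unfolding awp_relations_def Let_def
    apply (elim UnE CollectE exE conjE; hypsubst)
    apply ((rule mapI, (assumption | rule rls | (simp; fail))+,
        rule awp_satD[OF sat], assumption+)[1])+
    done
qed

definition awp_ideal :: "nat \<Rightarrow> ('a awp_gen list \<Rightarrow> 'k) set" where
  "awp_ideal d = Idl\<^bsub>P d\<^esub> (R d)"

lemma P_hom_id: "m \<le> d \<Longrightarrow> algebra_hom K (P m) (P d) (\<lambda>p. p)"
proof -
  assume "m \<le> d"
  then have "awp_gens A m \<subseteq> awp_gens A d" by (auto simp: awp_gens_def)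
  then have "carrier (P m) \<subseteq> carrier (P d)" by (rule cring.free_algebra_mono[OF K])
  then show ?thesis
    by (auto simp: algebra_hom_def ring_hom_def free_algebra_simps(2-6))
qed

lemma P_carrier_mono: "m \<le> d \<Longrightarrow> p \<in> carrier (P m) \<Longrightarrow> p \<in> carrier (P d)"
  by (rule algebra_hom_props(1)[OF P_algebra P_algebra P_hom_id])

lemma R_carrier: "R d \<subseteq> carrier (P d)"
  using relations_map[OF P_algebra P_hom_id _ _ _ relations_sat] by blast

lemma awp_ideal_ideal: "ideal (awp_ideal d) (P d)"
  unfolding awp_ideal_def by (rule ring.genideal_ideal[OF P_ring R_carrier])

lemma R_awp_ideal: "R d \<subseteq> awp_ideal d"
  unfolding awp_ideal_def by (rule ring.genideal_self[OF P_ring R_carrier])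

lemma awp_ideal_map:
  assumes h: "algebra_hom K (P m) (P d) h"
    and R: "\<And>p. p \<in> R m \<Longrightarrow> h p \<in> awp_ideal d" and p: "p \<in> awp_ideal m"
  shows "h p \<in> awp_ideal d"
proof -
  interpret h: ring_hom_ring "P m" "P d" h
    using h by (intro ring_hom_ringI2 P_ring) (simp add: algebra_hom_def)
  have "ideal {q \<in> carrier (P m). h q \<in> awp_ideal d} (P m)"
    by (rule h.ideal_vimage[OF awp_ideal_ideal])
  then have "awp_ideal m \<subseteq> {q \<in> carrier (P m). h q \<in> awp_ideal d}"
    unfolding awp_ideal_def[of m] using R R_carrier[of m] by (intro ring.genideal_minimal[OF P_ring]) auto
  then show ?thesis using p by auto
qed

section \<open>Juxtaposition of strands\<close>

text \<open>
  Strands are numbered from the right. Adding \<open>n\<close> strands on the right therefore raises all strand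
  numbers by \<open>n\<close>, while adding strands on the left is the inclusion of \<open>P n\<close> into \<open>P (m + n)\<close>.
\<close>

definition shift_gen :: "nat \<Rightarrow> 'a awp_gen \<Rightarrow> 'a awp_gen" where
  "shift_gen n y = (case y of Var_t i \<Rightarrow> Var_t (i + n) | Var_u i a \<Rightarrow> Var_u (i + n) a | Var_s i \<Rightarrow> Var_s (i + n))"

definition shift :: "nat \<Rightarrow> nat \<Rightarrow> ('a awp_gen list \<Rightarrow> 'k) \<Rightarrow> 'a awp_gen list \<Rightarrow> 'k" where
  "shift m n = free_eval K (P (m + n)) (\<lambda>y. free_var K (shift_gen n y))"

lemma shift_gen_in: "y \<in> awp_gens A m \<Longrightarrow> shift_gen n y \<in> awp_gens A (m + n)"
  by (auto simp: awp_gens_def shift_gen_def)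

lemma shift_hom: "algebra_hom K (P m) (P (m + n)) (shift m n)"
  unfolding shift_def
  by (rule assoc_algebra.free_eval_algebra_hom(1)[OF P_algebra])
    (auto intro!: cring.free_var_closed[OF K] shift_gen_in)

lemma shift_var: "y \<in> awp_gens A m \<Longrightarrow> shift m n (free_var K y) = free_var K (shift_gen n y)"
  unfolding shift_def
  by (rule assoc_algebra.free_eval_algebra_hom(2)[OF P_algebra])
    (auto intro!: cring.free_var_closed[OF K] shift_gen_in)

lemmas shift_props = algebra_hom_props[OF P_algebra P_algebra shift_hom]

lemma shift_gens:
  "i \<in> {1..m} \<Longrightarrow> shift m n (t i) = t (i + n)"
  "i \<in> {1..m} \<Longrightarrow> a \<in> carrier A \<Longrightarrow> shift m n (u i a) = u (i + n) a"
  "i \<in> {1..<m} \<Longrightarrow> shift m n (s i) = s (i + n)"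
  by (subst shift_var; simp add: awp_gens_def shift_gen_def)+

lemma algebra_hom_unique:
  assumes M: "assoc_algebra K M" and h: "algebra_hom K (P d) M h" "algebra_hom K (P d) M h'"
    and var: "\<And>y. y \<in> awp_gens A d \<Longrightarrow> h (free_var K y) = h' (free_var K y)"
    and p: "p \<in> carrier (P d)"
  shows "h p = h' p"
proof -
  note hp = algebra_hom_props[OF P_algebra M h(1)] and hp' = algebra_hom_props[OF P_algebra M h(2)]
  note var_closed = cring.free_var_closed[OF K]
  show ?thesis
    using p
  proof (induction p rule: cring.free_algebra_induct[OF K, consumes 1])
    case (3 x f)
    then show ?case by (simp add: hp(2)[OF var_closed] hp'(2)[OF var_closed] var)
  qed (simp_all add: hp(3,5-7) hp'(3,5-7))
qed

lemma algebra_hom_comp: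
  assumes "assoc_algebra K L" "assoc_algebra K M" "assoc_algebra K N"
    and "algebra_hom K L M h" "algebra_hom K M N h'"
  shows "algebra_hom K L N (\<lambda>x. h' (h x))"
  using algebra_hom_props[OF assms(1,2,4)] algebra_hom_props[OF assms(2,3,5)]
  by (auto simp: algebra_hom_def intro!: ring_hom_memI)

lemma shift_shift:
  assumes "p \<in> carrier (P l)"
  shows "shift (l + m) n (shift l m p) = shift l (m + n) p"
proof -
  have sub: "algebra_hom K (P l) (P (l + m + n)) (shift l (m + n))"
    using shift_hom[of l "m + n"] by (simp add: add.assoc)
  have "shift_gen n (shift_gen m y) = shift_gen (m + n) y" for y :: "'a awp_gen"
    by (cases y) (simp_all add: shift_gen_def)
  then show ?thesis
    using algebra_hom_unique[OF P_algebra
        algebra_hom_comp[OF P_algebra P_algebra P_algebra shift_hom[of l m] shift_hom[of "l + m" n]]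
        sub _ assms] by (simp add: shift_var shift_gen_in)
qed

lemma shift_restrict:
  assumes "p \<in> carrier (P l)" "l \<le> m"
  shows "shift m n p = shift l n p"
proof -
  have sub: "algebra_hom K (P l) (P (m + n)) (\<lambda>p. shift m n p)"
    by (rule algebra_hom_comp[OF P_algebra P_algebra P_algebra P_hom_id[OF assms(2)] shift_hom])
  have sub': "algebra_hom K (P l) (P (m + n)) (\<lambda>p. shift l n p)"
    by (rule algebra_hom_comp[OF P_algebra P_algebra P_algebra shift_hom P_hom_id]) (use assms in simp)
  have "awp_gens A l \<subseteq> awp_gens A m" using assms(2) by (auto simp: awp_gens_def)
  then show ?thesis
    using algebra_hom_unique[OF P_algebra sub sub' _ assms(1)] by (simp add: shift_var subset_iff)
qed

lemma shift_0: "p \<in> carrier (P m) \<Longrightarrow> shift m 0 p = p"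
proof -
  assume p: "p \<in> carrier (P m)"
  have h: "algebra_hom K (P m) (P m) (shift m 0)" using shift_hom[of m 0] by simp
  have "shift_gen 0 y = y" for y :: "'a awp_gen" by (cases y) (simp_all add: shift_gen_def)
  then show ?thesis
    using algebra_hom_unique[OF P_algebra h P_hom_id _ p] by (simp add: shift_var)
qed

lemma shift_ideal: "p \<in> awp_ideal m \<Longrightarrow> shift m n p \<in> awp_ideal (m + n)"
proof (rule awp_ideal_map[OF shift_hom])
  fix p assume "p \<in> R m"
  from relations_map[OF P_algebra shift_hom shift_gens awp_sat_shift[OF relations_sat order.refl]
      subsetD[OF R_awp_ideal] this]
  show "shift m n p \<in> awp_ideal (m + n)" by simp
qed

lemma awp_ideal_mono: "m \<le> d \<Longrightarrow> p \<in> awp_ideal m \<Longrightarrow> p \<in> awp_ideal d"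
proof (rule awp_ideal_map[OF P_hom_id])
  fix p assume "m \<le> d" "p \<in> R m"
  from relations_map[OF P_algebra P_hom_id[OF this(1)] _ _ _ awp_sat_shift[OF relations_sat, of m 0 d]
      subsetD[OF R_awp_ideal] this(2)] this(1)
  show "p \<in> awp_ideal d" by simp
qed

text \<open>
  Congruence modulo the relations is expressed as equality of cosets, which makes it available for
  rewriting and calculational reasoning.
\<close>

definition cls :: "nat \<Rightarrow> ('a awp_gen list \<Rightarrow> 'k) \<Rightarrow> ('a awp_gen list \<Rightarrow> 'k) set" where
  "cls d p = awp_ideal d +>\<^bsub>P d\<^esub> p"

lemma cls_eq_iff: "p \<in> carrier (P d) \<Longrightarrow> q \<in> carrier (P d) \<Longrightarrow> cls d p = cls d q \<longleftrightarrow> p \<ominus>\<^bsub>P d\<^esub> q \<in> awp_ideal d"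
  unfolding cls_def using ring.quotient_eq_iff_same_a_r_cos[OF P_ring awp_ideal_ideal] by simp

lemma cls_zero_iff:
  assumes "p \<in> carrier (P d)"
  shows "cls d p = cls d \<zero>\<^bsub>P d\<^esub> \<longleftrightarrow> p \<in> awp_ideal d"
proof -
  interpret ring "P d" by (rule P_ring)
  have "p \<ominus>\<^bsub>P d\<^esub> \<zero>\<^bsub>P d\<^esub> = p" using assms by (simp add: a_minus_def)
  then show ?thesis using cls_eq_iff[OF assms P_closed(5)] by simp
qed

lemma cls_mult:
  assumes "cls d p = cls d p'" "cls d q = cls d q'"
    and "p \<in> carrier (P d)" "p' \<in> carrier (P d)" "q \<in> carrier (P d)" "q' \<in> carrier (P d)"
  shows "cls d (p \<otimes>\<^bsub>P d\<^esub> q) = cls d (p' \<otimes>\<^bsub>P d\<^esub> q')"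
  using assms(1,2) ideal.rcoset_mult_add[OF awp_ideal_ideal assms(3,5)]
    ideal.rcoset_mult_add[OF awp_ideal_ideal assms(4,6)]
  unfolding cls_def by simp

lemma cls_add:
  assumes "cls d p = cls d p'" "cls d q = cls d q'"
    and "p \<in> carrier (P d)" "p' \<in> carrier (P d)" "q \<in> carrier (P d)" "q' \<in> carrier (P d)"
  shows "cls d (p \<oplus>\<^bsub>P d\<^esub> q) = cls d (p' \<oplus>\<^bsub>P d\<^esub> q')"
  using assms(1,2) ideal.a_rcos_sum[OF awp_ideal_ideal assms(3,5)]
    ideal.a_rcos_sum[OF awp_ideal_ideal assms(4,6)]
  unfolding cls_def by simp

text \<open>
  Scalar multiplication by \<open>c\<close> is multiplication by the element \<open>c \<cdot> 1\<close>, so this is a case of \<open>cls_mult\<close>.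
\<close>

lemma cls_scale:
  assumes pq: "cls d p = cls d q" and p: "p \<in> carrier (P d)" and q: "q \<in> carrier (P d)"
    and c: "c \<in> carrier K"
  shows "cls d (c \<odot>\<^bsub>P d\<^esub> p) = cls d (c \<odot>\<^bsub>P d\<^esub> q)"
proof -
  have scale: "(c \<odot>\<^bsub>P d\<^esub> \<one>\<^bsub>P d\<^esub>) \<otimes>\<^bsub>P d\<^esub> r = c \<odot>\<^bsub>P d\<^esub> r" if "r \<in> carrier (P d)" for r
    using assoc_algebra.smult_mult_left[OF P_algebra c P_closed(4) that]
      ring.ring_simprules(12)[OF P_ring that] by simp
  have c1: "c \<odot>\<^bsub>P d\<^esub> \<one>\<^bsub>P d\<^esub> \<in> carrier (P d)" by (rule P_closed(6)[OF c P_closed(4)])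
  show ?thesis
    using cls_mult[OF HOL.refl pq c1 c1 p q] unfolding scale[OF p] scale[OF q] .
qed

lemma cls_map:
  assumes h: "algebra_hom K (P m) (P d) h"
    and I: "\<And>p. p \<in> awp_ideal m \<Longrightarrow> h p \<in> awp_ideal d"
    and pq: "cls m p = cls m q" "p \<in> carrier (P m)" "q \<in> carrier (P m)"
  shows "cls d (h p) = cls d (h q)"
proof -
  note hp = algebra_hom_props[OF P_algebra P_algebra h]
  have "h (p \<ominus>\<^bsub>P m\<^esub> q) \<in> awp_ideal d"
    using pq by (intro I) (simp add: cls_eq_iff)
  then show ?thesis
    using pq(2,3) by (simp add: cls_eq_iff hp(1) hp(4))
qed

lemma cls_shift:
  "cls m p = cls m q \<Longrightarrow> p \<in> carrier (P m) \<Longrightarrow> q \<in> carrier (P m) \<Longrightarrow>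
    cls (m + n) (shift m n p) = cls (m + n) (shift m n q)"
  by (rule cls_map[OF shift_hom shift_ideal])

lemma cls_mono:
  "cls m p = cls m q \<Longrightarrow> m \<le> d \<Longrightarrow> p \<in> carrier (P m) \<Longrightarrow> q \<in> carrier (P m) \<Longrightarrow> cls d p = cls d q"
  by (rule cls_map[OF P_hom_id awp_ideal_mono])

lemma cls_relI:
  "p \<ominus>\<^bsub>P d\<^esub> q \<in> R d \<Longrightarrow> p \<in> carrier (P d) \<Longrightarrow> q \<in> carrier (P d) \<Longrightarrow> cls d p = cls d q"
  using subsetD[OF R_awp_ideal] by (simp add: cls_eq_iff)

text \<open>
  Each of the nine pairs of generators on disjoint sets of strands is covered by one of the defining
  relations, up to exchanging the two sides; for a crossing and a token the transposition fixes the
  strand of the token.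
\<close>

lemma gens_commute:
  assumes x: "x \<in> awp_gens A m" and y: "y \<in> awp_gens A n"
  shows "cls (m + n) (free_var K (shift_gen n x) \<otimes>\<^bsub>P (m + n)\<^esub> free_var K y) =
    cls (m + n) (free_var K y \<otimes>\<^bsub>P (m + n)\<^esub> free_var K (shift_gen n x))"
proof -
  let ?d = "m + n"
  note rel = awp_satD[OF relations_sat[of ?d]]
  have x': "free_var K (shift_gen n x) \<in> carrier (P ?d)"
    using shift_gen_in[OF x] by (rule cring.free_var_closed[OF K])
  have y': "free_var K y \<in> carrier (P ?d)"
    using P_carrier_mono[OF _ cring.free_var_closed[OF K y]] by simp
  have swap: "cls ?d (q \<otimes>\<^bsub>P ?d\<^esub> p) = cls ?d (p \<otimes>\<^bsub>P ?d\<^esub> q)"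
    if "p \<otimes>\<^bsub>P ?d\<^esub> q \<ominus>\<^bsub>P ?d\<^esub> q \<otimes>\<^bsub>P ?d\<^esub> p \<in> R ?d" "p \<in> carrier (P ?d)" "q \<in> carrier (P ?d)" for p q
    by (rule cls_relI[OF that(1) P_closed(1)[OF that(2,3)] P_closed(1)[OF that(3,2)], symmetric])
  have keep: "cls ?d (p \<otimes>\<^bsub>P ?d\<^esub> q) = cls ?d (q \<otimes>\<^bsub>P ?d\<^esub> p)"
    if "p \<otimes>\<^bsub>P ?d\<^esub> q \<ominus>\<^bsub>P ?d\<^esub> q \<otimes>\<^bsub>P ?d\<^esub> p \<in> R ?d" "p \<in> carrier (P ?d)" "q \<in> carrier (P ?d)" for p q
    by (rule swap[OF that, symmetric])
  consider i where "x = Var_t i" "i \<in> {1..m}" | i a where "x = Var_u i a" "i \<in> {1..m}" "a \<in> carrier A"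
    | i where "x = Var_s i" "i \<in> {1..<m}"
    using x by (auto simp: awp_gens_def)
  note xcases = this
  consider i where "y = Var_t i" "i \<in> {1..n}" | i a where "y = Var_u i a" "i \<in> {1..n}" "a \<in> carrier A"
    | i where "y = Var_s i" "i \<in> {1..<n}"
    using y by (auto simp: awp_gens_def)
  note ycases = this
  have fix_swap: "transpose i (i + 1) j = j" if "j \<noteq> i" "j \<noteq> i + 1" for i j :: nat
    using that by (simp add: transpose_def)
  show ?thesis
  proof (cases rule: xcases)
    case X: (1 i)
    show ?thesis
    proof (cases rule: ycases)
      case Y: (1 j)
      show ?thesis
        by (rule keep[OF _ x' y']) (unfold X(1) Y(1) shift_gen_def awp_gen.case, rule rel(4); use X Y in simp)
    next
      case Y: (2 j b)
      show ?thesis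
        by (rule keep[OF _ x' y']) (unfold X(1) Y(1) shift_gen_def awp_gen.case, rule rel(11); use X Y in simp)
    next
      case Y: (3 j)
      show ?thesis
        by (rule keep[OF _ x' y']) (unfold X(1) Y(1) shift_gen_def awp_gen.case, rule rel(5); use X Y in simp)
    qed
  next
    case X: (2 i a)
    show ?thesis
    proof (cases rule: ycases)
      case Y: (1 j)
      show ?thesis
        by (rule swap[OF _ y' x']) (unfold X(1) Y(1) shift_gen_def awp_gen.case, rule rel(11); use X Y in simp)
    next
      case Y: (2 j b)
      show ?thesis
        by (rule keep[OF _ x' y']) (unfold X(1) Y(1) shift_gen_def awp_gen.case, rule rel(9); use X Y in simp)
    next
      case Y: (3 j)
      show ?thesis
        by (rule swap[OF _ y' x'])
          (use X Y rel(10)[of j "i + n" a] fix_swap[of "i + n" j] in \<open>simp add: shift_gen_def\<close>)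
    qed
  next
    case X: (3 i)
    show ?thesis
    proof (cases rule: ycases)
      case Y: (1 j)
      show ?thesis
        by (rule swap[OF _ y' x']) (unfold X(1) Y(1) shift_gen_def awp_gen.case, rule rel(5); use X Y in simp)
    next
      case Y: (2 j b)
      show ?thesis
        by (rule keep[OF _ x' y'])
          (use X Y rel(10)[of "i + n" j b] fix_swap[of j "i + n"] in \<open>simp add: shift_gen_def\<close>)
    next
      case Y: (3 j)
      show ?thesis
        by (rule keep[OF _ x' y']) (unfold X(1) Y(1) shift_gen_def awp_gen.case, rule rel(1); use X Y in simp)
    qed
  qed
qed

definition commute :: "nat \<Rightarrow> ('a awp_gen list \<Rightarrow> 'k) \<Rightarrow> ('a awp_gen list \<Rightarrow> 'k) \<Rightarrow> bool" where
  "commute d p q \<longleftrightarrow> cls d (p \<otimes>\<^bsub>P d\<^esub> q) = cls d (q \<otimes>\<^bsub>P d\<^esub> p)"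

lemma commute_sym: "commute d p q \<Longrightarrow> commute d q p"
  by (simp add: commute_def)

text \<open>
  The elements that commute with \<open>x\<close> modulo the relations are closed under products and linear
  combinations, so it is enough to test generators.
\<close>

lemma commute_generate:
  assumes x: "x \<in> carrier (P d)" and n: "n \<le> d"
    and h: "algebra_hom K (P n) (P d) h"
    and gens: "\<And>y. y \<in> awp_gens A n \<Longrightarrow> commute d x (h (free_var K y))"
    and q: "q \<in> carrier (P n)"
  shows "commute d x (h q)"
proof -
  interpret ring "P d" by (rule P_ring)
  note hp = algebra_hom_props[OF P_algebra P_algebra h]
  show ?thesis
    using q
  proof (induction q rule: cring.free_algebra_induct[OF K, consumes 1])
    case 1
    show ?case using x by (simp add: hp commute_def)
  next
    case 2
    show ?case using x by (simp add: hp commute_def)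
  next
    case (3 y q)
    let ?y = "h (free_var K y)"
    have y: "?y \<in> carrier (P d)" by (rule hp(1)[OF cring.free_var_closed[OF K 3(1)]])
    have q: "h q \<in> carrier (P d)" by (rule hp(1)[OF 3(2)])
    have "cls d (x \<otimes>\<^bsub>P d\<^esub> (?y \<otimes>\<^bsub>P d\<^esub> h q)) = cls d (x \<otimes>\<^bsub>P d\<^esub> ?y \<otimes>\<^bsub>P d\<^esub> h q)"
      using x y q by (simp add: m_assoc)
    also have "\<dots> = cls d (?y \<otimes>\<^bsub>P d\<^esub> x \<otimes>\<^bsub>P d\<^esub> h q)"
      using gens[OF 3(1)] x y q by - (rule cls_mult, simp_all add: commute_def)
    also have "\<dots> = cls d (?y \<otimes>\<^bsub>P d\<^esub> (x \<otimes>\<^bsub>P d\<^esub> h q))"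
      using x y q by (simp add: m_assoc)
    also have "\<dots> = cls d (?y \<otimes>\<^bsub>P d\<^esub> (h q \<otimes>\<^bsub>P d\<^esub> x))"
      using 3(3) x y q by - (rule cls_mult, simp_all add: commute_def)
    also have "\<dots> = cls d (?y \<otimes>\<^bsub>P d\<^esub> h q \<otimes>\<^bsub>P d\<^esub> x)"
      using x y q by (simp add: m_assoc)
    finally show ?case
      by (simp add: commute_def hp(2)[OF cring.free_var_closed[OF K 3(1)] 3(2)])
  next
    case (4 f g)
    have f: "h f \<in> carrier (P d)" and g: "h g \<in> carrier (P d)" by (rule hp(1)[OF 4(1)] hp(1)[OF 4(2)])+
    show ?case
      unfolding commute_def hp(3)[OF 4(1,2)] l_distr[OF f g x] r_distr[OF f g x]
      by (rule cls_add) (use 4(3,4) x f g in \<open>simp_all add: commute_def\<close>)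
  next
    case (5 c f)
    have f: "h f \<in> carrier (P d)" by (rule hp(1)[OF 5(2)])
    show ?case
      unfolding commute_def hp(7)[OF 5(1,2)] assoc_algebra.smult_mult_left[OF P_algebra 5(1) f x]
        assoc_algebra.smult_mult_right[OF P_algebra 5(1) x f]
      by (rule cls_scale) (use 5(1,3) x f in \<open>simp_all add: commute_def\<close>)
  qed
qed

text \<open>
  Two applications of \<open>commute_generate\<close>, one for each factor, reduce the claim to \<open>gens_commute\<close>.
\<close>

lemma shift_commute:
  assumes p: "p \<in> carrier (P m)" and q: "q \<in> carrier (P n)"
  shows "commute (m + n) (shift m n p) q"
proof (rule commute_generate[OF _ _ P_hom_id _ q])
  show "shift m n p \<in> carrier (P (m + n))" by (rule shift_props(1)[OF p])
  fix y assume y: "y \<in> awp_gens A n"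
  have "commute (m + n) (free_var K y) (shift m n p)"
  proof (rule commute_generate[OF _ _ shift_hom _ p])
    show "free_var K y \<in> carrier (P (m + n))"
      using P_carrier_mono[OF _ cring.free_var_closed[OF K y]] by simp
    show "commute (m + n) (free_var K y) (shift m n (free_var K x))" if "x \<in> awp_gens A m" for x
      using gens_commute[OF that y] by (simp add: commute_def shift_var[OF that])
  qed simp
  then show "commute (m + n) (shift m n p) (free_var K y)" by (rule commute_sym)
qed simp_all

end

section \<open>The relations in tensor powers\<close>

text \<open>
  An object \<open>U\<close> of any strict linear monoidal category with endomorphisms satisfying the relations of the
  affine wreath product category: crossing \<open>sw\<close>, tokens \<open>tok a\<close> and dot \<open>dot\<close>.
\<close>

locale affine_wreath_category = lin_mon_category K C + dual_bases_algebra K A B dual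
  for K :: "('k, 'e) ring_scheme" and C :: "('o, 'm, 'k, 'z) lin_mon_cat_scheme" (structure)
    and A :: "('k, 'a, 'f) module_scheme" and B and dual +
  fixes U :: 'o and sw :: 'm and tok :: "'a \<Rightarrow> 'm" and dot :: 'm
  assumes sw_Hom: "sw \<in> Hom C (TensO C U U) (TensO C U U)"
    and tok_Hom: "a \<in> carrier A \<Longrightarrow> tok a \<in> Hom C U U"
    and dot_Hom: "dot \<in> Hom C U U"
    and sw_sw: "sw \<cdot> sw = Ident C (TensO C U U)"
    and braid: "(sw \<boxtimes> Ident C U) \<cdot> (Ident C U \<boxtimes> sw) \<cdot> (sw \<boxtimes> Ident C U) =
      (Ident C U \<boxtimes> sw) \<cdot> (sw \<boxtimes> Ident C U) \<cdot> (Ident C U \<boxtimes> sw)"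
    and tok_linear: "c \<in> carrier K \<Longrightarrow> c' \<in> carrier K \<Longrightarrow> a \<in> carrier A \<Longrightarrow> b \<in> carrier A \<Longrightarrow>
      tok (c \<odot>\<^bsub>A\<^esub> a \<oplus>\<^bsub>A\<^esub> c' \<odot>\<^bsub>A\<^esub> b) = AddM C (ScaleM C c (tok a)) (ScaleM C c' (tok b))"
    and tok_mult: "a \<in> carrier A \<Longrightarrow> b \<in> carrier A \<Longrightarrow> tok a \<cdot> tok b = tok (a \<otimes>\<^bsub>A\<^esub> b)"
    and tok_one: "tok \<one>\<^bsub>A\<^esub> = Ident C U"
    and sw_tok: "a \<in> carrier A \<Longrightarrow> sw \<cdot> (tok a \<boxtimes> Ident C U) = (Ident C U \<boxtimes> tok a) \<cdot> sw"
    and dot_sw: "DiffM K C ((dot \<boxtimes> Ident C U) \<cdot> sw) (sw \<cdot> (Ident C U \<boxtimes> dot)) =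
      (\<Oplus>\<^bsub>End_algebra C (TensO C U U)\<^esub>b\<in>B. tok b \<boxtimes> tok (dual b))"
    and tok_dot: "a \<in> carrier A \<Longrightarrow> tok a \<cdot> dot = dot \<cdot> tok a"
begin

abbreviation N :: "nat \<Rightarrow> 'o" where "N n \<equiv> tens_pow_obj C U n"
abbreviation one :: "nat \<Rightarrow> 'm" where "one n \<equiv> Ident C (N n)"
abbreviation H :: "nat \<Rightarrow> 'm set" where "H n \<equiv> Hom C (N n) (N n)"
abbreviation E where "E n \<equiv> End_algebra C (N n)"

lemma N_0: "N 0 = UnitO C" and N_Suc: "N (Suc n) = TensO C U (N n)"
  by (simp_all add: tens_pow_obj_def)

lemma N_add: "TensO C (N m) (N n) = N (m + n)"
  by (induction m) (simp_all add: N_0 N_Suc unitO_left tensO_assoc)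

lemma N_1: "N 1 = U" and N_2: "N 2 = TensO C U U"
  by (simp_all add: numeral_2_eq_2 N_0 N_Suc unitO_right)

lemma tens_pow_Ident: "tens_pow_mor C (Ident C U) n = one n"
  by (induction n) (simp_all add: tens_pow_mor_def N_0 N_Suc tens_id)

lemma gens_H: "sw \<in> H 2" "a \<in> carrier A \<Longrightarrow> tok a \<in> H 1" "dot \<in> H 1"
  using sw_Hom tok_Hom dot_Hom unfolding N_1 N_2 by simp_all

lemma one_H: "one n \<in> H n"
  by (rule Ident_Hom)

lemma tens_H: "f \<in> H m \<Longrightarrow> g \<in> H n \<Longrightarrow> f \<boxtimes> g \<in> H (m + n)"
  using tens_Hom[of f "N m" "N m" g "N n" "N n"] by (simp add: N_add)

lemma tens_one: "one m \<boxtimes> one n = one (m + n)"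
  by (simp add: tens_id N_add)

text \<open>
  The morphism \<open>f\<close> with \<open>p\<close> identity strands on its left and \<open>q\<close> on its right.
\<close>

definition emb :: "nat \<Rightarrow> 'm \<Rightarrow> nat \<Rightarrow> 'm" where
  "emb p f q = one p \<boxtimes> f \<boxtimes> one q"

lemma emb_H: "f \<in> H m \<Longrightarrow> emb p f q \<in> H (p + m + q)"
  unfolding emb_def by (intro tens_H one_H)

lemma emb_H': "f \<in> H m \<Longrightarrow> p + m + q = d \<Longrightarrow> emb p f q \<in> H d"
  using emb_H[of f m p q] by simp

lemma emb_comp:
  assumes "g \<in> H m" "f \<in> H m"
  shows "emb p g q \<cdot> emb p f q = emb p (g \<cdot> f) q"
  unfolding emb_def
  by (simp add: interchange[OF tens_H[OF one_H assms(1)] tens_H[OF one_H assms(2)] one_H one_H]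
      interchange[OF one_H one_H assms] id_left[OF one_H])

lemma emb_one: "emb p (one m) q = one (p + m + q)"
  by (simp add: emb_def tens_one)

lemma emb_left: "f \<in> H m \<Longrightarrow> emb p (one r \<boxtimes> f) q = emb (p + r) f q"
  by (simp add: emb_def tens_assoc[OF one_H one_H, symmetric] tens_one)

lemma emb_right: "f \<in> H m \<Longrightarrow> emb p (f \<boxtimes> one r) q = emb p f (r + q)"
  by (simp add: emb_def tens_assoc[OF one_H _ one_H, symmetric]
      tens_assoc[OF tens_H[OF one_H] one_H one_H] tens_one)

lemma emb_add: "f \<in> H m \<Longrightarrow> g \<in> H m \<Longrightarrow> emb p (AddM C f g) q = AddM C (emb p f q) (emb p g q)"
  unfolding emb_def
  by (simp add: tens_add_right[OF one_H] tens_add_left[OF tens_Hom[OF one_H] tens_Hom[OF one_H] one_H])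

lemma emb_scale: "c \<in> carrier K \<Longrightarrow> f \<in> H m \<Longrightarrow> emb p (ScaleM C c f) q = ScaleM C c (emb p f q)"
  unfolding emb_def
  by (simp add: tens_scale_right[OF _ one_H] tens_scale_left[OF _ tens_Hom[OF one_H] one_H])

lemma emb_Diff: "f \<in> H m \<Longrightarrow> g \<in> H m \<Longrightarrow> emb p (DiffM K C f g) q = DiffM K C (emb p f q) (emb p g q)"
  unfolding DiffM_def
  by (simp add: emb_add[OF _ scale_Hom[OF minus_one_closed]] emb_scale[OF minus_one_closed])

lemma emb_zero: "emb p (ZeroM C (N m) (N m)) q = ZeroM C (N (p + m + q)) (N (p + m + q))"
  unfolding emb_def by (simp add: tens_zero_right[OF one_H] tens_zero_left[OF one_H] N_add)

lemma emb_sum: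
  assumes "finite S" "\<And>b. b \<in> S \<Longrightarrow> f b \<in> H m"
  shows "emb p (\<Oplus>\<^bsub>E m\<^esub>b\<in>S. f b) q =
    (\<Oplus>\<^bsub>E (p + m + q)\<^esub>b\<in>S. emb p (f b) q)"
proof -
  interpret M: module K "E m" unfolding End_algebra_eq by (rule Hom_module)
  interpret M': module K "E (p + m + q)" unfolding End_algebra_eq by (rule Hom_module)
  have car: "carrier (End_algebra C X) = Hom C X X" "\<zero>\<^bsub>End_algebra C X\<^esub> = ZeroM C X X"
    "g \<oplus>\<^bsub>End_algebra C X\<^esub> h = AddM C g h" for X g h
    by (simp_all add: End_algebra_def)
  show ?thesis
    using assms
  proof (induction rule: finite_induct)
    case empty
    then show ?case by (simp add: car emb_zero)
  next
    case (insert b S)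
    have f: "f \<in> S \<rightarrow> carrier (E m)" and b: "f b \<in> carrier (E m)"
      using insert(4) by (auto simp: car)
    have f': "(\<lambda>b. emb p (f b) q) \<in> S \<rightarrow> carrier (E (p + m + q))"
      and b': "emb p (f b) q \<in> carrier (E (p + m + q))"
      using insert(4) by (auto simp: car intro!: emb_H)
    have sum: "(\<Oplus>\<^bsub>E m\<^esub>b\<in>S. f b) \<in> H m"
      using M.finsum_closed[OF f] by (simp add: car)
    show ?case
      unfolding M.finsum_insert[OF insert(1,2) f b] M'.finsum_insert[OF insert(1,2) f' b'] car(3)
      using insert.IH insert(4) by (simp add: emb_add[OF insert(4)[OF insertI1] sum])
  qed
qed

lemma tens_commute:
  assumes "f \<in> H m" "g \<in> H n"
  shows "(f \<boxtimes> one n) \<cdot> (one m \<boxtimes> g) = f \<boxtimes> g" "(one m \<boxtimes> g) \<cdot> (f \<boxtimes> one n) = f \<boxtimes> g"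
  by (simp_all add: interchange[OF assms(1) one_H one_H assms(2)]
      interchange[OF one_H assms(1) assms(2) one_H] id_left[OF assms(1)] id_left[OF assms(2)]
      id_right[OF assms(1)] id_right[OF assms(2)])

text \<open>
  Here \<open>f\<close> acts to the left of \<open>g\<close>, separated by \<open>k\<close> strands. After absorbing the strands in between into
  \<open>g\<close>, both products equal the tensor product of the two morphisms by the interchange law.
\<close>

lemma emb_commute:
  assumes f: "f \<in> H m" and g: "g \<in> H n" and d: "p + m + q = p' + n + q'" and q: "n + q' \<le> q"
  shows "emb p f q \<cdot> emb p' g q' = emb p' g q' \<cdot> emb p f q"
proof -
  define k where "k = q - n - q'"
  have k: "q = k + n + q'" "p' = p + (m + k)" using d q by (auto simp: k_def)
  let ?g = "one k \<boxtimes> g"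
  have gH: "?g \<in> H (k + n)" by (rule tens_H[OF one_H g])
  have "emb p f q = emb p (f \<boxtimes> one (k + n)) q'"
    unfolding k(1) by (rule emb_right[OF f, symmetric])
  moreover have "emb p' g q' = emb p (one m \<boxtimes> ?g) q'"
    unfolding k(2) emb_left[OF g, symmetric] by (simp add: tens_assoc[OF one_H one_H g, symmetric] tens_one)
  ultimately show ?thesis
    using emb_comp[OF tens_H[OF f one_H] tens_H[OF one_H gH]] emb_comp[OF tens_H[OF one_H gH] tens_H[OF f one_H]]
      tens_commute[OF f gH] by simp
qed

lemma emb_disjoint:
  assumes "f \<in> H m" "g \<in> H n" "p + m + q = p' + n + q'" "n + q' \<le> q \<or> m + q \<le> q'"
  shows "emb p f q \<cdot> emb p' g q' = emb p' g q' \<cdot> emb p f q"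
  using assms emb_commute[of f m g n p q p' q'] emb_commute[of g n f m p' q' p q] by auto

definition endo_t where "endo_t d i = emb (d - i) dot (i - 1)"
definition endo_u where "endo_u d i a = emb (d - i) (tok a) (i - 1)"
definition endo_s where "endo_s d i = emb (d - 1 - i) sw (i - 1)"

lemma endo_H:
  "i \<in> {1..d} \<Longrightarrow> endo_t d i \<in> H d"
  "i \<in> {1..d} \<Longrightarrow> a \<in> carrier A \<Longrightarrow> endo_u d i a \<in> H d"
  "i \<in> {1..<d} \<Longrightarrow> endo_s d i \<in> H d"
  unfolding endo_t_def endo_u_def endo_s_def
  by (rule emb_H'[OF gens_H(3)] emb_H'[OF gens_H(2)] emb_H'[OF gens_H(1)]; auto)+

text \<open>
  All generators on the strands \<open>i\<close> and \<open>i + 1\<close> are morphisms on two strands with the same identity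
  strands added, so that relations among them can be checked on two strands.
\<close>

lemma endo_pair:
  fixes i d :: nat
  assumes "i \<in> {1..<d}"
  obtains p q where "d = p + 2 + q"
    "endo_s d i = emb p sw q"
    "endo_t d i = emb p (one 1 \<boxtimes> dot) q" "endo_t d (i + 1) = emb p (dot \<boxtimes> one 1) q"
    "\<And>a. a \<in> carrier A \<Longrightarrow> endo_u d i a = emb p (one 1 \<boxtimes> tok a) q"
    "\<And>a. a \<in> carrier A \<Longrightarrow> endo_u d (i + 1) a = emb p (tok a \<boxtimes> one 1) q"
proof -
  define p q where "p = d - 1 - i" and "q = i - 1"
  have d: "d = p + 2 + q" "i = q + 1" using assms by (auto simp: p_def q_def)
  show ?thesis
    by (rule that[OF d(1)])
      (simp_all add: d endo_t_def endo_u_def endo_s_def emb_left[OF gens_H(3)] emb_right[OF gens_H(3)]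
        emb_left[OF gens_H(2)] emb_right[OF gens_H(2)])
qed

text \<open>
  The defining relation moves tokens through the crossing in one direction. As the crossing is an
  involution, multiplying by it on both sides gives the other direction.
\<close>

lemma tok_sw: "a \<in> carrier A \<Longrightarrow> sw \<cdot> (one 1 \<boxtimes> tok a) = (tok a \<boxtimes> one 1) \<cdot> sw"
proof -
  assume a: "a \<in> carrier A"
  have l: "tok a \<boxtimes> one 1 \<in> H 2" and r: "one 1 \<boxtimes> tok a \<in> H 2"
    using tens_H[OF gens_H(2)[OF a] one_H[of 1]] tens_H[OF one_H[of 1] gens_H(2)[OF a]]
    unfolding one_add_one by simp_all
  have ss: "sw \<cdot> sw = one 2" using sw_sw by (simp add: N_2)
  have "(tok a \<boxtimes> one 1) \<cdot> sw = sw \<cdot> sw \<cdot> (tok a \<boxtimes> one 1) \<cdot> sw"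
    by (simp only: ss id_left[OF l])
  also have "\<dots> = sw \<cdot> (sw \<cdot> (tok a \<boxtimes> one 1)) \<cdot> sw"
    by (simp only: comp_assoc[OF gens_H(1) gens_H(1) l])
  also have "\<dots> = sw \<cdot> ((one 1 \<boxtimes> tok a) \<cdot> sw) \<cdot> sw"
    using sw_tok[OF a] by (simp only: N_1)
  also have "\<dots> = sw \<cdot> (one 1 \<boxtimes> tok a) \<cdot> (sw \<cdot> sw)"
    by (simp only: comp_assoc[OF gens_H(1) r gens_H(1), symmetric]
        comp_assoc[OF comp_Hom[OF gens_H(1) r] gens_H(1) gens_H(1)])
  also have "\<dots> = sw \<cdot> (one 1 \<boxtimes> tok a)"
    by (simp only: ss id_right[OF comp_Hom[OF gens_H(1) r]])
  finally show ?thesis by (rule HOL.sym)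
qed

text \<open>
  Relations between generators on disjoint strands are instances of \<open>emb_disjoint\<close>; the others are the
  defining relations of the category, placed on the strands concerned by \<open>emb\<close>.
\<close>

theorem endo_sat: "awp_sat K A B dual (E d) (=) d (endo_t d) (endo_u d) (endo_s d)"
proof -
  note One_nat_def [simp del]
  interpret M: module K "E d" unfolding End_algebra_eq by (rule Hom_module)
  have ops: "f \<otimes>\<^bsub>E d\<^esub> g = f \<cdot> g" "\<one>\<^bsub>E d\<^esub> = one d"
    "f \<oplus>\<^bsub>E d\<^esub> g = AddM C f g" "c \<odot>\<^bsub>E d\<^esub> f = ScaleM C c f" for f g c
    by (simp_all add: End_algebra_def)
  have diff: "f \<ominus>\<^bsub>E d\<^esub> g = DiffM K C f g" if "f \<in> H d" "g \<in> H d" for f g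
    using DiffM_eq[OF that] by (simp add: End_algebra_eq)
  have two: "1 + 1 = (2::nat)" by simp
  note dot1 = tens_H[OF gens_H(3) one_H[of 1], unfolded two] tens_H[OF one_H[of 1] gens_H(3), unfolded two]
  note tok1 = tens_H[OF gens_H(2) one_H[of 1], unfolded two] tens_H[OF one_H[of 1] gens_H(2), unfolded two]
  show ?thesis
    unfolding awp_sat_def ops
  proof (intro conjI ballI allI impI)
    fix i j assume i: "i \<in> {1..<d}" and j: "j \<in> {1..<d}" and far: "\<bar>int i - int j\<bar> > 1"
    show "endo_s d i \<cdot> endo_s d j = endo_s d j \<cdot> endo_s d i"
      unfolding endo_s_def by (rule emb_disjoint[OF gens_H(1) gens_H(1)]; use i j far in \<open>simp, arith?\<close>)
  next
    fix i assume "i \<in> {1..<d}"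
    then obtain p q where d: "d = p + 2 + q" and s: "endo_s d i = emb p sw q"
      by (rule endo_pair)
    have "sw \<cdot> sw = one 2" using sw_sw by (simp add: N_2)
    then have "endo_s d i \<cdot> endo_s d i = emb p (one 2) q"
      by (simp only: s emb_comp[OF gens_H(1) gens_H(1)])
    then show "endo_s d i \<cdot> endo_s d i = one d"
      by (simp only: emb_one d)
  next
    fix i assume i: "1 \<le> i" "i + 2 \<le> d"
    define p q where "p = d - 2 - i" and "q = i - 1"
    have d: "d = p + 3 + q" "i = q + 1" using i by (auto simp: p_def q_def)
    let ?l = "sw \<boxtimes> one 1" and ?r = "one 1 \<boxtimes> sw"
    have three: "2 + 1 = (3::nat)" "1 + 2 = (3::nat)" by simp_all
    note lr = tens_H[OF gens_H(1) one_H[of 1], unfolded three] tens_H[OF one_H[of 1] gens_H(1), unfolded three]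
    have s: "endo_s d i = emb p ?r q" "endo_s d (i + 1) = emb p ?l q"
      by (simp_all add: endo_s_def d emb_left[OF gens_H(1)] emb_right[OF gens_H(1)]
        Suc_eq_plus1 add.commute[of 1 q])
    have "?l \<cdot> ?r \<cdot> ?l = ?r \<cdot> ?l \<cdot> ?r" using braid by (simp only: N_1)
    then show "endo_s d (i + 1) \<cdot> endo_s d i \<cdot> endo_s d (i + 1) = endo_s d i \<cdot> endo_s d (i + 1) \<cdot> endo_s d i"
      by (simp add: s emb_comp[OF lr] emb_comp[OF lr(2,1)] emb_comp[OF comp_Hom[OF lr] lr(1)]
          emb_comp[OF comp_Hom[OF lr(2,1)] lr(2)])
  next
    fix i j assume i: "i \<in> {1..d}" and j: "j \<in> {1..d}"
    show "endo_t d i \<cdot> endo_t d j = endo_t d j \<cdot> endo_t d i"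
    proof (cases "i = j")
      case False
      then show ?thesis unfolding endo_t_def
        by - (rule emb_disjoint[OF gens_H(3) gens_H(3)]; use i j in \<open>simp, arith?\<close>)
    qed simp
  next
    fix i j assume i: "i \<in> {1..d}" and j: "j \<in> {1..<d}" and ne: "i \<noteq> j" "i \<noteq> j + 1"
    show "endo_t d i \<cdot> endo_s d j = endo_s d j \<cdot> endo_t d i"
      unfolding endo_s_def endo_t_def
      by (rule emb_disjoint[OF gens_H(3) gens_H(1)]; use i j ne in \<open>simp, arith?\<close>)
  next
    fix j c c' a b assume j: "j \<in> {1..d}" and c: "c \<in> carrier K" "c' \<in> carrier K"
      and ab: "a \<in> carrier A" "b \<in> carrier A"
    show "endo_u d j (c \<odot>\<^bsub>A\<^esub> a \<oplus>\<^bsub>A\<^esub> c' \<odot>\<^bsub>A\<^esub> b) =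
        AddM C (ScaleM C c (endo_u d j a)) (ScaleM C c' (endo_u d j b))"
      by (simp add: endo_u_def tok_linear[OF c ab] emb_scale[OF c(1) gens_H(2)[OF ab(1)]]
          emb_scale[OF c(2) gens_H(2)[OF ab(2)]]
          emb_add[OF scale_Hom[OF c(1) gens_H(2)[OF ab(1)]] scale_Hom[OF c(2) gens_H(2)[OF ab(2)]]])
  next
    fix j a b assume j: "j \<in> {1..d}" and ab: "a \<in> carrier A" "b \<in> carrier A"
    show "endo_u d j a \<cdot> endo_u d j b = endo_u d j (a \<otimes>\<^bsub>A\<^esub> b)"
      by (simp add: endo_u_def emb_comp[OF gens_H(2)[OF ab(1)] gens_H(2)[OF ab(2)]] tok_mult ab)
  next
    fix j assume j: "j \<in> {1..d}"
    then have "d = d - j + 1 + (j - 1)" by auto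
    then show "endo_u d j \<one>\<^bsub>A\<^esub> = one d"
      using emb_one[of "d - j" 1 "j - 1"] by (simp add: endo_u_def tok_one N_1)
  next
    fix i j a b assume i: "i \<in> {1..d}" and j: "j \<in> {1..d}" and ne: "i \<noteq> j"
      and ab: "a \<in> carrier A" "b \<in> carrier A"
    show "endo_u d i a \<cdot> endo_u d j b = endo_u d j b \<cdot> endo_u d i a"
      unfolding endo_u_def
      by (rule emb_disjoint[OF gens_H(2)[OF ab(1)] gens_H(2)[OF ab(2)]]; use i j ne in \<open>simp, arith?\<close>)
  next
    fix i j a assume i: "i \<in> {1..<d}" and j: "j \<in> {1..d}" and a: "a \<in> carrier A"
    from i obtain p q where d: "d = p + 2 + q" and s: "endo_s d i = emb p sw q"
      and u: "endo_u d i a = emb p (one 1 \<boxtimes> tok a) q" "endo_u d (i + 1) a = emb p (tok a \<boxtimes> one 1) q"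
      by (rule endo_pair) (use a in auto)
    consider "j = i" | "j = i + 1" | "j \<noteq> i" "j \<noteq> i + 1" by linarith
    then show "endo_s d i \<cdot> endo_u d j a = endo_u d (transpose i (i + 1) j) a \<cdot> endo_s d i"
    proof cases
      case 1
      have "transpose i (i + 1) j = i + 1" by (simp add: 1)
      then show ?thesis
        using 1 u s tok_sw[OF a] by (simp add: emb_comp[OF gens_H(1) tok1(2)[OF a]] emb_comp[OF tok1(1)[OF a] gens_H(1)])
    next
      case 2
      have "transpose i (i + 1) j = i" by (simp add: 2)
      moreover have "sw \<cdot> (tok a \<boxtimes> one 1) = (one 1 \<boxtimes> tok a) \<cdot> sw"
        using sw_tok[OF a] by (simp only: N_1)
      ultimately show ?thesis
        using 2 u s
        by (simp add: emb_comp[OF gens_H(1) tok1(1)[OF a]] emb_comp[OF tok1(2)[OF a] gens_H(1)])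
    next
      case 3
      then have tr: "transpose i (i + 1) j = j" by (simp add: transpose_def)
      show ?thesis unfolding tr endo_s_def endo_u_def
        by (rule emb_disjoint[OF gens_H(1) gens_H(2)[OF a]]; use i j 3 in \<open>simp, arith?\<close>)
    qed
  next
    fix i j a assume i: "i \<in> {1..d}" and j: "j \<in> {1..d}" and a: "a \<in> carrier A"
    show "endo_t d i \<cdot> endo_u d j a = endo_u d j a \<cdot> endo_t d i"
    proof (cases "i = j")
      case True
      then show ?thesis
        using tok_dot[OF a] by (simp add: endo_t_def endo_u_def emb_comp[OF gens_H(3) gens_H(2)[OF a]]
            emb_comp[OF gens_H(2)[OF a] gens_H(3)])
    next
      case False
      then show ?thesis unfolding endo_t_def endo_u_def
        by - (rule emb_disjoint[OF gens_H(3) gens_H(2)[OF a]]; use i j in \<open>simp, arith?\<close>)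
    qed
  next
    fix i assume i: "i \<in> {1..<d}"
    from i obtain p q where d: "d = p + 2 + q" and s: "endo_s d i = emb p sw q"
      and t: "endo_t d i = emb p (one 1 \<boxtimes> dot) q" "endo_t d (i + 1) = emb p (dot \<boxtimes> one 1) q"
      and u: "\<And>a. a \<in> carrier A \<Longrightarrow> endo_u d i a = emb p (one 1 \<boxtimes> tok a) q"
        "\<And>a. a \<in> carrier A \<Longrightarrow> endo_u d (i + 1) a = emb p (tok a \<boxtimes> one 1) q"
      by (rule endo_pair) blast
    have Bc: "b \<in> carrier A" "dual b \<in> carrier A" if "b \<in> B" for b
      using that B by auto
    let ?L = "(dot \<boxtimes> one 1) \<cdot> sw" and ?R = "sw \<cdot> (one 1 \<boxtimes> dot)"
    have L: "?L \<in> H 2" and R: "?R \<in> H 2"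
      by (rule comp_Hom[OF dot1(1) gens_H(1)] comp_Hom[OF gens_H(1) dot1(2)])+
    have ts: "endo_t d (i + 1) \<cdot> endo_s d i = emb p ?L q" "endo_s d i \<cdot> endo_t d i = emb p ?R q"
      by (simp_all add: t s emb_comp[OF dot1(1) gens_H(1)] emb_comp[OF gens_H(1) dot1(2)])
    have bb: "tok b \<boxtimes> tok (dual b) \<in> H 2" if "b \<in> B" for b
      using tens_H[OF gens_H(2)[OF Bc(1)[OF that]] gens_H(2)[OF Bc(2)[OF that]]] by (simp add: two)
    have "endo_t d (i + 1) \<cdot> endo_s d i \<ominus>\<^bsub>E d\<^esub> endo_s d i \<cdot> endo_t d i =
        DiffM K C (emb p ?L q) (emb p ?R q)"
      unfolding ts using emb_H[OF L, of p q] emb_H[OF R, of p q] by (intro diff) (simp_all only: d)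
    also have "\<dots> = emb p (DiffM K C ?L ?R) q"
      by (rule emb_Diff[OF L R, symmetric])
    also have "\<dots> = emb p (\<Oplus>\<^bsub>E 2\<^esub>b\<in>B. tok b \<boxtimes> tok (dual b)) q"
      using dot_sw by (simp only: N_1 N_2)
    also have "\<dots> = (\<Oplus>\<^bsub>E d\<^esub>b\<in>B. emb p (tok b \<boxtimes> tok (dual b)) q)"
      unfolding d by (rule emb_sum[OF B(1) bb])
    also have "\<dots> = (\<Oplus>\<^bsub>E d\<^esub>b\<in>B. endo_u d (i + 1) b \<cdot> endo_u d i (dual b))"
    proof (rule M.finsum_cong'[OF HOL.refl])
      fix b assume b: "b \<in> B"
      show "emb p (tok b \<boxtimes> tok (dual b)) q = endo_u d (i + 1) b \<cdot> endo_u d i (dual b)"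
        unfolding u(2)[OF Bc(1)[OF b]] u(1)[OF Bc(2)[OF b]]
          emb_comp[OF tok1(1)[OF Bc(1)[OF b]] tok1(2)[OF Bc(2)[OF b]]]
          tens_commute(1)[OF gens_H(2)[OF Bc(1)[OF b]] gens_H(2)[OF Bc(2)[OF b]]] by (rule HOL.refl)
    next
      show "(\<lambda>b. endo_u d (i + 1) b \<cdot> endo_u d i (dual b)) \<in> B \<rightarrow> carrier (E d)"
      proof
        fix b assume b: "b \<in> B"
        have "endo_u d (i + 1) b \<cdot> endo_u d i (dual b) \<in> H d"
          using i endo_H(2)[of "i + 1" d b] endo_H(2)[of i d "dual b"] Bc[OF b]
          by (intro comp_Hom[of _ "N d"]) auto
        then show "endo_u d (i + 1) b \<cdot> endo_u d i (dual b) \<in> carrier (E d)"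
          by (simp add: End_algebra_def)
      qed
    qed
    finally show "endo_t d (i + 1) \<cdot> endo_s d i \<ominus>\<^bsub>E d\<^esub> endo_s d i \<cdot> endo_t d i =
        (\<Oplus>\<^bsub>E d\<^esub>b\<in>B. endo_u d (i + 1) b \<cdot> endo_u d i (dual b))" .
  qed
qed

lemma tens_one_right_hom: "algebra_hom K (E m) (E (m + n)) (\<lambda>f. f \<boxtimes> one n)"
  unfolding algebra_hom_def
proof (intro conjI ring_hom_memI ballI; simp only: End_algebra_def monoid.simps partial_object.simps ring.simps module.simps)
  show "f \<boxtimes> one n \<in> H (m + n)" if "f \<in> H m" for f by (rule tens_H[OF that one_H])
  show "(f \<cdot> g) \<boxtimes> one n = (f \<boxtimes> one n) \<cdot> (g \<boxtimes> one n)" if "f \<in> H m" "g \<in> H m" for f g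
    by (simp add: interchange[OF that one_H one_H] id_left[OF one_H])
  show "AddM C f g \<boxtimes> one n = AddM C (f \<boxtimes> one n) (g \<boxtimes> one n)" if "f \<in> H m" "g \<in> H m" for f g
    by (rule tens_add_left[OF that one_H])
  show "one m \<boxtimes> one n = one (m + n)" by (rule tens_one)
  show "ScaleM C c f \<boxtimes> one n = ScaleM C c (f \<boxtimes> one n)" if "c \<in> carrier K" "f \<in> H m" for c f
    by (rule tens_scale_left[OF that one_H])
qed

lemma tens_one_left_hom: "algebra_hom K (E n) (E (m + n)) (\<lambda>f. one m \<boxtimes> f)"
  unfolding algebra_hom_def
proof (intro conjI ring_hom_memI ballI; simp only: End_algebra_def monoid.simps partial_object.simps ring.simps module.simps)
  show "one m \<boxtimes> f \<in> H (m + n)" if "f \<in> H n" for f by (rule tens_H[OF one_H that])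
  show "one m \<boxtimes> (f \<cdot> g) = (one m \<boxtimes> f) \<cdot> (one m \<boxtimes> g)" if "f \<in> H n" "g \<in> H n" for f g
    by (simp add: interchange[OF one_H one_H that] id_left[OF one_H])
  show "one m \<boxtimes> AddM C f g = AddM C (one m \<boxtimes> f) (one m \<boxtimes> g)" if "f \<in> H n" "g \<in> H n" for f g
    by (rule tens_add_right[OF one_H that])
  show "one m \<boxtimes> one n = one (m + n)" by (rule tens_one)
  show "one m \<boxtimes> ScaleM C c f = ScaleM C c (one m \<boxtimes> f)" if "c \<in> carrier K" "f \<in> H n" for c f
    by (rule tens_scale_right[OF that(1) one_H that(2)])
qed

lemma emb_tens_right: "f \<in> H m \<Longrightarrow> emb p f q \<boxtimes> one n = emb p f (q + n)"
  unfolding emb_def by (simp add: tens_assoc[OF tens_H[OF one_H] one_H one_H] tens_one)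

lemma emb_tens_left: "f \<in> H m \<Longrightarrow> one n \<boxtimes> emb p f q = emb (n + p) f q"
  unfolding emb_def
  by (simp add: tens_assoc[OF one_H tens_H[OF one_H] one_H, symmetric]
      tens_assoc[OF one_H one_H, symmetric] tens_one)

definition endo :: "nat \<Rightarrow> 'a awp_gen \<Rightarrow> 'm" where
  "endo d y = (case y of Var_t i \<Rightarrow> endo_t d i | Var_u i a \<Rightarrow> endo_u d i a | Var_s i \<Rightarrow> endo_s d i)"

definition psi :: "nat \<Rightarrow> ('a awp_gen list \<Rightarrow> 'k) \<Rightarrow> 'm" where
  "psi d = free_eval K (E d) (endo d)"

lemma endo_closed: "endo d \<in> awp_gens A d \<rightarrow> carrier (E d)"
  using endo_H by (force simp: awp_gens_def endo_def End_algebra_def)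

lemma psi_hom: "algebra_hom K (P d) (E d) (psi d)"
  unfolding psi_def by (rule assoc_algebra.free_eval_algebra_hom(1)[OF End_assoc_algebra endo_closed])

lemma psi_var: "y \<in> awp_gens A d \<Longrightarrow> psi d (free_var K y) = endo d y"
  unfolding psi_def by (rule assoc_algebra.free_eval_algebra_hom(2)[OF End_assoc_algebra endo_closed])

lemma psi_relations: "p \<in> R d \<Longrightarrow> psi d p = ZeroM C (N d) (N d)"
proof -
  assume p: "p \<in> R d"
  interpret M: module K "E d" unfolding End_algebra_eq by (rule Hom_module)
  have "psi d p \<in> {\<zero>\<^bsub>E d\<^esub>}"
  proof (rule conjunct2[OF relations_map[OF End_assoc_algebra psi_hom _ _ _ endo_sat _ p]])
    show "x \<ominus>\<^bsub>E d\<^esub> y \<in> {\<zero>\<^bsub>E d\<^esub>}"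
      if "x \<in> carrier (E d)" "y \<in> carrier (E d)" "x = y" for x y
      using that M.M.r_neg by (simp add: a_minus_def)
  qed (subst psi_var; simp add: awp_gens_def endo_def)+
  then show ?thesis by (simp add: End_algebra_def)
qed

text \<open>
  Both sides are algebra homomorphisms in \<open>p\<close>, so it suffices to compare them on generators, where
  \<open>n\<close> more identity strands on the right account for raising the strand numbers by \<open>n\<close>.
\<close>

lemma psi_shift:
  assumes "p \<in> carrier (P m)"
  shows "psi (m + n) (shift m n p) = psi m p \<boxtimes> one n"
proof (rule algebra_hom_unique[OF End_assoc_algebra _ _ _ assms])
  show "algebra_hom K (P m) (E (m + n)) (\<lambda>p. psi (m + n) (shift m n p))"
    by (rule algebra_hom_comp[OF P_algebra P_algebra End_assoc_algebra shift_hom psi_hom])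
  show "algebra_hom K (P m) (E (m + n)) (\<lambda>p. psi m p \<boxtimes> one n)"
    by (rule algebra_hom_comp[OF P_algebra End_assoc_algebra End_assoc_algebra psi_hom tens_one_right_hom])
  fix y assume y: "y \<in> awp_gens A m"
  have "endo (m + n) (shift_gen n y) = endo m y \<boxtimes> one n"
    using y by (auto simp: awp_gens_def endo_def shift_gen_def endo_t_def endo_u_def endo_s_def
        emb_tens_right[OF gens_H(1)] emb_tens_right[OF gens_H(2)] emb_tens_right[OF gens_H(3)])
  then show "psi (m + n) (shift m n (free_var K y)) = psi m (free_var K y) \<boxtimes> one n"
    using y by (simp add: shift_var psi_var shift_gen_in)
qed

lemma psi_mono:
  assumes "p \<in> carrier (P n)"
  shows "psi (m + n) p = one m \<boxtimes> psi n p"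
proof (rule algebra_hom_unique[OF End_assoc_algebra _ _ _ assms])
  show "algebra_hom K (P n) (E (m + n)) (\<lambda>p. psi (m + n) p)"
    by (rule algebra_hom_comp[OF P_algebra P_algebra End_assoc_algebra P_hom_id psi_hom]) simp
  show "algebra_hom K (P n) (E (m + n)) (\<lambda>p. one m \<boxtimes> psi n p)"
    by (rule algebra_hom_comp[OF P_algebra End_assoc_algebra End_assoc_algebra psi_hom tens_one_left_hom])
  fix y assume y: "y \<in> awp_gens A n"
  then have y': "y \<in> awp_gens A (m + n)" by (auto simp: awp_gens_def)
  have "endo (m + n) y = one m \<boxtimes> endo n y"
    using y by (auto simp: awp_gens_def endo_def endo_t_def endo_u_def endo_s_def
        emb_tens_left[OF gens_H(1)] emb_tens_left[OF gens_H(2)] emb_tens_left[OF gens_H(3)])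
  then show "psi (m + n) (free_var K y) = one m \<boxtimes> psi n (free_var K y)"
    using y y' by (simp add: psi_var)
qed

end

section \<open>From terms to the affine wreath product algebra\<close>

context dual_bases_algebra
begin

text \<open>
  For a term \<open>f\<close>, \<open>dm f\<close> and \<open>cd f\<close> are the numbers of strands at its source and target.
\<close>

abbreviation S where "S \<equiv> aw_sig A"
abbreviation dm where "dm f \<equiv> length (tdom S f)"
abbreviation cd where "cd f \<equiv> length (tcod S f)"

lemma free_interpretation: "free_lin_mon_category K"
  by (rule free_lin_mon_category.intro[OF K])

interpretation F: free_lin_mon_category K S
  by (rule free_interpretation)

lemma unit_list_eq: "(xs :: unit list) = ys \<longleftrightarrow> length xs = length ys"
  by (auto intro: nth_equalityI)

text \<open>
  The value of a term in the affine wreath product algebra. Every generator is an endomorphism, so a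
  term whose source and target differ involves a zero morphism and has the value zero
  (\<open>phi_zero\<close>). The index \<open>dm f\<close> in the composite is therefore harmless when \<open>f\<close> is not an endomorphism.
\<close>

primrec phi :: "(unit, 'a aw_gen, 'k) mterm \<Rightarrow> 'a awp_gen list \<Rightarrow> 'k" where
  "phi (TId X) = \<one>\<^bsub>P (length X)\<^esub>"
| "phi (TGen y) = (case y of Gen_s \<Rightarrow> s 1 | Gen_beta a \<Rightarrow> u 1 a | Gen_x \<Rightarrow> t 1)"
| "phi (TComp g f) = phi g \<otimes>\<^bsub>P (dm f)\<^esub> phi f"
| "phi (TTens f g) = shift (dm f) (dm g) (phi f) \<otimes>\<^bsub>P (dm f + dm g)\<^esub> phi g"
| "phi (TZero X Y) = \<zero>\<^bsub>P (length X)\<^esub>"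
| "phi (TAdd f g) = phi f \<oplus>\<^bsub>P (dm f)\<^esub> phi g"
| "phi (TScale c f) = c \<odot>\<^bsub>P (dm f)\<^esub> phi f"

text \<open>
  The free algebras \<open>P d\<close> differ in their carriers only. This allows changing the number of strands
  in an operation at will.
\<close>

lemma ops_indep:
  "p \<otimes>\<^bsub>P d\<^esub> q = p \<otimes>\<^bsub>P e\<^esub> q" "p \<oplus>\<^bsub>P d\<^esub> q = p \<oplus>\<^bsub>P e\<^esub> q" "c \<odot>\<^bsub>P d\<^esub> p = c \<odot>\<^bsub>P e\<^esub> p"
  "\<one>\<^bsub>P d\<^esub> = \<one>\<^bsub>P e\<^esub>" "\<zero>\<^bsub>P d\<^esub> = \<zero>\<^bsub>P e\<^esub>"
  by (simp_all add: free_algebra_simps)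

lemma P_mult_zero:
  "p \<in> carrier (P e) \<Longrightarrow> p \<otimes>\<^bsub>P d\<^esub> \<zero>\<^bsub>P d'\<^esub> = \<zero>\<^bsub>P d''\<^esub>"
  "p \<in> carrier (P e) \<Longrightarrow> \<zero>\<^bsub>P d'\<^esub> \<otimes>\<^bsub>P d\<^esub> p = \<zero>\<^bsub>P d''\<^esub>"
  using ring.ring_simprules(24,25)[OF P_ring, of p e]
  unfolding ops_indep(1)[where d=d and e=e] ops_indep(5)[of d' e] ops_indep(5)[of d'' e] by simp_all

lemma phi_typing:
  "twf K S f \<Longrightarrow> phi f \<in> carrier (P (dm f)) \<and> (cd f \<noteq> dm f \<longrightarrow> phi f = \<zero>\<^bsub>P 0\<^esub>)"
proof (induction f)
  case (TId X)
  then show ?case by (simp add: P_closed)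
next
  case (TGen y)
  then show ?case
    by (auto simp: aw_sig_def intro!: gen_closed split: aw_gen.splits)
next
  case (TComp g f)
  then have g: "phi g \<in> carrier (P (cd f))" "cd g \<noteq> cd f \<longrightarrow> phi g = \<zero>\<^bsub>P 0\<^esub>"
    and f: "phi f \<in> carrier (P (dm f))" "cd f \<noteq> dm f \<longrightarrow> phi f = \<zero>\<^bsub>P 0\<^esub>" by auto
  show ?case
  proof (cases "cd f = dm f")
    case True
    then show ?thesis using f g P_closed(1)[of "phi g" "dm f" "phi f"] P_mult_zero(2)[OF f(1)] by auto
  next
    case False
    then have "phi (TComp g f) = \<zero>\<^bsub>P (dm f)\<^esub>" "phi (TComp g f) = \<zero>\<^bsub>P 0\<^esub>"
      using f P_mult_zero(1)[OF g(1)] by simp_all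
    then show ?thesis using P_closed(5)[of "dm f"] by simp
  qed
next
  case (TTens f g)
  then have f: "phi f \<in> carrier (P (dm f))" "cd f \<noteq> dm f \<longrightarrow> phi f = \<zero>\<^bsub>P 0\<^esub>"
    and g: "phi g \<in> carrier (P (dm g))" "cd g \<noteq> dm g \<longrightarrow> phi g = \<zero>\<^bsub>P 0\<^esub>" by auto
  have sf: "shift (dm f) (dm g) (phi f) \<in> carrier (P (dm f + dm g))" by (rule shift_props(1)[OF f(1)])
  have g': "phi g \<in> carrier (P (dm f + dm g))" by (rule P_carrier_mono[OF _ g(1)]) simp
  have z: "shift (dm f) (dm g) \<zero>\<^bsub>P 0\<^esub> = \<zero>\<^bsub>P 0\<^esub>"
    using shift_props(6)[of "dm f" "dm g"] ops_indep(5)[of "dm f" 0] ops_indep(5)[of "dm f + dm g" 0] by simp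
  show ?case
    using P_closed(1)[OF sf g'] P_mult_zero(2)[OF g'] P_mult_zero(1)[OF sf] f(2) g(2) z by auto
next
  case (TZero X Y)
  then show ?case using ops_indep(5)[of "length X" 0] P_closed(5)[of "length X"] by simp
next
  case (TAdd f g)
  then have f: "phi f \<in> carrier (P (dm f))" "cd f \<noteq> dm f \<longrightarrow> phi f = \<zero>\<^bsub>P 0\<^esub>"
    and g: "phi g \<in> carrier (P (dm f))" "cd f \<noteq> dm f \<longrightarrow> phi g = \<zero>\<^bsub>P 0\<^esub>" by auto
  have "\<zero>\<^bsub>P 0\<^esub> \<oplus>\<^bsub>P (dm f)\<^esub> \<zero>\<^bsub>P 0\<^esub> = \<zero>\<^bsub>P 0\<^esub>"
    using ring.ring_simprules(8)[OF P_ring P_closed(5), of "dm f"] ops_indep(5)[of "dm f" 0] by simp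
  then show ?case using f g P_closed(2) by simp
next
  case (TScale c f)
  then have f: "phi f \<in> carrier (P (dm f))" "cd f \<noteq> dm f \<longrightarrow> phi f = \<zero>\<^bsub>P 0\<^esub>" and c: "c \<in> carrier K" by auto
  have "c \<odot>\<^bsub>P (dm f)\<^esub> \<zero>\<^bsub>P 0\<^esub> = \<zero>\<^bsub>P 0\<^esub>"
    using module.smult_r_null[OF assoc_algebra_module[OF P_algebra] c, of "dm f"] ops_indep(5)[of "dm f" 0] by simp
  then show ?case using f c P_closed(6) by simp
qed

lemma phi_closed: "twf K S f \<Longrightarrow> phi f \<in> carrier (P (dm f))"
  and phi_zero: "twf K S f \<Longrightarrow> cd f \<noteq> dm f \<Longrightarrow> phi f = \<zero>\<^bsub>P d\<^esub>"
  using phi_typing[of f] ops_indep(5)[of d 0] by auto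

lemma phi_val: "twf K S f \<Longrightarrow> phi f w \<in> carrier K"
  using phi_closed[of f] by (simp add: free_algebra_simps(1))

lemma shift_zero: "shift m n \<zero>\<^bsub>P d\<^esub> = \<zero>\<^bsub>P e\<^esub>"
  using shift_props(6)[of m n] ops_indep(5)[of d m] ops_indep(5)[of e "m + n"] by simp

lemma shift_phi: "twf K S f \<Longrightarrow> shift (dm f) n (phi f) \<in> carrier (P (dm f + n))"
  by (rule shift_props(1)[OF phi_closed])

lemma phi_mono: "twf K S f \<Longrightarrow> phi f \<in> carrier (P (m + dm f))"
  by (rule P_carrier_mono[OF _ phi_closed]) simp_all

text \<open>
  If \<open>f\<close> and \<open>f'\<close> are endomorphisms, then so are \<open>g\<close> and \<open>g'\<close> or their values vanish, and the two middle
  factors can be exchanged by \<open>shift_commute\<close>. Otherwise both sides contain a factor zero.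
\<close>

lemma phi_interchange:
  assumes "twf K S (TComp g f)" "twf K S (TComp g' f')"
  shows "cls (dm f + dm f') (phi (TComp (TTens g g') (TTens f f'))) =
    cls (dm f + dm f') (phi (TTens (TComp g f) (TComp g' f')))"
proof -
  have wf: "twf K S g" "twf K S f" "twf K S g'" "twf K S f'" and cod: "dm g = cd f" "dm g' = cd f'"
    using assms by auto
  let ?m = "dm f" and ?n = "dm f'"
  show ?thesis
  proof (cases "cd f = ?m \<and> cd f' = ?n")
    case True
    then have d: "dm g = ?m" "dm g' = ?n" using cod by auto
    let ?d = "?m + ?n" and ?G = "shift ?m ?n (phi g)" and ?F = "shift ?m ?n (phi f)"
    have G: "?G \<in> carrier (P ?d)" and F: "?F \<in> carrier (P ?d)"
      using shift_phi[OF wf(1), of ?n] shift_phi[OF wf(2), of ?n] by (simp_all add: d)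
    have g: "phi g \<in> carrier (P ?m)" "phi g' \<in> carrier (P ?n)" "phi g' \<in> carrier (P ?d)" "phi f' \<in> carrier (P ?d)"
      using phi_closed[OF wf(1)] phi_closed[OF wf(3)] phi_mono[OF wf(3), of ?m] phi_mono[OF wf(4), of ?m]
      by (simp_all add: d)
    interpret ring "P ?d" by (rule P_ring)
    have "cls ?d (?G \<otimes>\<^bsub>P ?d\<^esub> phi g' \<otimes>\<^bsub>P ?d\<^esub> (?F \<otimes>\<^bsub>P ?d\<^esub> phi f')) =
        cls ?d (?G \<otimes>\<^bsub>P ?d\<^esub> ((phi g' \<otimes>\<^bsub>P ?d\<^esub> ?F) \<otimes>\<^bsub>P ?d\<^esub> phi f'))"
      using G F g by (simp add: m_assoc)
    also have "\<dots> = cls ?d (?G \<otimes>\<^bsub>P ?d\<^esub> ((?F \<otimes>\<^bsub>P ?d\<^esub> phi g') \<otimes>\<^bsub>P ?d\<^esub> phi f'))"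
    proof -
      have "cls ?d (phi g' \<otimes>\<^bsub>P ?d\<^esub> ?F) = cls ?d (?F \<otimes>\<^bsub>P ?d\<^esub> phi g')"
        using shift_commute[OF phi_closed[OF wf(2)] g(2)] by (simp add: commute_def)
      then have "cls ?d (phi g' \<otimes>\<^bsub>P ?d\<^esub> ?F \<otimes>\<^bsub>P ?d\<^esub> phi f') = cls ?d (?F \<otimes>\<^bsub>P ?d\<^esub> phi g' \<otimes>\<^bsub>P ?d\<^esub> phi f')"
        by (rule cls_mult[OF _ HOL.refl]) (use F g in simp_all)
      then show ?thesis by (rule cls_mult[OF HOL.refl]) (use F G g in simp_all)
    qed
    also have "\<dots> = cls ?d ((?G \<otimes>\<^bsub>P ?d\<^esub> ?F) \<otimes>\<^bsub>P ?d\<^esub> (phi g' \<otimes>\<^bsub>P ?d\<^esub> phi f'))"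
      using G F g by (simp add: m_assoc)
    also have "?G \<otimes>\<^bsub>P ?d\<^esub> ?F = shift ?m ?n (phi g \<otimes>\<^bsub>P ?m\<^esub> phi f)"
      by (rule shift_props(2)[OF g(1) phi_closed[OF wf(2)], symmetric])
    finally show ?thesis
      by (simp add: d ops_indep(1)[where d="?n" and e="?d"])
  next
    case False
    have "phi (TComp (TTens g g') (TTens f f')) = \<zero>\<^bsub>P 0\<^esub>"
      using False phi_zero[OF wf(2), of 0] phi_zero[OF wf(4), of 0] phi_closed[OF wf(4)]
        shift_phi[OF wf(2), of ?n] P_closed(1)[OF shift_phi[OF wf(1), of "dm g'"] phi_mono[OF wf(3), of "dm g"]]
      by (auto simp: shift_zero[of _ _ _ 0] P_mult_zero(1)[of _ _ _ _ 0] P_mult_zero(2)[of _ _ _ _ 0])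
    moreover have "phi (TTens (TComp g f) (TComp g' f')) = \<zero>\<^bsub>P 0\<^esub>"
      using False phi_zero[OF wf(2), of 0] phi_zero[OF wf(4), of 0] phi_closed[OF wf(1)] phi_closed[OF wf(3)]
        shift_phi[OF assms(1), of ?n] phi_closed[OF assms(2)]
      by (auto simp: shift_zero[of _ _ _ 0] P_mult_zero(1)[of _ _ _ _ 0] P_mult_zero(2)[of _ _ _ _ 0])
    ultimately show ?thesis by simp
  qed
qed

lemma phi_tens_assoc:
  assumes "twf K S f" "twf K S g" "twf K S h"
  shows "phi (TTens (TTens f g) h) = phi (TTens f (TTens g h))"
proof -
  let ?m = "dm f" and ?n = "dm g" and ?l = "dm h"
  let ?d = "?m + ?n + ?l"
  interpret ring "P ?d" by (rule P_ring)
  have g: "shift (?m + ?n) ?l (phi g) = shift ?n ?l (phi g)"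
    by (rule shift_restrict[OF phi_closed[OF assms(2)]]) simp
  have gc: "shift ?n ?l (phi g) \<in> carrier (P ?d)"
    by (rule P_carrier_mono[OF _ shift_phi[OF assms(2)]]) simp
  have f: "shift (?m + ?n) ?l (shift ?m ?n (phi f)) = shift ?m (?n + ?l) (phi f)"
    by (rule shift_shift[OF phi_closed[OF assms(1)]])
  have fc: "shift ?m (?n + ?l) (phi f) \<in> carrier (P ?d)"
    using shift_phi[OF assms(1), of "?n + ?l"] by (simp add: add.assoc)
  have hc: "phi h \<in> carrier (P ?d)" by (rule phi_mono[OF assms(3)])
  have "phi (TTens (TTens f g) h) = shift ?m (?n + ?l) (phi f) \<otimes>\<^bsub>P ?d\<^esub> shift ?n ?l (phi g) \<otimes>\<^bsub>P ?d\<^esub> phi h"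
    using shift_props(2)[OF shift_phi[OF assms(1), of ?n] phi_mono[OF assms(2), of ?m], of ?l] f g by simp
  also have "\<dots> = shift ?m (?n + ?l) (phi f) \<otimes>\<^bsub>P ?d\<^esub> (shift ?n ?l (phi g) \<otimes>\<^bsub>P ?d\<^esub> phi h)"
    by (rule m_assoc[OF fc gc hc])
  finally show ?thesis
    by (simp add: ops_indep(1)[where d="?n + ?l" and e="?d"] add.assoc)
qed

text \<open>
  Only the interchange law needs the relations. For all other axioms the two values are equal as
  elements of the free algebra, by the laws of convolution and the functoriality of \<open>shift\<close>.
\<close>

lemma phi_teq:
  assumes "teq K S f g"
  shows "cls (dm f) (phi f) = cls (dm f) (phi g)"
proof -
  interpret K: cring K by (rule K)
  note ops = free_algebra_simps(2-6)
  show ?thesis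
    using assms
  proof (induction rule: teq.induct)
    case (sym f g)
    then show ?case using F.teq_wf[OF sym.hyps] by simp
  next
    case (trans f g h)
    then show ?case using F.teq_wf[OF trans.hyps(1)] by simp
  next
    case (cong_comp g g' f f')
    note gg = F.teq_wf[OF cong_comp.hyps(1)] and ff = F.teq_wf[OF cong_comp.hyps(2)]
    show ?case
    proof (cases "cd f = dm f")
      case True
      have d: "dm g = dm f" "dm g' = dm f" "dm f' = dm f"
        using True cong_comp.hyps(3) gg ff by auto
      have "cls (dm f) (phi g \<otimes>\<^bsub>P (dm f)\<^esub> phi f) = cls (dm f) (phi g' \<otimes>\<^bsub>P (dm f)\<^esub> phi f')"
      proof (rule cls_mult)
        show "cls (dm f) (phi g) = cls (dm f) (phi g')" using cong_comp.IH(1) unfolding d(1) .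
        show "cls (dm f) (phi f) = cls (dm f) (phi f')" by (rule cong_comp.IH(2))
        show "phi g \<in> carrier (P (dm f))" "phi g' \<in> carrier (P (dm f))"
          using phi_closed[of g] phi_closed[of g'] gg unfolding d(1,2) by blast+
        show "phi f \<in> carrier (P (dm f))" "phi f' \<in> carrier (P (dm f))"
          using phi_closed[of f] phi_closed[of f'] ff unfolding d(3) by blast+
      qed
      then show ?thesis by (simp only: phi.simps tdom.simps d(3))
    next
      case False
      then have "phi f = \<zero>\<^bsub>P 0\<^esub>" "phi f' = \<zero>\<^bsub>P 0\<^esub>"
        using phi_zero[of f 0] phi_zero[of f' 0] ff by auto
      then show ?thesis
        using gg P_mult_zero(1)[OF phi_closed[of g], of _ _ 0] P_mult_zero(1)[OF phi_closed[of g'], of _ _ 0]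
        by simp
    qed
  next
    case (cong_tens f f' g g')
    note ff = F.teq_wf[OF cong_tens.hyps(1)] and gg = F.teq_wf[OF cong_tens.hyps(2)]
    have "cls (dm f + dm g) (shift (dm f) (dm g) (phi f)) = cls (dm f + dm g) (shift (dm f) (dm g) (phi f'))"
      using cls_shift[OF cong_tens.IH(1)] phi_closed[of f] phi_closed[of f'] ff by simp
    moreover have "cls (dm f + dm g) (phi g) = cls (dm f + dm g) (phi g')"
      using cls_mono[OF cong_tens.IH(2)] phi_closed[of g] phi_closed[of g'] gg by simp
    ultimately have "cls (dm f + dm g) (shift (dm f) (dm g) (phi f) \<otimes>\<^bsub>P (dm f + dm g)\<^esub> phi g) =
        cls (dm f + dm g) (shift (dm f) (dm g) (phi f') \<otimes>\<^bsub>P (dm f + dm g)\<^esub> phi g')"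
      by (rule cls_mult)
        (use shift_phi[of f] shift_phi[of f'] phi_mono[of g] phi_mono[of g'] ff gg in simp_all)
    then show ?case using ff gg by simp
  next
    case (cong_add f f' g g')
    note ff = F.teq_wf[OF cong_add.hyps(1)] and gg = F.teq_wf[OF cong_add.hyps(2)]
    show ?case
      using cls_add[of "dm f" "phi f" "phi f'" "phi g" "phi g'"] cong_add.IH cong_add.hyps(3,4)
        phi_closed[of g] phi_closed[of g'] phi_closed[of f] phi_closed[of f'] gg ff by simp
  next
    case (cong_scale c f f')
    note ff = F.teq_wf[OF cong_scale.hyps(2)]
    show ?case
      using cls_scale[OF cong_scale.IH _ _ cong_scale.hyps(1)] phi_closed[of f] phi_closed[of f'] ff by simp
  next
    case (interchange g f g' f')
    then show ?case using phi_interchange[of g f g' f'] by simp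
  next
    case (tens_assoc f g h)
    then show ?case using phi_tens_assoc[of f g h] by simp
  next
    case (tens_id X Y)
    then show ?case
      using shift_props(5)[of "length X" "length Y"] ring.ring_simprules(12)[OF P_ring P_closed(4)]
      by (simp add: ops_indep(4)[of "length Y" "length X + length Y"])
  next
    case (tens_add_left f f' g)
    then have "phi (TTens (TAdd f f') g) = phi (TAdd (TTens f g) (TTens f' g))"
      using shift_props(3)[OF phi_closed[of f], of "phi f'" "dm g"] phi_closed[of f']
        ring.ring_simprules(13)[OF P_ring shift_phi[of f "dm g"], of "shift (dm f) (dm g) (phi f')" "phi g"]
        shift_phi[of f' "dm g"] phi_mono[of g "dm f"] by simp
    then show ?case by simp
  next
    case (tens_add_right f g g')
    then have "phi g' \<in> carrier (P (dm f + dm g))"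
      using phi_mono[of g' "dm f"] by simp
    with tens_add_right have "phi (TTens f (TAdd g g')) = phi (TAdd (TTens f g) (TTens f g'))"
      using ring.ring_simprules(23)[OF P_ring phi_mono[of g "dm f"] _ shift_phi[of f "dm g"], of "phi g'"]
      by (simp add: ops_indep(2)[where d="dm g'" and e="dm f + dm g'"])
    then show ?case by simp
  next
    case (tens_scale_left c f g)
    then have "phi (TTens (TScale c f) g) = phi (TScale c (TTens f g))"
      using shift_props(7)[OF _ phi_closed[of f], of c "dm g"]
        assoc_algebra.smult_mult_left[OF P_algebra _ shift_phi[of f "dm g"] phi_mono[of g "dm f"], of c] by simp
    then show ?case by simp
  next
    case (tens_scale_right c f g)
    then have "phi (TTens f (TScale c g)) = phi (TScale c (TTens f g))"
      using assoc_algebra.smult_mult_right[OF P_algebra _ shift_phi[of f "dm g"] phi_mono[of g "dm f"], of c]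
      by (simp add: ops_indep(3)[where d="dm g" and e="dm f + dm g"])
    then show ?case by simp
  next
    case (tens_unit_left f)
    then have "phi (TTens (TId []) f) = phi f"
      using shift_props(5)[of 0 "dm f"] ring.ring_simprules(12)[OF P_ring phi_closed[of f]] by simp
    then show ?case by simp
  next
    case (tens_unit_right f)
    then have "phi (TTens f (TId [])) = phi f"
      using shift_0[OF phi_closed[of f]] monoid.r_one[OF ring.is_monoid[OF P_ring] phi_closed[of f]]
      by (simp add: ops_indep(4)[of 0 "dm f"])
    then show ?case by simp
  next
    case (comp_assoc h g f)
    then show ?case
      by (intro arg_cong[where f = "cls _"]) (simp add: ops fun_eq_iff cring.conv_assoc[OF K] phi_val)
  next
    case (comp_id_left f)
    then show ?case
      by (intro arg_cong[where f = "cls _"]) (simp add: ops fun_eq_iff cring.conv_one_left[OF K] phi_val)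
  next
    case (comp_id_right f)
    then show ?case
      by (intro arg_cong[where f = "cls _"]) (simp add: ops fun_eq_iff cring.conv_one_right[OF K] phi_val)
  next
    case (comp_add_left g g' f)
    then show ?case
      by (intro arg_cong[where f = "cls _"]) (simp add: ops fun_eq_iff cring.conv_add_left[OF K] phi_val)
  next
    case (comp_add_right g f f')
    then show ?case
      by (intro arg_cong[where f = "cls _"]) (simp add: ops fun_eq_iff cring.conv_add_right[OF K] phi_val)
  next
    case (comp_scale_left c g f)
    then show ?case
      by (intro arg_cong[where f = "cls _"]) (simp add: ops fun_eq_iff cring.conv_scale_left[OF K] phi_val)
  next
    case (comp_scale_right c g f)
    then show ?case
      by (intro arg_cong[where f = "cls _"]) (simp add: ops fun_eq_iff cring.conv_scale_right[OF K] phi_val)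
  qed (rule arg_cong[where f = "cls _"];
    simp add: ops fun_eq_iff phi_val K.a_ac K.l_minus K.r_neg K.l_distr K.r_distr K.m_assoc)+
qed

text \<open>
  The value of a morphism of the free category lies in the ideal of relations. By \<open>phi_teq\<close> this does
  not depend on the representing term (\<open>vanishesD\<close>).
\<close>

definition vanishes :: "(unit, 'a aw_gen, 'k) mterm set \<Rightarrow> bool" where
  "vanishes M \<longleftrightarrow> (\<exists>f. F.represents M f \<and> phi f \<in> awp_ideal (dm f))"

lemma vanishesI: "F.represents M f \<Longrightarrow> phi f \<in> awp_ideal (dm f) \<Longrightarrow> vanishes M"
  unfolding vanishes_def by blast

lemma represents_twf: "F.represents M f \<Longrightarrow> twf K S f"
  by (simp add: F.represents_def)

lemma represents_Dom: "F.represents M f \<Longrightarrow> Dom F.F M = tdom S f"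
  and represents_Cod: "F.represents M f \<Longrightarrow> Cod F.F M = tcod S f"
  using F.represents_memI[of M f] by (auto simp: Hom_def)

lemma vanishesD:
  assumes "vanishes M" "F.represents M f"
  shows "phi f \<in> awp_ideal (dm f)"
proof -
  obtain g where g: "F.represents M g" "phi g \<in> awp_ideal (dm g)"
    using assms(1) by (auto simp: vanishes_def)
  have "teq K S g f"
    using F.tclass_eqD[of g f] g(1) assms(2) by (simp add: F.represents_def)
  then have d: "dm g = dm f" and eq: "cls (dm f) (phi g) = cls (dm f) (phi f)"
    using F.teq_wf[of g f] phi_teq[of g f] by auto
  have "phi g \<in> carrier (P (dm f))" "phi f \<in> carrier (P (dm f))"
    using phi_closed[OF represents_twf[OF g(1)]] phi_closed[OF represents_twf[OF assms(2)]] d by simp_all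
  then show ?thesis
    using cls_zero_iff[of "phi g" "dm f"] cls_zero_iff[of "phi f" "dm f"] g(2) d eq by simp
qed

lemma phi_diff:
  assumes "twf K S f" "twf K S g" "tdom S f = tdom S g"
  shows "phi (TAdd f (TScale (\<ominus>\<^bsub>K\<^esub> \<one>\<^bsub>K\<^esub>) g)) = phi f \<ominus>\<^bsub>P (dm f)\<^esub> phi g"
proof -
  interpret M: module K "P (dm g)" by (rule assoc_algebra_module[OF P_algebra])
  have "(\<ominus>\<^bsub>K\<^esub> \<one>\<^bsub>K\<^esub>) \<odot>\<^bsub>P (dm g)\<^esub> phi g = \<ominus>\<^bsub>P (dm g)\<^esub> phi g"
    using M.smult_l_minus[OF M.R.one_closed phi_closed[OF assms(2)]] M.smult_one[OF phi_closed[OF assms(2)]]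
    by simp
  then show ?thesis using assms(3) by (simp add: a_minus_def)
qed

lemma represents_diff:
  assumes "F.represents M f" "F.represents N g" "tdom S f = tdom S g" "tcod S f = tcod S g"
  shows "F.represents (DiffM K F.F M N) (TAdd f (TScale (\<ominus>\<^bsub>K\<^esub> \<one>\<^bsub>K\<^esub>) g))"
  unfolding DiffM_def using assms
  by (intro F.represents_add F.represents_scale F.minus_one_closed) simp_all

lemma vanishes_diff:
  assumes "F.represents M f" "F.represents N g" "tdom S f = tdom S g" "tcod S f = tcod S g"
    and "cls (dm f) (phi f) = cls (dm f) (phi g)"
  shows "vanishes (DiffM K F.F M N)"
proof (rule vanishesI[OF represents_diff[OF assms(1-4)]])
  have f: "twf K S f" and g: "twf K S g" using assms(1,2) represents_twf by blast+
  have "phi g \<in> carrier (P (dm f))" using phi_closed[OF g] assms(3) by simp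
  then have "phi f \<ominus>\<^bsub>P (dm f)\<^esub> phi g \<in> awp_ideal (dm f)"
    using cls_eq_iff[OF phi_closed[OF f], of "phi g"] assms(5) by simp
  then show "phi (TAdd f (TScale (\<ominus>\<^bsub>K\<^esub> \<one>\<^bsub>K\<^esub>) g)) \<in> awp_ideal (dm (TAdd f (TScale (\<ominus>\<^bsub>K\<^esub> \<one>\<^bsub>K\<^esub>) g)))"
    by (simp only: phi_diff[OF f g assms(3)] tdom.simps)
qed

lemma phi_tens_id_right: "twf K S f \<Longrightarrow> phi (TTens f (TId X)) = shift (dm f) (length X) (phi f)"
  using monoid.r_one[OF ring.is_monoid[OF P_ring] shift_phi[of f "length X"]]
  by (simp add: ops_indep(4)[of "length X" "dm f + length X"])

lemma phi_tens_id_left: "twf K S f \<Longrightarrow> phi (TTens (TId X) f) = phi f"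
  using ring.ring_simprules(12)[OF P_ring phi_mono[of f "length X"]]
    shift_props(5)[of "length X" "dm f"] by simp

lemma represents_gen: "y \<in> Gens S \<Longrightarrow> F.represents (free_cat_gen K S y) (TGen y)"
  unfolding free_cat_gen_def by (rule F.represents_tclass) simp

lemma gens_S: "Gen_s \<in> Gens S" "Gen_x \<in> Gens S" "a \<in> carrier A \<Longrightarrow> Gen_beta a \<in> Gens S"
  by (auto simp: aw_sig_def)

lemma gens_dom:
  "Src S Gen_s = up @ up" "Src S Gen_x = up" "Src S (Gen_beta a) = up"
  "Tgt S Gen_s = up @ up" "Tgt S Gen_x = up" "Tgt S (Gen_beta a) = up"
  by (simp_all add: aw_sig_def)

lemma phi_strands:
  "phi (TTens (TGen Gen_s) (TId up)) = s 2" "phi (TTens (TId up) (TGen Gen_s)) = s 1"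
  "phi (TTens (TGen Gen_x) (TId up)) = t 2" "phi (TTens (TId up) (TGen Gen_x)) = t 1"
  "a \<in> carrier A \<Longrightarrow> phi (TTens (TGen (Gen_beta a)) (TId up)) = u 2 a"
  "a \<in> carrier A \<Longrightarrow> phi (TTens (TId up) (TGen (Gen_beta a))) = u 1 a"
proof -
  show "phi (TTens (TGen Gen_s) (TId up)) = s 2"
    using shift_gens(3)[of 1 2 1] by (simp add: phi_tens_id_right gens_S gens_dom numeral_2_eq_2 del: phi.simps(4))
  show "phi (TTens (TGen Gen_x) (TId up)) = t 2"
    using shift_gens(1)[of 1 1 1] by (simp add: phi_tens_id_right gens_S gens_dom numeral_2_eq_2 del: phi.simps(4))
  show "phi (TTens (TGen (Gen_beta a)) (TId up)) = u 2 a" if "a \<in> carrier A"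
    using that shift_gens(2)[of 1 1 a 1]
    by (simp add: phi_tens_id_right gens_S gens_dom numeral_2_eq_2 del: phi.simps(4))
  show "phi (TTens (TId up) (TGen Gen_s)) = s 1" "phi (TTens (TId up) (TGen Gen_x)) = t 1"
    by (simp_all add: phi_tens_id_left gens_S del: phi.simps(4))
  show "phi (TTens (TId up) (TGen (Gen_beta a))) = u 1 a" if "a \<in> carrier A"
    using that by (simp add: phi_tens_id_left gens_S del: phi.simps(4))
qed

lemma phi_tokens:
  assumes "a \<in> carrier A" "b \<in> carrier A"
  shows "phi (TTens (TGen (Gen_beta a)) (TGen (Gen_beta b))) = u 2 a \<otimes>\<^bsub>P 2\<^esub> u 1 b"
  using shift_gens(2)[of 1 1 a 1] assms(1) by (simp add: gens_dom numeral_2_eq_2)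

lemma free_lmc: "lin_mon_category K F.F"
  by (rule F.free_lin_mon_category)

text \<open>
  The sum over the basis is formed in an endomorphism algebra of the free category; a term representing
  it is built up summand by summand.
\<close>

lemma teleporter_represented:
  assumes "finite T" "T \<subseteq> B"
  shows "\<exists>f. F.represents (\<Oplus>\<^bsub>End_algebra F.F (up @ up)\<^esub>b\<in>T.
        free_cat_gen K S (Gen_beta b) \<boxtimes>\<^bsub>F.F\<^esub> free_cat_gen K S (Gen_beta (dual b))) f \<and>
      tdom S f = up @ up \<and> tcod S f = up @ up \<and> phi f = (\<Oplus>\<^bsub>P 2\<^esub>b\<in>T. u 2 b \<otimes>\<^bsub>P 2\<^esub> u 1 (dual b))"
proof -
  let ?E = "End_algebra F.F (up @ up)"
  interpret E: ring ?E by (rule assoc_algebra_ring[OF lin_mon_category.End_assoc_algebra[OF free_lmc]])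
  interpret PR: ring "P 2" by (rule P_ring)
  let ?M = "\<lambda>b. free_cat_gen K S (Gen_beta b) \<boxtimes>\<^bsub>F.F\<^esub> free_cat_gen K S (Gen_beta (dual b))"
  let ?p = "\<lambda>b. u 2 b \<otimes>\<^bsub>P 2\<^esub> u 1 (dual b)"
  let ?g = "\<lambda>b. TTens (TGen (Gen_beta b)) (TGen (Gen_beta (dual b)))"
  have Bc: "b \<in> carrier A" "dual b \<in> carrier A" if "b \<in> B" for b
    using that B by auto
  have g: "F.represents (?M b) (?g b)" if "b \<in> B" for b
    by (intro F.represents_tens represents_gen gens_S Bc[OF that])
  have gd: "tdom S (?g b) = up @ up" "tcod S (?g b) = up @ up" for b
    by (simp_all add: gens_dom)
  have Mc: "?M b \<in> carrier ?E" if "b \<in> B" for b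
    using F.represents_memI[OF g[OF that] gd] by (simp add: End_algebra_def)
  have pc: "?p b \<in> carrier (P 2)" if "b \<in> B" for b
    using gen_closed(2)[of 2 2 b] gen_closed(2)[of 1 2 "dual b"] Bc[OF that] by (intro P_closed(1)) simp_all
  show ?thesis
    using assms
  proof (induction T rule: finite_induct)
    case empty
    show ?case
      unfolding E.finsum_empty PR.finsum_empty
      by (intro exI[of _ "TZero (up @ up) (up @ up)"])
        (use F.represents_zero[of "up @ up" "up @ up"] in
          \<open>simp add: End_algebra_def[of F.F] free_algebra_simps(4)\<close>)
  next
    case (insert b T)
    then obtain f where f: "F.represents (\<Oplus>\<^bsub>?E\<^esub>b\<in>T. ?M b) f" "tdom S f = up @ up" "tcod S f = up @ up"
      "phi f = (\<Oplus>\<^bsub>P 2\<^esub>b\<in>T. ?p b)" by auto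
    have "(\<Oplus>\<^bsub>?E\<^esub>b\<in>insert b T. ?M b) = AddM F.F (?M b) (\<Oplus>\<^bsub>?E\<^esub>b\<in>T. ?M b)"
      using insert Mc by (subst E.finsum_insert) (auto simp: End_algebra_def)
    moreover have "F.represents (AddM F.F (?M b) (\<Oplus>\<^bsub>?E\<^esub>b\<in>T. ?M b)) (TAdd (?g b) f)"
      using insert g gd f by (intro F.represents_add) auto
    moreover have "phi (TAdd (?g b) f) = (\<Oplus>\<^bsub>P 2\<^esub>b\<in>insert b T. ?p b)"
    proof -
      have "dm (?g b) = 2" by (simp add: gens_dom)
      then have "phi (TAdd (?g b) f) = ?p b \<oplus>\<^bsub>P 2\<^esub> (\<Oplus>\<^bsub>P 2\<^esub>b\<in>T. ?p b)"
        using phi_tokens[of b "dual b"] Bc[of b] insert by (simp only: phi.simps(6) f(4)) simp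
      also have "\<dots> = (\<Oplus>\<^bsub>P 2\<^esub>b\<in>insert b T. ?p b)"
        using insert pc by (subst PR.finsum_insert) auto
      finally show ?thesis .
    qed
    ultimately show ?case using gd
      by (intro exI[of _ "TAdd (?g b) f"] conjI) (simp_all only: tdom.simps tcod.simps)
  qed
qed

text \<open>
  The form in which the defining relations of the category are matched with those of the algebra.
\<close>

lemma vanishes_relI:
  assumes f: "F.represents M f" and g: "F.represents N g"
    and dom: "tdom S f = tdom S g" "tcod S f = tcod S g" and d: "dm f = d"
    and phi: "phi f = p" "phi g = q" and rel: "p \<ominus>\<^bsub>P d\<^esub> q \<in> R d"
  shows "vanishes (DiffM K F.F M N)"
proof (rule vanishes_diff[OF f g dom])
  have "p \<in> carrier (P d)" "q \<in> carrier (P d)"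
    using phi_closed[OF represents_twf[OF f]] phi_closed[OF represents_twf[OF g]] dom d phi by auto
  then show "cls (dm f) (phi f) = cls (dm f) (phi g)"
    using cls_relI[OF rel] phi d by simp
qed

text \<open>
  Each defining relation of the category has as its value a defining relation of the affine wreath
  product algebra on one, two or three strands, up to sign.
\<close>

lemma relations_vanish: "M \<in> aw_relations K A B dual \<Longrightarrow> vanishes M"
proof -
  have idx: "(1::nat) \<in> {1..<2}" "(1::nat) \<in> {1..2}" "(2::nat) \<in> {1..2}" "(1::nat) \<in> {1..1}"
    by simp_all
  note rel = awp_satD[OF relations_sat]
  note dom = gens_dom tdom.simps tcod.simps
  note val = phi.simps(1-3,5-7) phi_strands aw_gen.case free_algebra_simps(2,3,5,6)
  note id = F.represents_Ident[of up] and tens = F.represents_tens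
  note gens = represents_gen[OF gens_S(1)] represents_gen[OF gens_S(2)] represents_gen[OF gens_S(3)]
  note sl = tens[OF gens(1) id] and sr = tens[OF id gens(1)]
  note xl = tens[OF gens(2) id] and xr = tens[OF id gens(2)]
  note bl = tens[OF gens(3) id] and br = tens[OF id gens(3)]
  assume "M \<in> aw_relations K A B dual"
  then show ?thesis
    unfolding aw_relations_def Let_def
  proof (elim UnE CollectE singletonE exE conjE; hypsubst)
    have r: "s 1 \<otimes>\<^bsub>P 2\<^esub> s 1 \<ominus>\<^bsub>P 2\<^esub> \<one>\<^bsub>P 2\<^esub> \<in> R 2" by (rule rel(2)[OF idx(1)])
    show "vanishes (DiffM K F.F (free_cat_gen K S Gen_s \<cdot>\<^bsub>F.F\<^esub> free_cat_gen K S Gen_s) (Ident F.F (up @ up)))"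
      by (rule vanishes_relI[OF F.represents_comp[OF gens(1) gens(1)] F.represents_Ident _ _ _ _ _ r])
        (simp_all add: dom val del: phi.simps(4))
  next
    let ?l = "free_cat_gen K S Gen_s \<boxtimes>\<^bsub>F.F\<^esub> Ident F.F up" and ?r = "Ident F.F up \<boxtimes>\<^bsub>F.F\<^esub> free_cat_gen K S Gen_s"
    have r: "s 2 \<otimes>\<^bsub>P 3\<^esub> s 1 \<otimes>\<^bsub>P 3\<^esub> s 2 \<ominus>\<^bsub>P 3\<^esub> s 1 \<otimes>\<^bsub>P 3\<^esub> s 2 \<otimes>\<^bsub>P 3\<^esub> s 1 \<in> R 3"
      using rel(3)[of 1 3] by (simp only: one_add_one)
    show "vanishes (DiffM K F.F (?l \<cdot>\<^bsub>F.F\<^esub> ?r \<cdot>\<^bsub>F.F\<^esub> ?l) (?r \<cdot>\<^bsub>F.F\<^esub> ?l \<cdot>\<^bsub>F.F\<^esub> ?r))"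
      by (rule vanishes_relI[OF F.represents_comp[OF F.represents_comp[OF sl sr] sl]
            F.represents_comp[OF F.represents_comp[OF sr sl] sr] _ _ _ _ _ r])
        (simp_all add: dom val del: phi.simps(4))
  next
    fix c c' a b
    assume c: "c \<in> carrier K" "c' \<in> carrier K" and ab: "a \<in> carrier A" "b \<in> carrier A"
    show "vanishes (DiffM K F.F (free_cat_gen K S (Gen_beta (c \<odot>\<^bsub>A\<^esub> a \<oplus>\<^bsub>A\<^esub> c' \<odot>\<^bsub>A\<^esub> b)))
        (AddM F.F (ScaleM F.F c (free_cat_gen K S (Gen_beta a))) (ScaleM F.F c' (free_cat_gen K S (Gen_beta b)))))"
      by (rule vanishes_relI[OF gens(3)[OF A_closed(1)[OF c ab]]
            F.represents_add[OF F.represents_scale[OF c(1) gens(3)[OF ab(1)]] F.represents_scale[OF c(2) gens(3)[OF ab(2)]]] _ _ _ _ _ rel(6)[OF idx(4) c ab]])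
        (simp_all add: dom val del: phi.simps(4))
  next
    fix a b
    assume ab: "a \<in> carrier A" "b \<in> carrier A"
    show "vanishes (DiffM K F.F (free_cat_gen K S (Gen_beta a) \<cdot>\<^bsub>F.F\<^esub> free_cat_gen K S (Gen_beta b))
        (free_cat_gen K S (Gen_beta (a \<otimes>\<^bsub>A\<^esub> b))))"
      by (rule vanishes_relI[OF F.represents_comp[OF gens(3)[OF ab(1)] gens(3)[OF ab(2)]]
            gens(3)[OF A_closed(2)[OF ab]] _ _ _ _ _ rel(7)[OF idx(4) ab]])
        (simp_all add: dom val del: phi.simps(4))
  next
    show "vanishes (DiffM K F.F (free_cat_gen K S (Gen_beta \<one>\<^bsub>A\<^esub>)) (Ident F.F up))"
      by (rule vanishes_relI[OF gens(3)[OF A_closed(3)] F.represents_Ident _ _ _ _ _ rel(8)[OF idx(4)]])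
        (simp_all add: dom val del: phi.simps(4))
  next
    fix a
    assume a: "a \<in> carrier A"
    have "transpose 1 (1 + 1) 2 = (1::nat)" by (simp add: transpose_def)
    then have r: "s 1 \<otimes>\<^bsub>P 2\<^esub> u 2 a \<ominus>\<^bsub>P 2\<^esub> u 1 a \<otimes>\<^bsub>P 2\<^esub> s 1 \<in> R 2"
      using rel(10)[OF idx(1) idx(3) a] by (simp only:)
    show "vanishes (DiffM K F.F
        (free_cat_gen K S Gen_s \<cdot>\<^bsub>F.F\<^esub> (free_cat_gen K S (Gen_beta a) \<boxtimes>\<^bsub>F.F\<^esub> Ident F.F up))
        ((Ident F.F up \<boxtimes>\<^bsub>F.F\<^esub> free_cat_gen K S (Gen_beta a)) \<cdot>\<^bsub>F.F\<^esub> free_cat_gen K S Gen_s))"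
      by (rule vanishes_relI[OF F.represents_comp[OF gens(1) bl[OF a]]
            F.represents_comp[OF br[OF a] gens(1)] _ _ _ _ _ r])
        (simp_all add: dom val a del: phi.simps(4))
  next
    let ?L = "TComp (TTens (TGen Gen_x) (TId up)) (TGen Gen_s)"
      and ?R = "TComp (TGen Gen_s) (TTens (TId up) (TGen Gen_x))"
    let ?sum = "\<Oplus>\<^bsub>End_algebra F.F (up @ up)\<^esub>b\<in>B. free_cat_gen K S (Gen_beta b) \<boxtimes>\<^bsub>F.F\<^esub> free_cat_gen K S (Gen_beta (dual b))"
    let ?m = "\<Oplus>\<^bsub>P 2\<^esub>b\<in>B. u 2 b \<otimes>\<^bsub>P 2\<^esub> u 1 (dual b)"
    have dLR: "tdom S ?L = up @ up" "tdom S ?R = up @ up" "tcod S ?L = up @ up" "tcod S ?R = up @ up"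
      by (simp_all add: dom)
    note L = F.represents_comp[OF xl gens(1)] and R = F.represents_comp[OF gens(1) xr]
    obtain f where f: "F.represents ?sum f" "tdom S f = up @ up" "tcod S f = up @ up" "phi f = ?m"
      using teleporter_represented[OF B(1) subset_refl] by blast
    have vals: "phi ?L = t 2 \<otimes>\<^bsub>P 2\<^esub> s 1" "phi ?R = s 1 \<otimes>\<^bsub>P 2\<^esub> t 1"
      by (simp_all add: val del: phi.simps(4))
    have r: "t 2 \<otimes>\<^bsub>P 2\<^esub> s 1 \<ominus>\<^bsub>P 2\<^esub> s 1 \<otimes>\<^bsub>P 2\<^esub> t 1 \<ominus>\<^bsub>P 2\<^esub> ?m \<in> R 2"
      using rel(12)[OF idx(1)] by (simp only: one_add_one)
    have "phi (TAdd ?L (TScale (\<ominus>\<^bsub>K\<^esub> \<one>\<^bsub>K\<^esub>) ?R)) = phi ?L \<ominus>\<^bsub>P (dm ?L)\<^esub> phi ?R"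
      using phi_diff[of ?L ?R] by (simp add: gens_S dom del: phi.simps)
    also have "dm ?L = 2" by (simp only: dLR) simp
    finally have "phi (TAdd ?L (TScale (\<ominus>\<^bsub>K\<^esub> \<one>\<^bsub>K\<^esub>) ?R)) = t 2 \<otimes>\<^bsub>P 2\<^esub> s 1 \<ominus>\<^bsub>P 2\<^esub> s 1 \<otimes>\<^bsub>P 2\<^esub> t 1"
      unfolding vals .
    from vanishes_relI[OF represents_diff[OF L R] f(1) _ _ _ this f(4) r]
    show "vanishes (DiffM K F.F (DiffM K F.F
        ((free_cat_gen K S Gen_x \<boxtimes>\<^bsub>F.F\<^esub> Ident F.F up) \<cdot>\<^bsub>F.F\<^esub> free_cat_gen K S Gen_s)
        (free_cat_gen K S Gen_s \<cdot>\<^bsub>F.F\<^esub> (Ident F.F up \<boxtimes>\<^bsub>F.F\<^esub> free_cat_gen K S Gen_x))) ?sum)"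
      by (simp add: dom f(2,3))
  next
    fix a
    assume a: "a \<in> carrier A"
    have "cls 1 (t 1 \<otimes>\<^bsub>P 1\<^esub> u 1 a) = cls 1 (u 1 a \<otimes>\<^bsub>P 1\<^esub> t 1)"
      by (rule cls_relI[OF rel(11)[OF idx(4) idx(4) a]]; intro P_closed gen_closed idx a)
    then show "vanishes (DiffM K F.F (free_cat_gen K S (Gen_beta a) \<cdot>\<^bsub>F.F\<^esub> free_cat_gen K S Gen_x)
        (free_cat_gen K S Gen_x \<cdot>\<^bsub>F.F\<^esub> free_cat_gen K S (Gen_beta a)))"
      by (intro vanishes_diff[OF F.represents_comp[OF gens(3)[OF a] gens(2)] F.represents_comp[OF gens(2) gens(3)[OF a]]])
        (simp_all add: dom)
  qed
qed

text \<open>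
  The vanishing morphisms are closed under the operations that generate a tensor ideal: composition by
  the ideal property, and tensor products because relations persist when strands are added on either
  side.
\<close>

lemma ideal_vanishes: "M \<in> aw_ideal K A B dual \<Longrightarrow> vanishes M"
  unfolding aw_ideal_def
proof (induction rule: gen_tensor_ideal.induct)
  case (rel M)
  then show ?case by (rule relations_vanish)
next
  case (zero X Y)
  have "\<zero>\<^bsub>P (length X)\<^esub> \<in> awp_ideal (length X)"
    by (rule additive_subgroup.zero_closed[OF ideal.axioms(1)[OF awp_ideal_ideal]])
  then show ?case by (intro vanishesI[OF F.represents_zero]) simp
next
  case (add M N)
  then obtain f g where f: "F.represents M f" "phi f \<in> awp_ideal (dm f)"
    and g: "F.represents N g" "phi g \<in> awp_ideal (dm g)" by (auto simp: vanishes_def)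
  have d: "tdom S f = tdom S g" "tcod S f = tcod S g"
    using add(3,4) f(1) g(1) by (simp_all add: represents_Dom represents_Cod)
  show ?case
    by (rule vanishesI[OF F.represents_add[OF f(1) g(1) d]])
      (use f(2) g(2) d additive_subgroup.a_closed[OF ideal.axioms(1)[OF awp_ideal_ideal], of _ "dm f"] in simp)
next
  case (scale c M)
  then obtain f where f: "F.represents M f" "phi f \<in> awp_ideal (dm f)" by (auto simp: vanishes_def)
  let ?d = "dm f"
  have fc: "phi f \<in> carrier (P ?d)" by (rule phi_closed[OF represents_twf[OF f(1)]])
  have "c \<odot>\<^bsub>P ?d\<^esub> phi f = (c \<odot>\<^bsub>P ?d\<^esub> \<one>\<^bsub>P ?d\<^esub>) \<otimes>\<^bsub>P ?d\<^esub> phi f"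
    using assoc_algebra.smult_mult_left[OF P_algebra scale(1) P_closed(4) fc] ring.ring_simprules(12)[OF P_ring fc]
    by simp
  also have "\<dots> \<in> awp_ideal ?d"
    by (rule ideal.I_l_closed[OF awp_ideal_ideal f(2) P_closed(6)[OF scale(1) P_closed(4)]])
  finally show ?case by (intro vanishesI[OF F.represents_scale[OF scale(1) f(1)]]) simp
next
  case (comp_left M N)
  then obtain f where f: "F.represents M f" "phi f \<in> awp_ideal (dm f)" by (auto simp: vanishes_def)
  obtain g where g: "twf K S g" "F.represents N g"
    by (rule F.represents_memE[OF HomI[OF comp_left(2)]])
  have d: "tdom S g = tcod S f"
    using comp_left(3) f(1) g(2) by (simp add: represents_Dom represents_Cod)
  have "phi g \<otimes>\<^bsub>P (dm f)\<^esub> phi f \<in> awp_ideal (dm f)"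
  proof (cases "cd f = dm f")
    case True
    then show ?thesis using ideal.I_l_closed[OF awp_ideal_ideal f(2)] phi_closed[OF g(1)] d by simp
  next
    case False
    then have "phi g \<otimes>\<^bsub>P (dm f)\<^esub> phi f = phi f"
      using phi_zero[OF represents_twf[OF f(1)] False, of 0] P_mult_zero(1)[OF phi_closed[OF g(1)], of _ 0 0] by simp
    then show ?thesis using f(2) by simp
  qed
  then show ?case by (intro vanishesI[OF F.represents_comp[OF g(2) f(1) d]]) simp
next
  case (comp_right M N)
  then obtain f where f: "F.represents M f" "phi f \<in> awp_ideal (dm f)" by (auto simp: vanishes_def)
  obtain g where g: "twf K S g" "F.represents N g"
    by (rule F.represents_memE[OF HomI[OF comp_right(2)]])
  have d: "tdom S f = tcod S g"
    using comp_right(3) f(1) g(2) by (simp add: represents_Dom represents_Cod)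
  have "phi f \<otimes>\<^bsub>P (dm g)\<^esub> phi g \<in> awp_ideal (dm g)"
  proof (cases "cd g = dm g")
    case True
    then show ?thesis using ideal.I_r_closed[OF awp_ideal_ideal f(2)] phi_closed[OF g(1)] d by simp
  next
    case False
    then have "phi f \<otimes>\<^bsub>P (dm g)\<^esub> phi g = \<zero>\<^bsub>P (dm g)\<^esub>"
      using phi_zero[OF g(1) False, of 0] P_mult_zero(1)[OF phi_closed[OF represents_twf[OF f(1)]], of _ 0] by simp
    then show ?thesis
      using additive_subgroup.zero_closed[OF ideal.axioms(1)[OF awp_ideal_ideal]] by simp
  qed
  then show ?case by (intro vanishesI[OF F.represents_comp[OF f(1) g(2) d]]) simp
next
  case (tens_left M N)
  then obtain f where f: "F.represents M f" "phi f \<in> awp_ideal (dm f)" by (auto simp: vanishes_def)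
  obtain g where g: "twf K S g" "F.represents N g"
    by (rule F.represents_memE[OF HomI[OF tens_left(2)]])
  have "phi f \<in> awp_ideal (dm g + dm f)" by (rule awp_ideal_mono[OF _ f(2)]) simp
  then have "shift (dm g) (dm f) (phi g) \<otimes>\<^bsub>P (dm g + dm f)\<^esub> phi f \<in> awp_ideal (dm g + dm f)"
    by (rule ideal.I_l_closed[OF awp_ideal_ideal _ shift_phi[OF g(1)]])
  then show ?case by (intro vanishesI[OF F.represents_tens[OF g(2) f(1)]]) simp
next
  case (tens_right M N)
  then obtain f where f: "F.represents M f" "phi f \<in> awp_ideal (dm f)" by (auto simp: vanishes_def)
  obtain g where g: "twf K S g" "F.represents N g"
    by (rule F.represents_memE[OF HomI[OF tens_right(2)]])
  have "shift (dm f) (dm g) (phi f) \<otimes>\<^bsub>P (dm f + dm g)\<^esub> phi g \<in> awp_ideal (dm f + dm g)"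
    by (rule ideal.I_r_closed[OF awp_ideal_ideal shift_ideal[OF f(2)] phi_mono[OF g(1)]])
  then show ?case by (intro vanishesI[OF F.represents_tens[OF f(1) g(2)]]) simp
qed

section \<open>Affine wreath product algebras as endomorphism algebras\<close>

lemma quotient_interpretation: "tensor_quotient K F.F (aw_relations K A B dual)"
proof (intro tensor_quotient.intro tensor_quotient_axioms.intro F.free_lin_mon_category subsetI)
  fix M assume "M \<in> aw_relations K A B dual"
  then obtain f where "F.represents M f" using relations_vanish by (auto simp: vanishes_def)
  then show "M \<in> Mor F.F" by (rule Hom_Mor[OF F.represents_memI[OF _ HOL.refl HOL.refl]])
qed

interpretation Q: tensor_quotient K F.F "aw_relations K A B dual"
  by (rule quotient_interpretation)

abbreviation AWC where "AWC \<equiv> AW K A B dual"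
abbreviation gen where "gen y \<equiv> AW_gen K A B dual y"
abbreviation fgen where "fgen y \<equiv> free_cat_gen K S y"

lemma AW_eq: "AWC = Q.Q"
  by (simp add: AW_def aw_ideal_def)

lemma AW_gen_eq: "gen y = Q.qc (fgen y)"
  by (simp add: AW_gen_def aw_ideal_def)

lemma AW_lin_mon_category: "lin_mon_category K AWC"
  unfolding AW_eq by (rule Q.quot_lin_mon_category)

lemma AW_objects: "UnitO AWC = []" "TensO AWC X Y = X @ Y"
  by (simp_all add: AW_eq Q.quot_simps(1,2) F.free_simps)

text \<open>
  An expression in the quotient category is represented by the same expression in the free category.
  As the objects are lists, the rules in \<open>lifts_ops\<close> may identify differently bracketed tensor products
  of objects.
\<close>

definition lifts :: "(unit, 'a aw_gen, 'k) mterm set set \<Rightarrow> (unit, 'a aw_gen, 'k) mterm set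
    \<Rightarrow> unit list \<Rightarrow> unit list \<Rightarrow> bool" where
  "lifts F M X Y \<longleftrightarrow> Q.represents F M X Y"

lemma lifts_Hom: "lifts F M X Y \<Longrightarrow> F \<in> Hom AWC X Y"
  unfolding lifts_def AW_eq by (rule Q.represents_memI)

text \<open>
  Defining relations become equalities in the quotient.
\<close>

lemma lifts_eqI: "lifts F M X Y \<Longrightarrow> lifts G N X Y \<Longrightarrow> DiffM K F.F M N \<in> aw_relations K A B dual \<Longrightarrow> F = G"
  unfolding lifts_def Q.represents_def using Q.quot_rel_zero by blast

lemma lifts_gen:
  assumes "y \<in> Gens S" "X = Src S y" "Y = Tgt S y"
  shows "lifts (gen y) (fgen y) X Y"
  using F.represents_memI[OF represents_gen[OF assms(1)]] assms(2,3)
  by (simp add: lifts_def Q.represents_def AW_gen_eq)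

lemma lifts_gens:
  "lifts (gen Gen_s) (fgen Gen_s) (up @ up) (up @ up)" "lifts (gen Gen_x) (fgen Gen_x) up up"
  "a \<in> carrier A \<Longrightarrow> lifts (gen (Gen_beta a)) (fgen (Gen_beta a)) up up"
  by (simp_all add: lifts_gen gens_S gens_dom)

lemma lifts_ops:
  "lifts (Ident AWC X) (Ident F.F X) X X"
  "lifts (ZeroM AWC X Y) (ZeroM F.F X Y) X Y"
  "lifts G N Y Z \<Longrightarrow> lifts F M X Y' \<Longrightarrow> Y = Y' \<Longrightarrow> lifts (G \<cdot>\<^bsub>AWC\<^esub> F) (N \<cdot>\<^bsub>F.F\<^esub> M) X Z"
  "lifts G N X Y \<Longrightarrow> lifts F M X' Y' \<Longrightarrow> X @ X' = X'' \<Longrightarrow> Y @ Y' = Y'' \<Longrightarrow>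
    lifts (G \<boxtimes>\<^bsub>AWC\<^esub> F) (N \<boxtimes>\<^bsub>F.F\<^esub> M) X'' Y''"
  "lifts G N X Y \<Longrightarrow> lifts F M X Y \<Longrightarrow> lifts (AddM AWC G F) (AddM F.F N M) X Y"
  "c \<in> carrier K \<Longrightarrow> lifts F M X Y \<Longrightarrow> lifts (ScaleM AWC c F) (ScaleM F.F c M) X Y"
  "lifts G N X Y \<Longrightarrow> lifts F M X Y \<Longrightarrow> lifts (DiffM K AWC G F) (DiffM K F.F N M) X Y"
proof -
  show "lifts (Ident AWC X) (Ident F.F X) X X" "lifts (ZeroM AWC X Y) (ZeroM F.F X Y) X Y"
    unfolding lifts_def AW_eq by (rule Q.represents_Ident Q.represents_zero)+
  show "lifts G N Y Z \<Longrightarrow> lifts F M X Y' \<Longrightarrow> Y = Y' \<Longrightarrow> lifts (G \<cdot>\<^bsub>AWC\<^esub> F) (N \<cdot>\<^bsub>F.F\<^esub> M) X Z"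
    unfolding lifts_def AW_eq by (hypsubst, rule Q.represents_comp)
  show "lifts G N X Y \<Longrightarrow> lifts F M X' Y' \<Longrightarrow> X @ X' = X'' \<Longrightarrow> Y @ Y' = Y'' \<Longrightarrow>
    lifts (G \<boxtimes>\<^bsub>AWC\<^esub> F) (N \<boxtimes>\<^bsub>F.F\<^esub> M) X'' Y''"
    using Q.represents_tens[of G N X Y F M X' Y'] unfolding lifts_def AW_eq F.free_simps by simp
  show add: "lifts G N X Y \<Longrightarrow> lifts F M X Y \<Longrightarrow> lifts (AddM AWC G F) (AddM F.F N M) X Y" for F G M N
    unfolding lifts_def AW_eq by (rule Q.represents_add)
  show scale: "c \<in> carrier K \<Longrightarrow> lifts F M X Y \<Longrightarrow> lifts (ScaleM AWC c F) (ScaleM F.F c M) X Y" for c F M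
    unfolding lifts_def AW_eq by (rule Q.represents_scale)
  show "lifts G N X Y \<Longrightarrow> lifts F M X Y \<Longrightarrow> lifts (DiffM K AWC G F) (DiffM K F.F N M) X Y"
    unfolding DiffM_def by (intro add scale F.minus_one_closed)
qed

lemma lifts_sum:
  assumes "finite T" "\<And>b. b \<in> T \<Longrightarrow> lifts (f b) (g b) X X"
  shows "lifts (\<Oplus>\<^bsub>End_algebra AWC X\<^esub>b\<in>T. f b) (\<Oplus>\<^bsub>End_algebra F.F X\<^esub>b\<in>T. g b) X X"
proof -
  interpret E: ring "End_algebra AWC X"
    by (rule assoc_algebra_ring[OF lin_mon_category.End_assoc_algebra[OF AW_lin_mon_category]])
  interpret E': ring "End_algebra F.F X"
    by (rule assoc_algebra_ring[OF lin_mon_category.End_assoc_algebra[OF F.free_lin_mon_category]])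
  show ?thesis
    using assms
  proof (induction rule: finite_induct)
    case empty
    show ?case unfolding E.finsum_empty E'.finsum_empty using lifts_ops(2) by (simp add: End_algebra_def[of _ X])
  next
    case (insert b T)
    have f: "f c \<in> carrier (End_algebra AWC X)" and g: "g c \<in> carrier (End_algebra F.F X)"
      if "c \<in> insert b T" for c
      using lifts_Hom[OF insert(4)[OF that]] insert(4)[OF that]
      by (simp_all add: End_algebra_def lifts_def Q.represents_def)
    have "(\<Oplus>\<^bsub>End_algebra AWC X\<^esub>b\<in>insert b T. f b) = AddM AWC (f b) (\<Oplus>\<^bsub>End_algebra AWC X\<^esub>b\<in>T. f b)"
      using f insert(1,2) by (subst E.finsum_insert) (auto simp: End_algebra_def)
    moreover have "(\<Oplus>\<^bsub>End_algebra F.F X\<^esub>b\<in>insert b T. g b) = AddM F.F (g b) (\<Oplus>\<^bsub>End_algebra F.F X\<^esub>b\<in>T. g b)"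
      using g insert(1,2) by (subst E'.finsum_insert) (auto simp: End_algebra_def)
    ultimately show ?case
      using lifts_ops(5)[OF insert(4)[of b] insert.IH] insert(4) by simp
  qed
qed

theorem AW_affine_wreath_category:
  "affine_wreath_category K AWC A B dual up (gen Gen_s) (\<lambda>a. gen (Gen_beta a)) (gen Gen_x)"
proof (intro affine_wreath_category.intro affine_wreath_category_axioms.intro AW_lin_mon_category,
    unfold AW_objects)
  show "dual_bases_algebra K A B dual" by (rule dual_bases_algebra_axioms)
  show "gen Gen_s \<in> Hom AWC (up @ up) (up @ up)" "gen Gen_x \<in> Hom AWC up up"
    "a \<in> carrier A \<Longrightarrow> gen (Gen_beta a) \<in> Hom AWC up up" for a
    by (rule lifts_Hom, rule lifts_gens, assumption?)+
  note comp = lifts_ops(3)[OF _ _ HOL.refl] and id = lifts_ops(1)[of up]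
  note bl = lifts_ops(4)[OF lifts_gens(3) id HOL.refl HOL.refl] and br = lifts_ops(4)[OF id lifts_gens(3) HOL.refl HOL.refl]
  note xl = lifts_ops(4)[OF lifts_gens(2) id HOL.refl HOL.refl] and xr = lifts_ops(4)[OF id lifts_gens(2) HOL.refl HOL.refl]
  show "gen Gen_s \<cdot>\<^bsub>AWC\<^esub> gen Gen_s = Ident AWC (up @ up)"
    by (rule lifts_eqI[OF comp[OF lifts_gens(1) lifts_gens(1)] lifts_ops(1)]) (simp add: aw_relations_def Let_def)
  let ?l = "gen Gen_s \<boxtimes>\<^bsub>AWC\<^esub> Ident AWC up" and ?r = "Ident AWC up \<boxtimes>\<^bsub>AWC\<^esub> gen Gen_s"
  have l: "lifts ?l (fgen Gen_s \<boxtimes>\<^bsub>F.F\<^esub> Ident F.F up) (up @ up @ up) (up @ up @ up)"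
    by (rule lifts_ops(4)[OF lifts_gens(1) id]) simp_all
  have r: "lifts ?r (Ident F.F up \<boxtimes>\<^bsub>F.F\<^esub> fgen Gen_s) (up @ up @ up) (up @ up @ up)"
    by (rule lifts_ops(4)[OF id lifts_gens(1)]) simp_all
  show "?l \<cdot>\<^bsub>AWC\<^esub> ?r \<cdot>\<^bsub>AWC\<^esub> ?l = ?r \<cdot>\<^bsub>AWC\<^esub> ?l \<cdot>\<^bsub>AWC\<^esub> ?r"
    by (rule lifts_eqI[OF comp[OF comp[OF l r] l] comp[OF comp[OF r l] r]]) (simp add: aw_relations_def Let_def)
  show "gen (Gen_beta (c \<odot>\<^bsub>A\<^esub> a \<oplus>\<^bsub>A\<^esub> c' \<odot>\<^bsub>A\<^esub> b)) =
      AddM AWC (ScaleM AWC c (gen (Gen_beta a))) (ScaleM AWC c' (gen (Gen_beta b)))"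
    if c: "c \<in> carrier K" "c' \<in> carrier K" and ab: "a \<in> carrier A" "b \<in> carrier A" for c c' a b
    by (rule lifts_eqI[OF lifts_gens(3)[OF A_closed(1)[OF c ab]]
          lifts_ops(5)[OF lifts_ops(6)[OF c(1) lifts_gens(3)[OF ab(1)]] lifts_ops(6)[OF c(2) lifts_gens(3)[OF ab(2)]]]])
      (unfold aw_relations_def Let_def, use c ab in blast)
  show "gen (Gen_beta a) \<cdot>\<^bsub>AWC\<^esub> gen (Gen_beta b) = gen (Gen_beta (a \<otimes>\<^bsub>A\<^esub> b))"
    if ab: "a \<in> carrier A" "b \<in> carrier A" for a b
    by (rule lifts_eqI[OF comp[OF lifts_gens(3)[OF ab(1)] lifts_gens(3)[OF ab(2)]] lifts_gens(3)[OF A_closed(2)[OF ab]]])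
      (unfold aw_relations_def Let_def, use ab in blast)
  show "gen (Gen_beta \<one>\<^bsub>A\<^esub>) = Ident AWC up"
    by (rule lifts_eqI[OF lifts_gens(3)[OF A_closed(3)] id]) (simp add: aw_relations_def Let_def)
  show "gen Gen_s \<cdot>\<^bsub>AWC\<^esub> (gen (Gen_beta a) \<boxtimes>\<^bsub>AWC\<^esub> Ident AWC up) =
      (Ident AWC up \<boxtimes>\<^bsub>AWC\<^esub> gen (Gen_beta a)) \<cdot>\<^bsub>AWC\<^esub> gen Gen_s" if a: "a \<in> carrier A" for a
    by (rule lifts_eqI[OF comp[OF lifts_gens(1) bl[OF a]] comp[OF br[OF a] lifts_gens(1)]])
      (unfold aw_relations_def Let_def, use a in blast)
  show "DiffM K AWC ((gen Gen_x \<boxtimes>\<^bsub>AWC\<^esub> Ident AWC up) \<cdot>\<^bsub>AWC\<^esub> gen Gen_s) (gen Gen_s \<cdot>\<^bsub>AWC\<^esub> (Ident AWC up \<boxtimes>\<^bsub>AWC\<^esub> gen Gen_x)) =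
      (\<Oplus>\<^bsub>End_algebra AWC (up @ up)\<^esub>b\<in>B. gen (Gen_beta b) \<boxtimes>\<^bsub>AWC\<^esub> gen (Gen_beta (dual b)))"
  proof (rule lifts_eqI[OF lifts_ops(7)[OF comp[OF xl lifts_gens(1)] comp[OF lifts_gens(1) xr]]])
    show "lifts (\<Oplus>\<^bsub>End_algebra AWC (up @ up)\<^esub>b\<in>B. gen (Gen_beta b) \<boxtimes>\<^bsub>AWC\<^esub> gen (Gen_beta (dual b)))
        (\<Oplus>\<^bsub>End_algebra F.F (up @ up)\<^esub>b\<in>B. fgen (Gen_beta b) \<boxtimes>\<^bsub>F.F\<^esub> fgen (Gen_beta (dual b))) (up @ up) (up @ up)"
      by (rule lifts_sum[OF B(1) lifts_ops(4)[OF lifts_gens(3) lifts_gens(3) HOL.refl HOL.refl]])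
        (use B(2,3) in auto)
  qed (simp add: aw_relations_def Let_def)
  show "gen (Gen_beta a) \<cdot>\<^bsub>AWC\<^esub> gen Gen_x = gen Gen_x \<cdot>\<^bsub>AWC\<^esub> gen (Gen_beta a)" if a: "a \<in> carrier A" for a
    by (rule lifts_eqI[OF comp[OF lifts_gens(3)[OF a] lifts_gens(2)] comp[OF lifts_gens(2) lifts_gens(3)[OF a]]])
      (unfold aw_relations_def Let_def, use a in blast)
qed

interpretation W: affine_wreath_category K AWC A B dual up "gen Gen_s" "\<lambda>a. gen (Gen_beta a)" "gen Gen_x"
  by (rule AW_affine_wreath_category)

lemma N_eq: "W.N n = replicate n ()"
  by (induction n) (simp_all add: W.N_0 W.N_Suc AW_objects)

lemma N_length: "W.N (length X) = X"
  by (simp add: N_eq unit_list_eq)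

definition denote :: "(unit, 'a aw_gen, 'k) mterm \<Rightarrow> (unit, 'a aw_gen, 'k) mterm set set" where
  "denote f = Q.qc (F.tc f)"

lemma tc_Hom: "twf K S f \<Longrightarrow> F.tc f \<in> Hom F.F (tdom S f) (tcod S f)"
  by (rule F.represents_memI[OF F.represents_tclass HOL.refl HOL.refl])

lemma tc_ops:
  "F.tc (TId X) = Ident F.F X" "F.tc (TZero X Y) = ZeroM F.F X Y"
  "twf K S g \<Longrightarrow> twf K S f \<Longrightarrow> tdom S g = tcod S f \<Longrightarrow> F.tc (TComp g f) = F.tc g \<cdot>\<^bsub>F.F\<^esub> F.tc f"
  "twf K S g \<Longrightarrow> twf K S f \<Longrightarrow> F.tc (TTens g f) = F.tc g \<boxtimes>\<^bsub>F.F\<^esub> F.tc f"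
  "twf K S g \<Longrightarrow> twf K S f \<Longrightarrow> tdom S g = tdom S f \<Longrightarrow> tcod S g = tcod S f \<Longrightarrow>
    F.tc (TAdd g f) = AddM F.F (F.tc g) (F.tc f)"
  "c \<in> carrier K \<Longrightarrow> twf K S f \<Longrightarrow> F.tc (TScale c f) = ScaleM F.F c (F.tc f)"
  using F.represents_Ident[of X] F.represents_zero[of X Y]
    F.represents_comp[OF F.represents_tclass F.represents_tclass, of g f]
    F.represents_tens[OF F.represents_tclass F.represents_tclass, of g f]
    F.represents_add[OF F.represents_tclass F.represents_tclass, of g f]
    F.represents_scale[OF _ F.represents_tclass, of c f]
  by (simp_all add: F.represents_def)

lemma denote_Hom: "twf K S f \<Longrightarrow> denote f \<in> Hom AWC (tdom S f) (tcod S f)"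
  using tc_Hom[of f] by (auto simp: denote_def AW_eq Q.quot_Hom)

lemma denote_ops:
  "denote (TId X) = Ident AWC X" "denote (TZero X Y) = ZeroM AWC X Y" "denote (TGen y) = gen y"
  "twf K S g \<Longrightarrow> twf K S f \<Longrightarrow> tdom S g = tcod S f \<Longrightarrow> denote (TComp g f) = denote g \<cdot>\<^bsub>AWC\<^esub> denote f"
  "twf K S g \<Longrightarrow> twf K S f \<Longrightarrow> denote (TTens g f) = denote g \<boxtimes>\<^bsub>AWC\<^esub> denote f"
  "twf K S g \<Longrightarrow> twf K S f \<Longrightarrow> tdom S g = tdom S f \<Longrightarrow> tcod S g = tcod S f \<Longrightarrow>
    denote (TAdd g f) = AddM AWC (denote g) (denote f)"
  "c \<in> carrier K \<Longrightarrow> twf K S f \<Longrightarrow> denote (TScale c f) = ScaleM AWC c (denote f)"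
proof -
  show "denote (TId X) = Ident AWC X" "denote (TZero X Y) = ZeroM AWC X Y" "denote (TGen y) = gen y"
    by (simp_all add: denote_def tc_ops AW_eq Q.quot_simps AW_gen_eq free_cat_gen_def)
  show "denote (TComp g f) = denote g \<cdot>\<^bsub>AWC\<^esub> denote f"
    if "twf K S g" "twf K S f" "tdom S g = tcod S f"
    using Q.quot_comp[OF tc_Hom[OF that(1)], of "F.tc f" "tdom S f"] tc_Hom[OF that(2)] that
    by (simp add: denote_def tc_ops AW_eq)
  show "denote (TTens g f) = denote g \<boxtimes>\<^bsub>AWC\<^esub> denote f" if "twf K S g" "twf K S f"
    using Q.quot_tens[OF tc_Hom[OF that(1)] tc_Hom[OF that(2)]] that
    by (simp add: denote_def tc_ops AW_eq)
  show "denote (TAdd g f) = AddM AWC (denote g) (denote f)"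
    if "twf K S g" "twf K S f" "tdom S g = tdom S f" "tcod S g = tcod S f"
    using Q.quot_add[OF tc_Hom[OF that(1)], of "F.tc f"] tc_Hom[OF that(2)] that
    by (simp add: denote_def tc_ops AW_eq)
  show "denote (TScale c f) = ScaleM AWC c (denote f)" if "c \<in> carrier K" "twf K S f"
    using Q.quot_scale[OF that(1) tc_Hom[OF that(2)]] that
    by (simp add: denote_def tc_ops AW_eq)
qed

lemmas psi_props = algebra_hom_props[OF P_algebra W.End_assoc_algebra W.psi_hom]

lemma End_simps:
  "carrier (End_algebra AWC X) = Hom AWC X X" "f \<otimes>\<^bsub>End_algebra AWC X\<^esub> g = f \<cdot>\<^bsub>AWC\<^esub> g"
  "\<one>\<^bsub>End_algebra AWC X\<^esub> = Ident AWC X" "\<zero>\<^bsub>End_algebra AWC X\<^esub> = ZeroM AWC X X"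
  "f \<oplus>\<^bsub>End_algebra AWC X\<^esub> g = AddM AWC f g" "c \<odot>\<^bsub>End_algebra AWC X\<^esub> f = ScaleM AWC c f"
  by (simp_all add: End_algebra_def)

lemma psi_zero: "W.psi n \<zero>\<^bsub>P d\<^esub> = ZeroM AWC (W.N n) (W.N n)"
  using psi_props(6)[of n] ops_indep(5)[of d n] by (simp add: End_simps)

lemma emb_0: "f \<in> W.H m \<Longrightarrow> W.emb 0 f 0 = f"
  by (simp add: W.emb_def W.N_0 W.tens_unit_left W.tens_unit_right)

lemma endo_gens:
  "W.endo_t 1 1 = gen Gen_x" "a \<in> carrier A \<Longrightarrow> W.endo_u 1 1 a = gen (Gen_beta a)" "W.endo_s 2 1 = gen Gen_s"
  by (simp_all add: W.endo_t_def W.endo_u_def W.endo_s_def emb_0[OF W.gens_H(1)] emb_0[OF W.gens_H(2)]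
      emb_0[OF W.gens_H(3)])

lemma psi_gens:
  "W.psi 1 (t 1) = gen Gen_x" "a \<in> carrier A \<Longrightarrow> W.psi 1 (u 1 a) = gen (Gen_beta a)" "W.psi 2 (s 1) = gen Gen_s"
  by (subst W.psi_var; simp add: awp_gens_def W.endo_def endo_gens[simplified])+

text \<open>
  Terms that are not endomorphisms denote zero, for the reason given at \<open>phi\<close>. For endomorphisms,
  composition and linear structure are respected because \<open>psi\<close> is a homomorphism; for tensor products
  one writes \<open>f \<otimes> g\<close> as \<open>(f \<otimes> 1) \<circ> (1 \<otimes> g)\<close> and uses \<open>psi_shift\<close> and \<open>psi_mono\<close>.
\<close>

lemma denote_psi:
  "twf K S f \<Longrightarrow> denote f = (if cd f = dm f then W.psi (dm f) (phi f) else ZeroM AWC (tdom S f) (tcod S f))"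
proof (induction f)
  case (TId X)
  then show ?case using psi_props(5)[of "length X"] by (simp add: denote_ops N_length End_simps)
next
  case (TGen y)
  then consider "y = Gen_s" | "y = Gen_x" | a where "y = Gen_beta a" "a \<in> carrier A"
    by (auto simp: aw_sig_def)
  then show ?case
    by cases (simp_all add: denote_ops gens_dom psi_gens[simplified] numeral_2_eq_2[symmetric])
next
  case (TComp g f)
  then have wf: "twf K S g" "twf K S f" and d: "tdom S g = tcod S f" by auto
  note g = denote_Hom[OF wf(1)] and f = denote_Hom[OF wf(2)]
  have eq: "denote (TComp g f) = denote g \<cdot>\<^bsub>AWC\<^esub> denote f" by (rule denote_ops(4)[OF wf d])
  show ?case
  proof (cases "cd f = dm f")
    case True
    then have dd: "tcod S f = tdom S f" by (simp add: unit_list_eq)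
    show ?thesis
    proof (cases "cd g = dm g")
      case True
      then have "denote g = W.psi (dm f) (phi g)" "denote f = W.psi (dm f) (phi f)"
        using TComp.IH wf d dd by simp_all
      moreover have "W.psi (dm f) (phi g \<otimes>\<^bsub>P (dm f)\<^esub> phi f) = W.psi (dm f) (phi g) \<cdot>\<^bsub>AWC\<^esub> W.psi (dm f) (phi f)"
        using psi_props(2)[of "phi g" "dm f" "phi f"] phi_closed[OF wf(1)] phi_closed[OF wf(2)] d dd
        by (simp add: End_simps)
      ultimately show ?thesis using eq True d dd by simp
    next
      case False
      then have "denote g = ZeroM AWC (tdom S g) (tcod S g)" using TComp.IH wf by simp
      then show ?thesis using eq False d dd W.comp_zero_left[OF f, of "tcod S g"] by simp
    qed
  next
    case False
    then have 0: "denote f = ZeroM AWC (tdom S f) (tcod S f)" using TComp.IH wf by simp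
    have "denote (TComp g f) = ZeroM AWC (tdom S f) (tcod S g)"
      unfolding eq 0 using W.comp_zero_right[OF g, of "tdom S f"] d by simp
    moreover have "phi (TComp g f) = \<zero>\<^bsub>P 0\<^esub>"
      using phi_zero[OF wf(2) False, of 0] P_mult_zero(1)[OF phi_closed[OF wf(1)], of _ 0 0] by simp
    moreover have "tcod S g = tdom S f" if "cd g = dm f"
      using that by (simp add: unit_list_eq)
    ultimately show ?thesis
      by (cases "cd g = dm f") (simp_all add: psi_zero N_length unit_list_eq[symmetric] del: phi.simps)
  qed
next
  case (TTens f g)
  then have wf: "twf K S f" "twf K S g" by auto
  let ?m = "dm f" and ?n = "dm g"
  note f = denote_Hom[OF wf(1)] and g = denote_Hom[OF wf(2)]
  have eq: "denote (TTens f g) = denote f \<boxtimes>\<^bsub>AWC\<^esub> denote g" by (rule denote_ops(5)[OF wf])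
  show ?case
  proof (cases "cd f = ?m \<and> cd g = ?n")
    case True
    then have IH: "denote f = W.psi ?m (phi f)" "denote g = W.psi ?n (phi g)"
      using TTens.IH wf by simp_all
    have H: "W.psi ?m (phi f) \<in> W.H ?m" "W.psi ?n (phi g) \<in> W.H ?n"
      using psi_props(1)[OF phi_closed[OF wf(1)]] psi_props(1)[OF phi_closed[OF wf(2)]] by (simp_all add: End_simps)
    have "W.psi (?m + ?n) (shift ?m ?n (phi f) \<otimes>\<^bsub>P (?m + ?n)\<^esub> phi g) =
        W.psi (?m + ?n) (shift ?m ?n (phi f)) \<cdot>\<^bsub>AWC\<^esub> W.psi (?m + ?n) (phi g)"
      using psi_props(2)[OF shift_phi[OF wf(1)] phi_mono[OF wf(2)]] by (simp add: End_simps)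
    also have "\<dots> = (W.psi ?m (phi f) \<boxtimes>\<^bsub>AWC\<^esub> W.one ?n) \<cdot>\<^bsub>AWC\<^esub> (W.one ?m \<boxtimes>\<^bsub>AWC\<^esub> W.psi ?n (phi g))"
      by (simp only: W.psi_shift[OF phi_closed[OF wf(1)]] W.psi_mono[OF phi_closed[OF wf(2)]])
    also have "\<dots> = W.psi ?m (phi f) \<boxtimes>\<^bsub>AWC\<^esub> W.psi ?n (phi g)"
      by (rule W.tens_commute(1)[OF H])
    finally show ?thesis using True eq IH by simp
  next
    case False
    have "denote (TTens f g) = ZeroM AWC (tdom S f @ tdom S g) (tcod S f @ tcod S g)"
    proof (cases "cd f = ?m")
      case True
      then have "denote g = ZeroM AWC (tdom S g) (tcod S g)" using False TTens.IH wf by simp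
      then show ?thesis using eq W.tens_zero_right[OF f, of "tdom S g" "tcod S g"] by (simp add: AW_objects)
    next
      case False
      then have "denote f = ZeroM AWC (tdom S f) (tcod S f)" using TTens.IH wf by simp
      then show ?thesis using eq W.tens_zero_left[OF g, of "tdom S f" "tcod S f"] by (simp add: AW_objects)
    qed
    moreover have "phi (TTens f g) = \<zero>\<^bsub>P 0\<^esub>"
    proof (cases "cd f = ?m")
      case True
      then have "phi g = \<zero>\<^bsub>P 0\<^esub>" using False phi_zero[OF wf(2), of 0] by simp
      then show ?thesis using P_mult_zero(1)[OF shift_phi[OF wf(1), of ?n], of _ 0 0] by simp
    next
      case False
      then have "shift ?m ?n (phi f) = \<zero>\<^bsub>P 0\<^esub>" using phi_zero[OF wf(1), of 0] shift_zero[of ?m ?n 0 0] by simp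
      then show ?thesis using P_mult_zero(2)[OF phi_mono[OF wf(2), of ?m], of _ 0 0] by simp
    qed
    moreover have "W.N (?m + ?n) = tcod S f @ tcod S g" "W.N (?m + ?n) = tdom S f @ tdom S g"
      if "cd f + cd g = ?m + ?n"
      using that N_length[of "tdom S f @ tdom S g"] N_length[of "tcod S f @ tcod S g"] by simp_all
    ultimately show ?thesis by (simp add: psi_zero del: phi.simps)
  qed
next
  case (TZero X Y)
  then show ?case using N_length[of X] N_length[of Y] by (auto simp: denote_ops psi_zero)
next
  case (TAdd f g)
  then have wf: "twf K S f" "twf K S g" and d: "tdom S f = tdom S g" "tcod S f = tcod S g" by auto
  have eq: "denote (TAdd f g) = AddM AWC (denote f) (denote g)" by (rule denote_ops(6)[OF wf d])
  show ?case
  proof (cases "cd f = dm f")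
    case True
    have "phi g \<in> carrier (P (dm f))" using phi_closed[OF wf(2)] d by simp
    then have "W.psi (dm f) (phi f \<oplus>\<^bsub>P (dm f)\<^esub> phi g) = AddM AWC (W.psi (dm f) (phi f)) (W.psi (dm f) (phi g))"
      using psi_props(3)[OF phi_closed[OF wf(1)]] by (simp add: End_simps)
    then show ?thesis using TAdd.IH wf d True eq by simp
  next
    case False
    then show ?thesis using TAdd.IH wf d eq W.add_zero[OF W.zero_Hom] by simp
  qed
next
  case (TScale c f)
  then have wf: "twf K S f" and c: "c \<in> carrier K" by auto
  have eq: "denote (TScale c f) = ScaleM AWC c (denote f)" by (rule denote_ops(7)[OF c wf])
  show ?case
  proof (cases "cd f = dm f")
    case True
    then show ?thesis
      using TScale.IH wf eq psi_props(7)[OF c phi_closed[OF wf]] by (simp add: End_simps)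
  next
    case False
    interpret M: module K "Hom_module AWC (tdom S f) (tcod S f)" by (rule W.Hom_module)
    have "ScaleM AWC c (ZeroM AWC (tdom S f) (tcod S f)) = ZeroM AWC (tdom S f) (tcod S f)"
      using M.smult_r_null[OF c] by (simp add: Hom_module_simps)
    then show ?thesis using TScale.IH wf False eq by simp
  qed
qed

text \<open>
  The term is the generating morphism between identity strands; the \<open>i - 1\<close> strands on its right raise
  the strand number from \<open>1\<close> to \<open>i\<close>.
\<close>

lemma gen_term:
  assumes "y \<in> awp_gens A d"
  shows "\<exists>f. twf K S f \<and> dm f = d \<and> cd f = d \<and> phi f = free_var K y"
proof -
  let ?strand = "\<lambda>p g q. TTens (TTens (TId (replicate p ())) (TGen g)) (TId (replicate q ()))"
  have phi: "phi (?strand p g q) = shift (p + length (Src S g)) q (phi (TGen g))" if "g \<in> Gens S" for p g q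
    using phi_tens_id_right[of "TTens (TId (replicate p ())) (TGen g)" "replicate q ()"]
      phi_tens_id_left[of "TGen g" "replicate p ()"] that by (simp del: phi.simps)
  consider i where "y = Var_t i" "i \<in> {1..d}" | i a where "y = Var_u i a" "i \<in> {1..d}" "a \<in> carrier A"
    | i where "y = Var_s i" "i \<in> {1..<d}"
    using assms by (auto simp: awp_gens_def)
  then show ?thesis
  proof cases
    case 1
    have "phi (?strand (d - i) Gen_x (i - 1)) = t i"
      using 1 shift_gens(1)[of 1 "d - i + 1" "i - 1"]
      by (subst phi) (auto simp: gens_S gens_dom simp del: replicate.simps)
    then show ?thesis using 1
      by (intro exI[of _ "?strand (d - i) Gen_x (i - 1)"]) (auto simp: gens_S gens_dom simp del: phi.simps)
  next
    case 2
    have "phi (?strand (d - i) (Gen_beta a) (i - 1)) = u i a"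
      using 2 shift_gens(2)[of 1 "d - i + 1" a "i - 1"]
      by (subst phi) (auto simp: gens_S gens_dom)
    then show ?thesis using 2
      by (intro exI[of _ "?strand (d - i) (Gen_beta a) (i - 1)"]) (auto simp: gens_S gens_dom simp del: phi.simps)
  next
    case 3
    have "phi (?strand (d - 1 - i) Gen_s (i - 1)) = s i"
      using 3 shift_gens(3)[of 1 "d - 1 - i + 2" "i - 1"]
      by (subst phi) (auto simp: gens_S gens_dom numeral_2_eq_2)
    then show ?thesis using 3
      by (intro exI[of _ "?strand (d - 1 - i) Gen_s (i - 1)"]) (auto simp: gens_S gens_dom simp del: phi.simps)
  qed
qed

lemma phi_surj:
  assumes "p \<in> carrier (P d)"
  shows "\<exists>f. twf K S f \<and> dm f = d \<and> cd f = d \<and> phi f = p"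
  using assms
proof (induction p rule: cring.free_algebra_induct[OF K, consumes 1])
  case 1
  show ?case by (intro exI[of _ "TZero (replicate d ()) (replicate d ())"]) simp
next
  case 2
  show ?case by (intro exI[of _ "TId (replicate d ())"]) simp
next
  case (3 y p)
  from gen_term[OF 3(1)] obtain g where g: "twf K S g" "dm g = d" "cd g = d" "phi g = free_var K y" by blast
  from 3(3) obtain f where f: "twf K S f" "dm f = d" "cd f = d" "phi f = p" by blast
  show ?case using f g by (intro exI[of _ "TComp g f"]) (simp add: unit_list_eq)
next
  case (4 p q)
  from 4(3) obtain f where f: "twf K S f" "dm f = d" "cd f = d" "phi f = p" by blast
  from 4(4) obtain g where g: "twf K S g" "dm g = d" "cd g = d" "phi g = q" by blast
  show ?case using f g by (intro exI[of _ "TAdd f g"]) (simp add: unit_list_eq)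
next
  case (5 c p)
  from 5(3) obtain f where f: "twf K S f" "dm f = d" "cd f = d" "phi f = p" by blast
  show ?case using f 5(1) by (intro exI[of _ "TScale c f"]) simp
qed

text \<open>
  Surjectivity comes from \<open>denote_psi\<close>. If \<open>psi d p\<close> is zero, a term with value \<open>p\<close> denotes zero, so its
  difference to the zero term lies in the tensor ideal and \<open>ideal_vanishes\<close> applies to it.
\<close>

theorem End_presentation:
  "presented_by K (End_algebra AWC (tens_pow_obj AWC up d)) (awp_gens A d) (R d) (awp_endo K A B dual d)"
proof (rule presented_byI[OF K W.End_assoc_algebra W.psi_hom R_carrier])
  show "W.psi d r = \<zero>\<^bsub>End_algebra AWC (W.N d)\<^esub>" if "r \<in> R d" for r
    using W.psi_relations[OF that] by (simp add: End_simps)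
  show "W.psi d (free_var K y) = awp_endo K A B dual d y" if "y \<in> awp_gens A d" for y
    unfolding W.psi_var[OF that]
    by (cases y) (simp_all add: awp_endo_def Let_def W.endo_def W.endo_t_def W.endo_u_def W.endo_s_def
        W.emb_def W.tens_pow_Ident)
  show "\<exists>p\<in>carrier (P d). W.psi d p = M" if "M \<in> carrier (End_algebra AWC (W.N d))" for M
  proof -
    have "Hom AWC X X = Q.qc ` Hom F.F X X" for X
      by (simp add: AW_eq Q.quot_Hom)
    then have "M \<in> Q.qc ` Hom F.F (W.N d) (W.N d)"
      using that by (simp add: End_simps)
    then obtain L where L: "L \<in> Hom F.F (W.N d) (W.N d)" "M = Q.qc L" by blast
    obtain f where f: "twf K S f" "F.represents L f" "W.N d = tdom S f" "W.N d = tcod S f"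
      by (rule F.represents_memE[OF L(1)])
    have d: "dm f = d" "cd f = d" using f(3,4) by (simp_all add: f(3,4)[symmetric] N_eq)
    have "M = denote f" using L(2) f(2) by (simp add: denote_def F.represents_def)
    also have "\<dots> = W.psi d (phi f)" using denote_psi[OF f(1)] d by simp
    finally show ?thesis using phi_closed[OF f(1)] d by auto
  qed
  show "p \<in> Idl\<^bsub>P d\<^esub> (R d)" if p: "p \<in> carrier (P d)" and 0: "W.psi d p = \<zero>\<^bsub>End_algebra AWC (W.N d)\<^esub>" for p
  proof -
    obtain f where f: "twf K S f" "dm f = d" "cd f = d" "phi f = p" using phi_surj[OF p] by blast
    have X: "tdom S f = W.N d" "tcod S f = W.N d"
      using f(2,3) N_length[of "tdom S f"] N_length[of "tcod S f"] by simp_all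
    let ?z = "TZero (W.N d) (W.N d)"
    have "denote f = denote ?z"
      using denote_psi[OF f(1)] f 0 by (simp add: denote_ops End_simps)
    then have "Q.cong (F.tc f) (F.tc ?z)"
      unfolding denote_def using tc_Hom[OF f(1)] tc_Hom[of ?z] by (intro Q.qc_eqD) (auto intro: Hom_Mor)
    then have I: "DiffM K F.F (F.tc f) (F.tc ?z) \<in> aw_ideal K A B dual"
      by (simp add: Q.cong_def aw_ideal_def)
    have zwf: "twf K S ?z" by simp
    have dz: "tdom S f = tdom S ?z" "tcod S f = tcod S ?z" using X by simp_all
    have "phi (TAdd f (TScale (\<ominus>\<^bsub>K\<^esub> \<one>\<^bsub>K\<^esub>) ?z)) \<in> awp_ideal d"
      using vanishesD[OF ideal_vanishes[OF I] represents_diff[OF F.represents_tclass[OF f(1)] F.represents_tclass[OF zwf] dz]]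
      by (simp only: tdom.simps f(2))
    then have "phi f \<ominus>\<^bsub>P d\<^esub> phi ?z \<in> awp_ideal d"
      using phi_diff[OF f(1) zwf dz(1)] f(2) by (simp only:)
    moreover have "phi ?z = \<zero>\<^bsub>P d\<^esub>" by (simp add: N_eq)
    ultimately have "cls d p = cls d \<zero>\<^bsub>P d\<^esub>"
      using cls_eq_iff[OF p P_closed(5)] f(4) by simp
    then show ?thesis using cls_zero_iff[OF p] by (simp add: awp_ideal_def)
  qed
qed

end

theorem proposition6p2:
  fixes K :: "('k, 'e) ring_scheme"
    and A :: "('k, 'a, 'f) module_scheme"
    and tr :: "'a \<Rightarrow> 'k"
    and B :: "'a set"
    and dual :: "'a \<Rightarrow> 'a"
    and d :: nat
  assumes "cring K"
    and "assoc_algebra K A"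
    and "tr \<in> carrier A \<rightarrow> carrier K"
    and "\<And>a b. a \<in> carrier A \<Longrightarrow> b \<in> carrier A \<Longrightarrow> tr (a \<oplus>\<^bsub>A\<^esub> b) = tr a \<oplus>\<^bsub>K\<^esub> tr b"
    and "\<And>c a. c \<in> carrier K \<Longrightarrow> a \<in> carrier A \<Longrightarrow> tr (c \<odot>\<^bsub>A\<^esub> a) = c \<otimes>\<^bsub>K\<^esub> tr a"
    and "finite_basis K A B (\<lambda>b. b)"
    and "finite_basis K A B dual"
    and "\<And>a b. a \<in> carrier A \<Longrightarrow> b \<in> carrier A \<Longrightarrow> tr (a \<otimes>\<^bsub>A\<^esub> b) = tr (b \<otimes>\<^bsub>A\<^esub> a)"
    and "\<And>a b. a \<in> B \<Longrightarrow> b \<in> B \<Longrightarrow>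
           tr (dual a \<otimes>\<^bsub>A\<^esub> b) = (if a = b then \<one>\<^bsub>K\<^esub> else \<zero>\<^bsub>K\<^esub>)"
  shows "presented_by K (End_algebra (AW K A B dual) (tens_pow_obj (AW K A B dual) up d))
           (awp_gens A d) (awp_relations K A B dual d) (awp_endo K A B dual d)"
proof -
  have "dual_bases_algebra K A B dual"
    using assms(1,2,6,7) by (auto simp: dual_bases_algebra_def finite_basis_def)
  then show ?thesis by (rule dual_bases_algebra.End_presentation)
qed

end
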